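(* In the setting of the context, assume that $(\gamma_n)_{n\ge0}$ and $(\eta_n)_{n\ge1}$ satisfy the step-weight assumption (SW), and that there exists an almost surely finite random variable $n_1$ such that $\tilde\gamma_n=\gamma_n$ for every $n\ge n_1$. Suppose that there exists $K>0$ such that $$\forall n\ge1,\quad|X_n-X_{n-1}|\le K\sqrt{\gamma_n}\,\sqrt{V(X_{n-1})}\,\bigl(1+|U_n|\bigr),$$ and a nonnegative function $W$ on $\mathbb{R}^d$ such that: there exist $\alpha>0$, $\beta>0$, $n_0\in\mathbb{N}$ with $$\forall n\ge n_0,\quad\frac{\mathbb{E}\bigl[W(X_{n+1})\,|\,\mathcal{F}_n\bigr]-W(X_n)}{\tilde\gamma_{n+1}}\le-\alpha W(X_n)+\beta;$$ $V=o(W)$ as $|x|\to+\infty$; and $\sup_{n\ge1}\nu_n^\eta(W)<+\infty$ almost surely. Then for every twice continuously differentiable function $f:\mathbb{R}^d\to\mathbb{R}$ with compact support, $$\lim_{n\to\infty}\nu_n^\eta(\mathcal{A}f)=0\quad\text{a.s.}$$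
   Context: **Diffusion.** $b:\mathbb{R}^d\to\mathbb{R}^d$ and $\sigma:\mathbb{R}^d\to\mathbb{R}^{d\times m}$ are locally Lipschitz. $\mathcal{A}$ is the infinitesimal generator of $dx_t=b(x_t)dt+\sigma(x_t)dB_t$ ($B$ an $m$-dimensional Brownian motion): $\mathcal{A}f=\langle\nabla f,b\rangle+\frac12\mathrm{Tr}(\sigma^*D^2f\,\sigma)$. **Standing assumption on $V$.** $V:\mathbb{R}^d\to[1,+\infty)$ is $C^2$ with $V(x)\to+\infty$ as $|x|\to+\infty$ and: for some $\alpha_V,\beta_V>0$, $\langle\nabla V,b\rangle\le-\alpha_VV+\beta_V$; for some $C_{V,\sigma}>0$ and $a\in(0,1]$, $\mathrm{Tr}(\sigma^*(\nabla V)^{\otimes2}\sigma)\le C_{V,\sigma}V^{2-a}$; and for some $C>0$, $\sup_x\mathrm{Tr}(\sigma^*D^2V\sigma)(x)\le C\sup_x\mathrm{Tr}(\sigma^*\sigma)(x)$. **Noise.** $(U_n)_{n\ge1}$ are i.i.d. $\mathbb{R}^m$-valued random variables with $\mathrm{var}(U_1)=\mathrm{Id}_m$ and, for some $\kappa>0$, $\mathbb{E}[\exp\langle\theta,U_1\rangle]\le\exp(\kappa|\theta|^2/2)$ for all $\theta\in\mathbb{R}^m$ (so $U_1$ is centered). $\mathcal{F}_n=\sigma(U_1,\dots,U_n)$, $\mathcal{F}_0$ trivial. **Scheme.** $(\gamma_n)_{n\ge0}$ is a deterministic nonincreasing sequence of positive numbers with $\lim_n\gamma_n=0$ and $\sum_n\gamma_n=+\infty$;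 $(\chi_n)_{n\ge0}$ is an $(\mathcal{F}_n)$-adapted sequence of positive random variables; $\tilde\gamma_0=\gamma_0$ and $\tilde\gamma_n=\gamma_n\wedge\chi_{n-1}$ for $n\ge1$. From a deterministic $X_0=x_0\in\mathbb{R}^d$, $$X_{n+1}=X_n+\tilde\gamma_{n+1}b(X_n)+\sqrt{\tilde\gamma_{n+1}}\,\sigma(X_n)U_{n+1},\quad n\ge0.$$ **Weighted empirical measures.** $(\eta_n)_{n\ge1}$ is a sequence of positive numbers with $\sum_n\eta_n=+\infty$, $H_n=\sum_{k=1}^n\eta_k$, and $\nu_n^\eta=\frac1{H_n}\sum_{k=1}^n\eta_k\delta_{X_{k-1}}$. **Assumption (SW).** With $\Delta\frac{\eta_k}{\gamma_k}=\frac{\eta_k}{\gamma_k}-\frac{\eta_{k-1}}{\gamma_{k-1}}$ (convention $\eta_0=0$) and $x_+=\max(x,0)$: - $\lim_n\frac1{H_n}\sum_{k=1}^n\bigl|\Delta\frac{\eta_k}{\gamma_k}\bigr|=0$; - $\Bigl(\frac1{\gamma_nH_n}\bigl(\Delta\frac{\eta_n}{\gamma_n}\bigr)_+\Bigr)_n$ is nonincreasing and $\sum_n\frac1{H_n}\bigl(\Delta\frac{\eta_n}{\gamma_n}\bigr)_+<+\infty$; - there is $s\in(1,2]$ such that $\Bigl(\frac1{\gamma_n}\bigl(\frac{\eta_n}{H_n\sqrt{\gamma_n}}\bigr)^s\Bigr)_n$ is nonincreasing and $\sum_n\bigl(\frac{\eta_n}{H_n\sqrt{\gamma_n}}\bigr)^s<+\infty$.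 Functions $W$ are Borel measurable; (in)equalities between random variables hold almost surely. *)

theory Defs
  imports "HOL-Probability.Probability" "HOL-Library.Landau_Symbols"
begin

definition grad :: "(real ^ 'd \<Rightarrow> real) \<Rightarrow> real ^ 'd \<Rightarrow> real ^ 'd" where
  "grad f x = (\<chi> i. frechet_derivative f (at x) (axis i 1))"

definition hessian :: "(real ^ 'd \<Rightarrow> real) \<Rightarrow> real ^ 'd \<Rightarrow> real ^ 'd ^ 'd" where
  "hessian f x = jacobian (grad f) (at x)"

(* Continuity of f and of its gradient is implied by differentiability. *)
definition C2 :: "(real ^ 'd \<Rightarrow> real) \<Rightarrow> bool" where
  "C2 f \<longleftrightarrow> (\<forall>x. f differentiable (at x)) \<and> (\<forall>x. grad f differentiable (at x)) \<and>
     continuous_on UNIV (hessian f)"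

lemma grad_GDERIV:
  assumes "f differentiable (at x)"
  shows "GDERIV f x :> grad f x"
proof -
  have D: "(f has_derivative frechet_derivative f (at x)) (at x)"
    using assms by (simp add: frechet_derivative_works)
  then interpret linear "frechet_derivative f (at x)"
    by (rule has_derivative_linear)
  have "frechet_derivative f (at x) h = h \<bullet> grad f x" for h
  proof -
    have "frechet_derivative f (at x) h = frechet_derivative f (at x) (\<Sum>i\<in>UNIV. h $ i *\<^sub>R axis i 1)"
      using basis_expansion[of h] by (simp add: scalar_mult_eq_scaleR)
    also have "\<dots> = (\<Sum>i\<in>UNIV. h $ i * frechet_derivative f (at x) (axis i 1))"
      by (simp add: sum scaleR)
    finally show ?thesis
      by (simp add: grad_def inner_vec_def)
  qed
  then have "frechet_derivative f (at x) = (\<lambda>h. h \<bullet> grad f x)" ..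
  then show ?thesis
    using D by (simp add: gderiv_def)
qed

definition generator ::
  "(real ^ 'd \<Rightarrow> real ^ 'd) \<Rightarrow> (real ^ 'd \<Rightarrow> real ^ 'm ^ 'd) \<Rightarrow> (real ^ 'd \<Rightarrow> real) \<Rightarrow> real ^ 'd \<Rightarrow> real"
where
  "generator b \<sigma> f x =
     grad f x \<bullet> b x + 1 / 2 * trace (transpose (\<sigma> x) ** hessian f x ** \<sigma> x)"

definition outer_square :: "real ^ 'd \<Rightarrow> real ^ 'd ^ 'd" where
  "outer_square v = (\<chi> i j. v $ i * v $ j)"

(* The suprema in the last condition may be infinite, hence are taken in ereal. *)
definition lyapunov ::
  "(real ^ 'd \<Rightarrow> real ^ 'd) \<Rightarrow> (real ^ 'd \<Rightarrow> real ^ 'm ^ 'd) \<Rightarrow> (real ^ 'd \<Rightarrow> real) \<Rightarrow> bool"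
where
  "lyapunov b \<sigma> V \<longleftrightarrow>
     (\<forall>x. V x \<ge> 1) \<and> C2 V \<and> filterlim V at_top at_infinity \<and>
     (\<exists>\<alpha>>0. \<exists>\<beta>>0. \<forall>x. grad V x \<bullet> b x \<le> - \<alpha> * V x + \<beta>) \<and>
     (\<exists>C>0. \<exists>a\<in>{0<..1}. \<forall>x.
        trace (transpose (\<sigma> x) ** outer_square (grad V x) ** \<sigma> x) \<le> C * V x powr (2 - a)) \<and>
     (\<exists>C>0. (SUP x. ereal (trace (transpose (\<sigma> x) ** hessian V x ** \<sigma> x)))
              \<le> ereal C * (SUP x. ereal (trace (transpose (\<sigma> x) ** \<sigma> x))))"

definition covariance_matrix :: "'a measure \<Rightarrow> ('a \<Rightarrow> real ^ 'm) \<Rightarrow> real ^ 'm ^ 'm" where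
  "covariance_matrix M Z =
     (\<chi> i j. LINT \<omega>|M. (Z \<omega> $ i - (LINT \<omega>'|M. Z \<omega>' $ i)) * (Z \<omega> $ j - (LINT \<omega>'|M. Z \<omega>' $ j)))"

(* The noise is indexed from 1; U 0 is never used.  The exponential moments are
   Lebesgue integrals with values in ennreal, so that the bound entails finiteness. *)
definition subgaussian_noise :: "'a measure \<Rightarrow> (nat \<Rightarrow> 'a \<Rightarrow> real ^ 'm) \<Rightarrow> bool" where
  "subgaussian_noise M U \<longleftrightarrow>
     prob_space.indep_vars M (\<lambda>_. borel) U {1..} \<and>
     (\<forall>n\<ge>1. distr M borel (U n) = distr M borel (U 1)) \<and>
     covariance_matrix M (U 1) = mat 1 \<and>
     (\<exists>\<kappa>>0. \<forall>\<theta>. (\<integral>\<^sup>+ \<omega>. ennreal (exp (\<theta> \<bullet> U 1 \<omega>)) \<partial>M) \<le> ennreal (exp (\<kappa> * (norm \<theta>)\<^sup>2 / 2)))"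

definition noise_filtration :: "'a measure \<Rightarrow> (nat \<Rightarrow> 'a \<Rightarrow> real ^ 'm) \<Rightarrow> nat \<Rightarrow> 'a measure" where
  "noise_filtration M U n =
     sigma (space M) (\<Union>k\<in>{1..n}. {U k -` A \<inter> space M | A. A \<in> sets borel})"

fun capped_step :: "(nat \<Rightarrow> real) \<Rightarrow> (nat \<Rightarrow> 'a \<Rightarrow> real) \<Rightarrow> nat \<Rightarrow> 'a \<Rightarrow> real" where
  "capped_step \<gamma> cap 0 \<omega> = \<gamma> 0"
| "capped_step \<gamma> cap (Suc n) \<omega> = min (\<gamma> (Suc n)) (cap n \<omega>)"

definition step_sequence :: "(nat \<Rightarrow> real) \<Rightarrow> bool" where
  "step_sequence \<gamma> \<longleftrightarrow> (\<forall>n. \<gamma> n > 0) \<and> decseq \<gamma> \<and> \<gamma> \<longlonglongrightarrow> 0 \<and> \<not> summable \<gamma>"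

definition step_caps ::
  "'a measure \<Rightarrow> (nat \<Rightarrow> 'a \<Rightarrow> real ^ 'm) \<Rightarrow> (nat \<Rightarrow> 'a \<Rightarrow> real) \<Rightarrow> bool"
where
  "step_caps M U cap \<longleftrightarrow>
     (\<forall>n. cap n \<in> borel_measurable (noise_filtration M U n) \<and> (AE \<omega> in M. cap n \<omega> > 0))"

definition euler_scheme ::
  "'a measure \<Rightarrow> (real ^ 'd \<Rightarrow> real ^ 'd) \<Rightarrow> (real ^ 'd \<Rightarrow> real ^ 'm ^ 'd) \<Rightarrow> (nat \<Rightarrow> real) \<Rightarrow>
   (nat \<Rightarrow> 'a \<Rightarrow> real) \<Rightarrow> (nat \<Rightarrow> 'a \<Rightarrow> real ^ 'm) \<Rightarrow> real ^ 'd \<Rightarrow> (nat \<Rightarrow> 'a \<Rightarrow> real ^ 'd) \<Rightarrow> bool"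
where
  "euler_scheme M b \<sigma> \<gamma> cap U x\<^sub>0 X \<longleftrightarrow>
     (\<forall>n. X n \<in> borel_measurable M) \<and>
     (AE \<omega> in M. X 0 \<omega> = x\<^sub>0) \<and>
     (\<forall>n. AE \<omega> in M. X (n + 1) \<omega> =
        X n \<omega> + capped_step \<gamma> cap (n + 1) \<omega> *\<^sub>R b (X n \<omega>)
              + sqrt (capped_step \<gamma> cap (n + 1) \<omega>) *\<^sub>R (\<sigma> (X n \<omega>) *v U (n + 1) \<omega>))"

(* The weights are indexed from 1; the value 0 at index 0 is the convention
   used in the increments of the ratio below. *)
definition weight_sequence :: "(nat \<Rightarrow> real) \<Rightarrow> bool" where
  "weight_sequence \<eta> \<longleftrightarrow> \<eta> 0 = 0 \<and> (\<forall>n\<ge>1. \<eta> n > 0) \<and> \<not> summable \<eta>"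

definition weight_total :: "(nat \<Rightarrow> real) \<Rightarrow> nat \<Rightarrow> real" where
  "weight_total \<eta> n = (\<Sum>k=1..n. \<eta> k)"

definition ratio_increment :: "(nat \<Rightarrow> real) \<Rightarrow> (nat \<Rightarrow> real) \<Rightarrow> nat \<Rightarrow> real" where
  "ratio_increment \<eta> \<gamma> k = \<eta> k / \<gamma> k - \<eta> (k - 1) / \<gamma> (k - 1)"

(* Monotonicity is required from index 1 on: weight_total vanishes at 0. *)
definition step_weight :: "(nat \<Rightarrow> real) \<Rightarrow> (nat \<Rightarrow> real) \<Rightarrow> bool" where
  "step_weight \<gamma> \<eta> \<longleftrightarrow>
     (\<lambda>n. 1 / weight_total \<eta> n * (\<Sum>k=1..n. \<bar>ratio_increment \<eta> \<gamma> k\<bar>)) \<longlonglongrightarrow> 0 \<and>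
     antimono_on {1..} (\<lambda>n. 1 / (\<gamma> n * weight_total \<eta> n) * max (ratio_increment \<eta> \<gamma> n) 0) \<and>
     summable (\<lambda>n. 1 / weight_total \<eta> n * max (ratio_increment \<eta> \<gamma> n) 0) \<and>
     (\<exists>s\<in>{1<..2}.
        antimono_on {1..} (\<lambda>n. 1 / \<gamma> n * (\<eta> n / (weight_total \<eta> n * sqrt (\<gamma> n))) powr s) \<and>
        summable (\<lambda>n. (\<eta> n / (weight_total \<eta> n * sqrt (\<gamma> n))) powr s))"

(* The weighted sum of Dirac masses, as the image under k \<mapsto> X (k - 1) \<omega> of the measure
   giving mass \<eta> k / H n to each k in {1..n}. *)
definition empirical_measure ::
  "(nat \<Rightarrow> real) \<Rightarrow> (nat \<Rightarrow> 'a \<Rightarrow> real ^ 'd) \<Rightarrow> nat \<Rightarrow> 'a \<Rightarrow> (real ^ 'd) measure"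
where
  "empirical_measure \<eta> X n \<omega> =
     distr (point_measure {1..n} (\<lambda>k. ennreal (\<eta> k / weight_total \<eta> n))) borel (\<lambda>k. X (k - 1) \<omega>)"

lemma sets_empirical_measure [simp, measurable_cong]: "sets (empirical_measure \<eta> X n \<omega>) = sets borel"
  by (simp add: empirical_measure_def)

lemma weight_total_nonneg: "weight_sequence \<eta> \<Longrightarrow> 0 \<le> weight_total \<eta> n"
  unfolding weight_total_def weight_sequence_def by (intro sum_nonneg) (auto intro: less_imp_le)

lemma emeasure_empirical_measure:
  assumes "A \<in> sets borel"
  shows "emeasure (empirical_measure \<eta> X n \<omega>) A =
    (\<Sum>k=1..n. ennreal (\<eta> k / weight_total \<eta> n) * indicator A (X (k - 1) \<omega>))"
proof -
  have "emeasure (empirical_measure \<eta> X n \<omega>) A =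
      (\<integral>\<^sup>+ x. indicator A x \<partial>empirical_measure \<eta> X n \<omega>)"
    using assms by simp
  also have "\<dots> = (\<Sum>k=1..n. ennreal (\<eta> k / weight_total \<eta> n) * indicator A (X (k - 1) \<omega>))"
    using assms unfolding empirical_measure_def
    by (subst nn_integral_distr) (auto simp: nn_integral_point_measure_finite mult.commute)
  finally show ?thesis .
qed

lemma integral_empirical_measure:
  fixes g :: "real ^ 'd \<Rightarrow> real"
  assumes "weight_sequence \<eta>" and "g \<in> borel_measurable borel"
  shows "(LINT x|empirical_measure \<eta> X n \<omega>. g x) =
    1 / weight_total \<eta> n * (\<Sum>k=1..n. \<eta> k * g (X (k - 1) \<omega>))"
proof -
  have nn: "0 \<le> \<eta> k / weight_total \<eta> n" if "k \<in> {1..n}" for k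
    using that assms(1)
    by (intro divide_nonneg_nonneg weight_total_nonneg[OF assms(1)])
       (auto simp: weight_sequence_def intro: less_imp_le)
  show ?thesis
    unfolding empirical_measure_def using assms(2) nn
    by (subst integral_distr, simp, simp, subst lebesgue_integral_point_measure_finite)
       (simp_all add: sum_distrib_left)
qed

end

theory Submission
  imports Defs
begin

text \<open>
  Let \<open>q\<^sub>k = \<eta>\<^sub>k / \<gamma>\<^sub>k\<close> and \<open>H\<^sub>n = \<eta>\<^sub>1 + \<dots> + \<eta>\<^sub>n\<close>, and let \<open>P\<^sub>k\<close> be the transition kernel of one
  Euler step of length \<open>\<gamma>\<^sub>k\<close>. For all \<open>k\<close>, the term \<open>\<eta>\<^sub>k \<A>f (X\<^sub>k\<^sub>-\<^sub>1)\<close> equals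
  \<open>q\<^sub>k (f (X\<^sub>k) - f (X\<^sub>k\<^sub>-\<^sub>1)) - q\<^sub>k (f (X\<^sub>k) - P\<^sub>k f (X\<^sub>k\<^sub>-\<^sub>1)) - \<eta>\<^sub>k r\<^sub>k\<close>,
  where \<open>r\<^sub>k = (P\<^sub>k f - f) (X\<^sub>k\<^sub>-\<^sub>1) / \<gamma>\<^sub>k - \<A>f (X\<^sub>k\<^sub>-\<^sub>1)\<close>. The \<open>H\<^sub>n\<close>-averages of the three parts vanish.
  The first is a summation by parts. The second is, from the random index \<open>n\<^sub>1\<close> on, a sum of
  martingale differences; after division by \<open>H\<^sub>k\<close> their variances are summable, because the jump
  bound controls them by \<open>V\<close>, hence by \<open>1 + W\<close>, and the drift condition on \<open>W\<close> makes the
  corresponding series of expectations converge; Kronecker's lemma concludes. For the third,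
  a Taylor expansion with the jump bound gives \<open>r\<^sub>k = o(V)\<close> where \<open>V (X\<^sub>k\<^sub>-\<^sub>1)\<close> is bounded and
  \<open>r\<^sub>k = O(V)\<close> in general, and \<open>V = o(W)\<close> turns both into \<open>r\<^sub>k = o(1 + W)\<close>.
\<close>

subsection \<open>Weighted averages\<close>

text \<open>Two obstacles shape the martingale part. No integrability of \<open>W (X n)\<close> is
  assumed, so expectations are taken only on the events
  \<open>W (Y n\<^sub>0 \<omega>) \<le> i\<close>. These belong to \<open>F n\<^sub>0\<close>, give
  the drift recursion a finite start, and exhaust the space. Moreover, \<open>n\<^sub>1\<close> is
  not a stopping time. Hence the sum does not start there: each difference carries the indicator
  that its step is uncapped, which is known one step earlier because the caps are adapted. The
  kernels thus use only the deterministic lengths \<open>\<gamma> k\<close>. The jump bound is given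
  along the actual noise; independence turns it into a bound for almost every value of a fresh noise
  variable, which is what the kernels integrate. For the third part, the cubic Taylor term costs a
  factor \<open>V * sqrt V\<close>, which \<open>W\<close> does not control. The fine expansion is
  therefore used only where \<open>V\<close> is below a threshold, and its cost disappears with
  \<open>sqrt (\<gamma> k)\<close>; above the threshold the quadratic bound suffices, since there
  \<open>V\<close> is a small multiple of \<open>W\<close>.\<close>

text \<open>The finitely many early terms are killed by \<open>H\<close>, and the others add up to a
  small multiple of \<open>L * H n\<close>. Later uses take \<open>w = 1\<close> (Cesaro averages),
  \<open>w = 1 + W\<close>, and \<open>\<eta> = w = 0\<close>, which covers a sequence that vanishes
  from some index on.\<close>

lemma weighted_average_tendsto_0:
  fixes e \<eta> w H :: "nat \<Rightarrow> real"
  assumes H: "filterlim H at_top sequentially"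
    and w: "\<And>k. 1 \<le> k \<Longrightarrow> 0 \<le> \<eta> k * w k"
    and L: "\<And>n. 1 \<le> n \<Longrightarrow> (\<Sum>k=1..n. \<eta> k * w k) \<le> L * H n"
    and small: "\<And>\<epsilon>. \<epsilon> > 0 \<Longrightarrow> eventually (\<lambda>k. \<bar>e k\<bar> \<le> \<epsilon> * (\<eta> k * w k)) sequentially"
  shows "(\<lambda>n. 1 / H n * (\<Sum>k=1..n. e k)) \<longlonglongrightarrow> 0"
proof (rule LIMSEQ_I)
  fix r :: real assume r: "r > 0"
  \<comment> \<open>Half of \<open>r\<close> is reserved for the late terms and half for the early
    ones; the added 1 avoids a division by zero.\<close>
  define \<epsilon> where "\<epsilon> = r / (2 * (\<bar>L\<bar> + 1))"
  have \<epsilon>: "\<epsilon> > 0" "\<epsilon> * \<bar>L\<bar> \<le> r / 2"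
    using r by (auto simp: \<epsilon>_def field_simps)
  from small[OF \<epsilon>(1)] obtain N where N: "\<And>k. k \<ge> N \<Longrightarrow> \<bar>e k\<bar> \<le> \<epsilon> * (\<eta> k * w k)"
    by (auto simp: eventually_sequentially)
  define C where "C = (\<Sum>k=1..N. \<bar>e k\<bar>)"
  \<comment> \<open>This threshold yields both \<open>C < r / 2 * H n\<close> and
    \<open>H n > 0\<close>.\<close>
  from H have "eventually (\<lambda>n. H n > 2 * C / r + 1) sequentially"
    by (auto simp: filterlim_at_top_dense)
  then obtain N' where N': "\<And>n. n \<ge> N' \<Longrightarrow> H n > 2 * C / r + 1"
    by (auto simp: eventually_sequentially)
  have "norm (1 / H n * (\<Sum>k=1..n. e k) - 0) < r" if n: "n \<ge> max 1 N'" for n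
  proof -
    have Hn: "H n > 2 * C / r + 1" using N'[of n] n by auto
    have C0: "C \<ge> 0" by (auto simp: C_def intro: sum_nonneg)
    have Hpos: "H n > 0" using Hn C0 r by (smt (verit) divide_nonneg_pos)
    have "\<bar>\<Sum>k=1..n. e k\<bar> \<le> (\<Sum>k=1..n. \<bar>e k\<bar>)" by (rule sum_abs)
    also have "\<dots> \<le> (\<Sum>k=1..n. (if k \<le> N then \<bar>e k\<bar> else 0) + \<epsilon> * (\<eta> k * w k))"
      using N w \<epsilon> by (intro sum_mono) auto
    also have "\<dots> = (\<Sum>k=1..n. if k \<le> N then \<bar>e k\<bar> else 0) + \<epsilon> * (\<Sum>k=1..n. \<eta> k * w k)"
      by (simp add: sum.distrib sum_distrib_left)
    also have "(\<Sum>k=1..n. if k \<le> N then \<bar>e k\<bar> else 0) = (\<Sum>k\<in>{1..n}\<inter>{..N}. \<bar>e k\<bar>)"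
      by (subst sum.inter_restrict) auto
    also have "\<dots> \<le> C" unfolding C_def by (intro sum_mono2) auto
    also have "(\<Sum>k=1..n. \<eta> k * w k) \<le> \<bar>L\<bar> * H n"
      using L[of n] n Hpos by (smt (verit) max.boundedE mult_right_mono)
    finally have "\<bar>\<Sum>k=1..n. e k\<bar> \<le> C + \<epsilon> * (\<bar>L\<bar> * H n)" using \<epsilon> by simp
    also have "\<epsilon> * (\<bar>L\<bar> * H n) \<le> r / 2 * H n"
      using \<epsilon>(2) Hpos by (simp add: mult.assoc[symmetric])
    also have "C < r / 2 * H n"
    proof -
      have "2 * C / r < H n" using Hn by simp
      then show ?thesis using r by (simp add: field_simps)
    qed
    finally show ?thesis using Hpos by (simp add: abs_mult field_simps)
  qed
  then show "\<exists>no. \<forall>n\<ge>no. norm (1 / H n * (\<Sum>k=1..n. e k) - 0) < r" by blast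
qed

lemma summation_by_parts:
  fixes q g :: "nat \<Rightarrow> real"
  shows "(\<Sum>k=1..n. q k * (g k - g (k - 1))) =
    q n * g n - q 0 * g 0 - (\<Sum>k=1..n. (q k - q (k - 1)) * g (k - 1))"
  by (induction n) (auto simp: algebra_simps)

text \<open>Summation by parts is applied to the centred sums \<open>S - s\<close>. After division
  by \<open>H n\<close> the boundary term is \<open>S n - s\<close>, and what remains is an
  \<open>\<eta>\<close>-weighted average of a null sequence.\<close>

lemma kronecker:
  fixes \<eta> d H :: "nat \<Rightarrow> real"
  assumes Hdef: "\<And>n. H n = (\<Sum>k=1..n. \<eta> k)"
    and H: "filterlim H at_top sequentially"
    and \<eta>: "\<And>k. 1 \<le> k \<Longrightarrow> \<eta> k > 0"
    and conv: "convergent (\<lambda>n. \<Sum>k=1..n. d k)"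
  shows "(\<lambda>n. 1 / H n * (\<Sum>k=1..n. H k * d k)) \<longlonglongrightarrow> 0"
proof -
  define S where "S n = (\<Sum>k=1..n. d k)" for n
  from conv obtain s where s: "S \<longlonglongrightarrow> s" unfolding S_def convergent_def by blast
  have Hpos: "H n > 0" if "n \<ge> 1" for n
    unfolding Hdef using that by (intro sum_pos \<eta>) auto
  have H0: "H 0 = 0" by (simp add: Hdef)
  have Hstep: "H k - H (k - 1) = \<eta> k" if "k \<ge> 1" for k
    using that by (cases k) (auto simp: Hdef)
  have *: "(\<Sum>k=1..n. H k * d k) = H n * (S n - s) - (\<Sum>k=1..n. \<eta> k * (S (k - 1) - s))" for n
  proof -
    have "(\<Sum>k=1..n. H k * d k) = (\<Sum>k=1..n. H k * ((S k - s) - (S (k - 1) - s)))"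
    proof (intro sum.cong refl)
      fix k assume "k \<in> {1..n}"
      then show "H k * d k = H k * ((S k - s) - (S (k - 1) - s))" by (cases k) (auto simp: S_def)
    qed
    also have "\<dots> = H n * (S n - s) - (\<Sum>k=1..n. (H k - H (k - 1)) * (S (k - 1) - s))"
      by (subst summation_by_parts) (simp add: H0)
    also have "(\<Sum>k=1..n. (H k - H (k - 1)) * (S (k - 1) - s)) = (\<Sum>k=1..n. \<eta> k * (S (k - 1) - s))"
      by (intro sum.cong refl) (metis Hstep atLeastAtMost_iff)
    finally show ?thesis .
  qed
  have "(\<lambda>n. 1 / H n * (\<Sum>k=1..n. \<eta> k * (S (k - 1) - s))) \<longlonglongrightarrow> 0"
  proof (rule weighted_average_tendsto_0[OF H, where \<eta>=\<eta> and w="\<lambda>_. 1" and L=1])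
    fix \<epsilon> :: real assume \<epsilon>: "\<epsilon> > 0"
    have "(\<lambda>k. S (k - 1)) \<longlonglongrightarrow> s"
      by (subst filterlim_sequentially_Suc[symmetric]) (simp add: s)
    from LIMSEQ_D[OF this \<epsilon>] obtain N where N: "\<And>k. k \<ge> N \<Longrightarrow> \<bar>S (k - 1) - s\<bar> < \<epsilon>" by auto
    have "\<bar>\<eta> k * (S (k - 1) - s)\<bar> \<le> \<epsilon> * (\<eta> k * 1)" if "k \<ge> max 1 N" for k
      using N[of k] \<eta>[of k] that by (simp add: abs_mult mult.commute)
    then show "eventually (\<lambda>k. \<bar>\<eta> k * (S (k - 1) - s)\<bar> \<le> \<epsilon> * (\<eta> k * 1)) sequentially"
      unfolding eventually_sequentially by blast
  qed (use \<eta> Hdef in \<open>auto intro: less_imp_le\<close>)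
  then have "(\<lambda>n. (S n - s) - 1 / H n * (\<Sum>k=1..n. \<eta> k * (S (k - 1) - s))) \<longlonglongrightarrow> 0 - 0"
    by (intro tendsto_diff) (use s in \<open>auto intro: LIM_zero\<close>)
  moreover have "eventually (\<lambda>n. (S n - s) - 1 / H n * (\<Sum>k=1..n. \<eta> k * (S (k - 1) - s))
      = 1 / H n * (\<Sum>k=1..n. H k * d k)) sequentially"
    using eventually_ge_at_top[of 1]
  proof eventually_elim
    case (elim n)
    with Hpos[of n] show ?case unfolding * by (simp add: right_diff_distrib)
  qed
  ultimately show ?thesis by (simp add: tendsto_cong)
qed

lemma weight_total_at_top:
  assumes "weight_sequence \<eta>"
  shows "filterlim (weight_total \<eta>) at_top sequentially"
proof -
  have pos: "\<And>k. k \<ge> 1 \<Longrightarrow> \<eta> k > 0" and ns: "\<not> summable \<eta>" and e0: "\<eta> 0 = 0"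
    using assms by (auto simp: weight_sequence_def)
  have nn: "\<eta> k \<ge> 0" for k using pos[of k] e0 by (cases k) auto
  have eq: "weight_total \<eta> n = (\<Sum>k\<le>n. \<eta> k)" for n
    unfolding weight_total_def using e0
    by (intro sum.mono_neutral_left) (auto simp: not_less_eq_eq)
  show ?thesis
    unfolding filterlim_at_top
  proof
    fix Z :: real
    show "eventually (\<lambda>n. Z \<le> weight_total \<eta> n) sequentially"
    proof (rule ccontr)
      assume "\<not> eventually (\<lambda>n. Z \<le> weight_total \<eta> n) sequentially"
      then have "\<exists>n\<ge>N. weight_total \<eta> n < Z" for N
        by (auto simp: eventually_sequentially not_le)
      then have "(\<Sum>k<N. \<eta> k) \<le> Z" for N
      proof -
        obtain n where n: "n \<ge> N" "weight_total \<eta> n < Z"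
          using \<open>\<And>N. \<exists>n\<ge>N. weight_total \<eta> n < Z\<close> by blast
        have "(\<Sum>k<N. \<eta> k) \<le> (\<Sum>k\<le>n. \<eta> k)"
          using n nn by (intro sum_mono2) auto
        with n eq show ?thesis by simp
      qed
      then have "summable \<eta>" using nn by (intro bounded_imp_summable[where B=Z])
          (simp_all only: lessThan_Suc_atMost[symmetric])
      with ns show False ..
    qed
  qed
qed

text \<open>Since \<open>\<eta> 0 = 0\<close>, the ratio \<open>\<eta> n / \<gamma> n\<close> is
  itself bounded by its total variation up to \<open>n\<close>. Both terms left by summation by
  parts are then at most \<open>B\<close> times that variation, whose average vanishes by the first
  condition of \<open>step_weight\<close>.\<close>

lemma weighted_increments_tendsto_0:
  fixes \<gamma> \<eta> g :: "nat \<Rightarrow> real"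
  assumes eta: "weight_sequence \<eta>" and sw: "step_weight \<gamma> \<eta>" and \<gamma>: "\<And>n. \<gamma> n > 0"
    and g: "\<And>n. \<bar>g n\<bar> \<le> B"
  shows "(\<lambda>n. 1 / weight_total \<eta> n * (\<Sum>k=1..n. \<eta> k / \<gamma> k * (g k - g (k - 1)))) \<longlonglongrightarrow> 0"
proof -
  let ?\<Delta> = "\<lambda>n. \<Sum>k=1..n. \<bar>ratio_increment \<eta> \<gamma> k\<bar>"
  let ?q = "\<lambda>k. \<eta> k / \<gamma> k"
  have q0: "?q 0 = 0" using eta by (simp add: weight_sequence_def)
  have B: "B \<ge> 0" using g[of 0] by linarith
  have tel: "?q n = (\<Sum>k=1..n. ratio_increment \<eta> \<gamma> k)" for n
    using q0 by (induction n) (auto simp: ratio_increment_def)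
  have lim: "(\<lambda>n. 1 / weight_total \<eta> n * ?\<Delta> n) \<longlonglongrightarrow> 0"
    using sw unfolding step_weight_def by blast
  have abel: "\<bar>\<Sum>k=1..n. ?q k * (g k - g (k - 1))\<bar> \<le> 2 * B * ?\<Delta> n" for n
  proof -
    have "\<bar>\<Sum>k=1..n. ?q k * (g k - g (k - 1))\<bar>
        = \<bar>?q n * g n - (\<Sum>k=1..n. ratio_increment \<eta> \<gamma> k * g (k - 1))\<bar>"
      by (subst summation_by_parts) (simp add: q0 ratio_increment_def)
    also have "\<dots> \<le> \<bar>?q n * g n\<bar> + \<bar>\<Sum>k=1..n. ratio_increment \<eta> \<gamma> k * g (k - 1)\<bar>"
      by (rule abs_triangle_ineq4)
    also have "\<bar>?q n * g n\<bar> \<le> ?\<Delta> n * B"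
      unfolding abs_mult using g B by (intro mult_mono) (auto simp: tel intro: sum_nonneg sum_abs)
    also have "\<bar>\<Sum>k=1..n. ratio_increment \<eta> \<gamma> k * g (k - 1)\<bar> \<le> (\<Sum>k=1..n. \<bar>ratio_increment \<eta> \<gamma> k\<bar> * B)"
      by (rule order_trans[OF sum_abs]) (auto intro!: sum_mono mult_left_mono g simp: abs_mult)
    also have "\<dots> = ?\<Delta> n * B" by (simp add: sum_distrib_right)
    finally show ?thesis by simp
  qed
  have *: "norm (1 / weight_total \<eta> n * (\<Sum>k=1..n. ?q k * (g k - g (k - 1))))
      \<le> norm (1 / weight_total \<eta> n * ?\<Delta> n) * (2 * B)" for n
  proof -
    have "1 / weight_total \<eta> n * \<bar>\<Sum>k=1..n. ?q k * (g k - g (k - 1))\<bar> \<le> 1 / weight_total \<eta> n * (2 * B * ?\<Delta> n)"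
      using weight_total_nonneg[OF eta, of n] abel[of n] by (intro mult_left_mono) auto
    then show ?thesis
      using weight_total_nonneg[OF eta, of n] by (simp add: abs_mult sum_nonneg mult.commute mult.assoc)
  qed
  show ?thesis
    by (rule tendsto_0_le[OF lim always_eventually]) (use * in blast)
qed

subsection \<open>Convergence of square-integrable martingales\<close>

text \<open>\<open>centered\<close> is the martingale property tested against bounded functions of
  the past, exactly what an orthogonality argument consumes. The bounds \<open>B n\<close> may grow
  at any rate: they secure integrability and enter no estimate.\<close>

locale square_integrable_martingale_differences = prob_space M for M :: "'a measure" +
  fixes F :: "nat \<Rightarrow> 'a measure" and D :: "nat \<Rightarrow> 'a \<Rightarrow> real" and B :: "nat \<Rightarrow> real"
  assumes subalgebra: "\<And>n. subalgebra M (F n)"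
    and filtration: "\<And>n. sets (F n) \<subseteq> sets (F (Suc n))"
    and adapted: "\<And>n. D n \<in> borel_measurable (F n)"
    and bounded: "\<And>n \<omega>. \<bar>D n \<omega>\<bar> \<le> B n"
    and centered: "\<And>n Z c. Z \<in> borel_measurable (F n) \<Longrightarrow> (\<And>\<omega>. \<bar>Z \<omega>\<bar> \<le> c) \<Longrightarrow>
      (LINT \<omega>|M. Z \<omega> * D (Suc n) \<omega>) = 0"
    and summable_variance: "summable (\<lambda>n. LINT \<omega>|M. (D n \<omega>)\<^sup>2)"
begin

lemma space_F [simp]: "space (F n) = space M"
  using subalgebra[of n] by (simp add: subalgebra_def)

lemma sets_F_mono: "m \<le> n \<Longrightarrow> sets (F m) \<subseteq> sets (F n)"
  by (rule lift_Suc_mono_le[of "\<lambda>n. sets (F n)", OF filtration])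

lemma measurable_F_mono: "m \<le> n \<Longrightarrow> f \<in> measurable (F m) N \<Longrightarrow> f \<in> measurable (F n) N"
  using sets_F_mono[of m n] unfolding measurable_def by auto

lemma measurable_F_M: "f \<in> measurable (F m) N \<Longrightarrow> f \<in> measurable M N"
  using subalgebra by (rule measurable_from_subalg)

lemma D_measurable [measurable]: "D n \<in> borel_measurable M"
  using adapted by (rule measurable_F_M)

definition S :: "nat \<Rightarrow> nat \<Rightarrow> 'a \<Rightarrow> real" where
  "S m n \<omega> = (\<Sum>k\<in>{m<..n}. D k \<omega>)"

lemma S_measurable: "S m n \<in> borel_measurable (F n)"
  unfolding S_def[abs_def]
  by (intro borel_measurable_sum measurable_F_mono[OF _ adapted]) auto

lemma S_measurable_M [measurable]: "S m n \<in> borel_measurable M"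
  using S_measurable by (rule measurable_F_M)

lemma S_Suc: "m \<le> n \<Longrightarrow> S m (Suc n) \<omega> = S m n \<omega> + D (Suc n) \<omega>"
  by (simp add: S_def atLeastSucAtMost_greaterThanAtMost[symmetric] sum.cl_ivl_Suc)

definition below :: "nat \<Rightarrow> real \<Rightarrow> nat \<Rightarrow> 'a \<Rightarrow> bool" where
  "below m \<epsilon> i \<omega> \<longleftrightarrow> (\<forall>j\<le>i. \<bar>S m (m + j) \<omega>\<bar> < \<epsilon>)"

text \<open>Stopping the partial sums at their first exceedance of \<open>\<epsilon>\<close> keeps the increments orthogonal and
  turns the maximal inequality into Chebyshev's inequality.\<close>

primrec stopped :: "nat \<Rightarrow> real \<Rightarrow> nat \<Rightarrow> 'a \<Rightarrow> real" where
  "stopped m \<epsilon> 0 \<omega> = 0"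
| "stopped m \<epsilon> (Suc i) \<omega> = stopped m \<epsilon> i \<omega> +
     (if below m \<epsilon> i \<omega> then D (Suc (m + i)) \<omega> else 0)"

lemma below_measurable:
  "Measurable.pred (F (m + i)) (below m \<epsilon> i)"
proof -
  have "Measurable.pred (F (m + i)) (\<lambda>\<omega>. \<bar>S m (m + j) \<omega>\<bar> < \<epsilon>)" if "j \<in> {..i}" for j
  proof -
    have [measurable]: "S m (m + j) \<in> borel_measurable (F (m + i))"
      using that by (intro measurable_F_mono[OF _ S_measurable]) auto
    show ?thesis by measurable
  qed
  then have "Measurable.pred (F (m + i)) (\<lambda>\<omega>. \<forall>j\<in>{..i}. \<bar>S m (m + j) \<omega>\<bar> < \<epsilon>)"
    by (rule pred_intros_finite(3)[OF finite_atMost])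
  then show ?thesis unfolding Ball_def atMost_iff below_def[abs_def] .
qed

lemma stopped_measurable: "stopped m \<epsilon> i \<in> borel_measurable (F (m + i))"
proof (induction i)
  case (Suc i)
  have [measurable]: "stopped m \<epsilon> i \<in> borel_measurable (F (m + Suc i))"
    by (rule measurable_F_mono[OF _ Suc.IH]) simp
  have [measurable]: "Measurable.pred (F (m + Suc i)) (below m \<epsilon> i)"
    by (rule measurable_F_mono[OF _ below_measurable]) simp
  have [measurable]: "D (Suc (m + i)) \<in> borel_measurable (F (m + Suc i))"
    using adapted[of "Suc (m + i)"] by simp
  have "(\<lambda>\<omega>. stopped m \<epsilon> i \<omega> + (if below m \<epsilon> i \<omega> then D (Suc (m + i)) \<omega> else 0))
      \<in> borel_measurable (F (m + Suc i))"
    by measurable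
  then show ?case by simp
qed simp

lemma stopped_bounded: "\<exists>c. \<forall>\<omega>. \<bar>stopped m \<epsilon> i \<omega>\<bar> \<le> c"
proof (induction i)
  case (Suc i)
  then obtain c where c: "\<And>\<omega>. \<bar>stopped m \<epsilon> i \<omega>\<bar> \<le> c" by blast
  have "\<bar>stopped m \<epsilon> (Suc i) \<omega>\<bar> \<le> c + B (Suc (m + i))" for \<omega>
    using c[of \<omega>] bounded[of "Suc (m + i)" \<omega>] by auto
  then show ?case by blast
qed auto

text \<open>The cross term vanishes by \<open>centered\<close>, because the stopped sum times the
  indicator of \<open>below\<close> is bounded and known one step earlier. In the square of the new
  increment this indicator is bounded by 1.\<close>

lemma stopped_variance:
  "(LINT \<omega>|M. (stopped m \<epsilon> i \<omega>)\<^sup>2) \<le> (\<Sum>j<i. LINT \<omega>|M. (D (Suc (m + j)) \<omega>)\<^sup>2)"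
proof (induction i)
  case (Suc i)
  let ?G = "\<lambda>\<omega>. if below m \<epsilon> i \<omega> then 1 else 0 :: real"
  let ?D = "D (Suc (m + i))" and ?T = "stopped m \<epsilon> i"
  obtain c where c: "\<And>\<omega>. \<bar>?T \<omega>\<bar> \<le> c" using stopped_bounded by blast
  have c0: "c \<ge> 0" using c[of undefined] by linarith
  have B0: "B n \<ge> 0" for n using bounded[of n undefined] by linarith
  have [measurable]: "?T \<in> borel_measurable M"
    by (rule measurable_F_M[OF stopped_measurable])
  have [measurable]: "Measurable.pred M (below m \<epsilon> i)"
    by (rule measurable_F_M[OF below_measurable])
  have int: "integrable M g" if "g \<in> borel_measurable M" "\<And>\<omega>. \<bar>g \<omega>\<bar> \<le> C" for g :: "'a \<Rightarrow> real" and C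
    using that by (intro integrable_const_bound[where B=C]) auto
  have i1: "integrable M (\<lambda>\<omega>. (?T \<omega>)\<^sup>2)"
    by (rule int[of _ "c\<^sup>2"]) (use c c0 in \<open>auto simp: abs_le_square_iff[symmetric]\<close>)
  have i3: "integrable M (\<lambda>\<omega>. (?D \<omega>)\<^sup>2)"
    by (rule int[of _ "(B (Suc (m + i)))\<^sup>2"]) (use bounded B0 in \<open>auto simp: abs_le_square_iff[symmetric]\<close>)
  have i2: "integrable M (\<lambda>\<omega>. ?T \<omega> * ?G \<omega> * ?D \<omega>)"
    by (rule int[of _ "c * 1 * B (Suc (m + i))"])
       (auto simp: abs_mult intro!: mult_mono mult_nonneg_nonneg c bounded c0 B0)
  have i4: "integrable M (\<lambda>\<omega>. ?G \<omega> * (?D \<omega>)\<^sup>2)"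
    by (rule Bochner_Integration.integrable_bound[OF i3]) auto
  have z: "(LINT \<omega>|M. (?T \<omega> * ?G \<omega>) * ?D \<omega>) = 0"
  proof (rule centered)
    have [measurable]: "?T \<in> borel_measurable (F (m + i))" by (rule stopped_measurable)
    have [measurable]: "Measurable.pred (F (m + i)) (below m \<epsilon> i)"
      by (rule below_measurable)
    show "(\<lambda>\<omega>. ?T \<omega> * ?G \<omega>) \<in> borel_measurable (F (m + i))" by measurable
    show "\<bar>?T \<omega> * ?G \<omega>\<bar> \<le> c" for \<omega> using c[of \<omega>] c0 by auto
  qed
  have "(LINT \<omega>|M. (stopped m \<epsilon> (Suc i) \<omega>)\<^sup>2)
      = (LINT \<omega>|M. (?T \<omega>)\<^sup>2 + 2 * (?T \<omega> * ?G \<omega> * ?D \<omega>) + ?G \<omega> * (?D \<omega>)\<^sup>2)"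
    by (intro Bochner_Integration.integral_cong refl) (auto simp: power2_eq_square algebra_simps)
  also have "\<dots> = (LINT \<omega>|M. (?T \<omega>)\<^sup>2) + 2 * (LINT \<omega>|M. ?T \<omega> * ?G \<omega> * ?D \<omega>)
      + (LINT \<omega>|M. ?G \<omega> * (?D \<omega>)\<^sup>2)"
    using i1 i2 i4 by simp
  also have "(LINT \<omega>|M. ?G \<omega> * (?D \<omega>)\<^sup>2) \<le> (LINT \<omega>|M. (?D \<omega>)\<^sup>2)"
    by (rule integral_mono[OF i4 i3]) auto
  finally show ?case using Suc.IH z by simp
qed simp

text \<open>The increment that carries the sum across the level is still added and no later one is,
  so the stopped sum freezes at a value beyond the level.\<close>

lemma stopped_exceeds:
  assumes "j \<le> i" "\<bar>S m (m + j) \<omega>\<bar> \<ge> \<epsilon>" "\<epsilon> > 0"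
  shows "\<bar>stopped m \<epsilon> i \<omega>\<bar> \<ge> \<epsilon>"
proof -
  have eq: "stopped m \<epsilon> i \<omega> = S m (m + i) \<omega>" if "\<forall>j<i. \<bar>S m (m + j) \<omega>\<bar> < \<epsilon>" for i
    using that
  proof (induction i)
    case 0
    show ?case by (simp add: S_def)
  next
    case (Suc i)
    then have "below m \<epsilon> i \<omega>" by (simp add: below_def)
    with Suc show ?case by (simp add: S_Suc)
  qed
  \<comment> \<open>The exceedance index is left unspecified, since in the induction on
    \<open>i\<close> it may be an old index or the newest one.\<close>
  have "\<exists>j\<le>i. \<epsilon> \<le> \<bar>S m (m + j) \<omega>\<bar>" using assms by blast
  then show ?thesis
  proof (induction i)
    case 0
    then show ?case using assms(3) by (auto simp: S_def)
  next
    case (Suc i)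
    show ?case
    proof (cases "\<exists>j\<le>i. \<epsilon> \<le> \<bar>S m (m + j) \<omega>\<bar>")
      case True
      then have "\<not> below m \<epsilon> i \<omega>" by (auto simp: below_def not_less)
      then have "stopped m \<epsilon> (Suc i) \<omega> = stopped m \<epsilon> i \<omega>"
        by simp
      then show ?thesis using Suc.IH True by simp
    next
      case False
      then have "\<epsilon> \<le> \<bar>S m (m + Suc i) \<omega>\<bar>" using Suc.prems by (metis le_SucE)
      moreover have "stopped m \<epsilon> (Suc i) \<omega> = S m (m + Suc i) \<omega>"
        using False by (intro eq) (metis not_le less_Suc_eq_le)
      ultimately show ?thesis by simp
    qed
  qed
qed

text \<open>Extending the variance sum to the whole series makes the bound uniform in the horizon
  \<open>i\<close>, which can then tend to infinity.\<close>

lemma maximal_inequality: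
  assumes "\<epsilon> > 0"
  shows "prob {\<omega>\<in>space M. \<exists>j\<le>i. \<bar>S m (m + j) \<omega>\<bar> \<ge> \<epsilon>}
    \<le> (\<Sum>j. LINT \<omega>|M. (D (Suc (m + j)) \<omega>)\<^sup>2) / \<epsilon>\<^sup>2"
proof -
  have [measurable]: "stopped m \<epsilon> i \<in> borel_measurable M"
    by (rule measurable_F_M[OF stopped_measurable])
  obtain c where c: "\<And>\<omega>. \<bar>stopped m \<epsilon> i \<omega>\<bar> \<le> c" using stopped_bounded by blast
  have int: "integrable M (\<lambda>\<omega>. (stopped m \<epsilon> i \<omega>)\<^sup>2)"
  proof (rule integrable_const_bound[where B="c\<^sup>2"])
    have "\<bar>stopped m \<epsilon> i \<omega>\<bar> \<le> \<bar>c\<bar>" for \<omega> using c[of \<omega>] by linarith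
    then show "AE \<omega> in M. norm ((stopped m \<epsilon> i \<omega>)\<^sup>2) \<le> c\<^sup>2" by (auto simp: abs_le_square_iff)
  qed simp
  have "prob {\<omega>\<in>space M. \<exists>j\<le>i. \<bar>S m (m + j) \<omega>\<bar> \<ge> \<epsilon>}
      \<le> prob {\<omega>\<in>space M. \<epsilon>\<^sup>2 \<le> (stopped m \<epsilon> i \<omega>)\<^sup>2}"
  proof (rule finite_measure_mono)
    show "{\<omega> \<in> space M. \<exists>j\<le>i. \<epsilon> \<le> \<bar>S m (m + j) \<omega>\<bar>} \<subseteq> {\<omega> \<in> space M. \<epsilon>\<^sup>2 \<le> (stopped m \<epsilon> i \<omega>)\<^sup>2}"
      using stopped_exceeds[OF _ _ assms] assms
      by (auto simp: abs_le_square_iff[symmetric])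
  qed simp
  also have "\<dots> \<le> (LINT \<omega>|M. (stopped m \<epsilon> i \<omega>)\<^sup>2) / \<epsilon>\<^sup>2"
    using assms by (intro integral_Markov_inequality_measure[OF int]) auto
  also have "\<dots> \<le> (\<Sum>j<i. LINT \<omega>|M. (D (Suc (m + j)) \<omega>)\<^sup>2) / \<epsilon>\<^sup>2"
    by (intro divide_right_mono stopped_variance) simp
  also have "\<dots> \<le> (\<Sum>j. LINT \<omega>|M. (D (Suc (m + j)) \<omega>)\<^sup>2) / \<epsilon>\<^sup>2"
    using summable_variance summable_ignore_initial_segment[of "\<lambda>n. LINT \<omega>|M. (D n \<omega>)\<^sup>2" "Suc m"]
    by (intro divide_right_mono sum_le_suminf) (auto simp: add.commute)
  finally show ?thesis .
qed

text \<open>A path that oscillates after every starting index \<open>m\<close> lies in all the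
  events \<open>?A m\<close>, whose probabilities are controlled by the tails \<open>r m\<close> of
  a convergent series.\<close>

lemma AE_oscillation_small:
  assumes "\<epsilon> > 0"
  shows "AE \<omega> in M. \<exists>m. \<forall>j. \<bar>S m (m + j) \<omega>\<bar> < \<epsilon>"
proof -
  define r where "r m = (\<Sum>j. LINT \<omega>|M. (D (Suc (m + j)) \<omega>)\<^sup>2)" for m
  have r: "r \<longlonglongrightarrow> 0"
  proof -
    have "(\<lambda>m. \<Sum>j. LINT \<omega>|M. (D (j + m) \<omega>)\<^sup>2) \<longlonglongrightarrow> 0"
      using suminf_exist_split2[OF summable_variance] .
    from LIMSEQ_Suc[OF this] show ?thesis by (simp add: r_def[abs_def] add.commute)
  qed
  let ?E = "\<lambda>m i. {\<omega>\<in>space M. \<exists>j\<le>i. \<bar>S m (m + j) \<omega>\<bar> \<ge> \<epsilon>}"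
  let ?A = "\<lambda>m. {\<omega>\<in>space M. \<exists>j. \<bar>S m (m + j) \<omega>\<bar> \<ge> \<epsilon>}"
  have A: "prob (?A m) \<le> r m / \<epsilon>\<^sup>2" for m
  proof -
    have "(\<lambda>i. prob (?E m i)) \<longlonglongrightarrow> prob (\<Union>i. ?E m i)"
      by (intro finite_Lim_measure_incseq) (auto simp: incseq_def intro: order_trans)
    moreover have "(\<Union>i. ?E m i) = ?A m" by auto
    ultimately show ?thesis
      using maximal_inequality[OF assms, of _ m] unfolding r_def by (intro LIMSEQ_le_const2) auto
  qed
  have "prob {\<omega>\<in>space M. \<forall>m. \<exists>j. \<bar>S m (m + j) \<omega>\<bar> \<ge> \<epsilon>} \<le> r m / \<epsilon>\<^sup>2" for m
    by (rule order_trans[OF finite_measure_mono A[of m]]) auto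
  moreover have "(\<lambda>m. r m / \<epsilon>\<^sup>2) \<longlonglongrightarrow> 0"
    using tendsto_divide[OF r tendsto_const, of "\<epsilon>\<^sup>2"] assms by simp
  ultimately have "prob {\<omega>\<in>space M. \<forall>m. \<exists>j. \<bar>S m (m + j) \<omega>\<bar> \<ge> \<epsilon>} \<le> 0"
    by (intro LIMSEQ_le_const[where X="\<lambda>m. r m / \<epsilon>\<^sup>2"]) auto
  then have "prob {\<omega>\<in>space M. \<forall>m. \<exists>j. \<bar>S m (m + j) \<omega>\<bar> \<ge> \<epsilon>} = 0"
    by (intro antisym) auto
  then show ?thesis
    by (subst (asm) prob_Collect_eq_0) (auto simp: not_le)
qed

theorem AE_convergent: "AE \<omega> in M. convergent (\<lambda>n. \<Sum>k=1..n. D k \<omega>)"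
proof -
  have "AE \<omega> in M. \<forall>i::nat. \<exists>m. \<forall>j. \<bar>S m (m + j) \<omega>\<bar> < inverse (real (Suc i))"
    by (subst AE_all_countable) (auto intro!: AE_oscillation_small)
  then show ?thesis
  proof eventually_elim
    case (elim \<omega>)
    have S: "S m n \<omega> = (\<Sum>k=1..n. D k \<omega>) - (\<Sum>k=1..m. D k \<omega>)" if "m \<le> n" for m n
      using that by (induction n rule: dec_induct) (auto simp: S_Suc, simp add: S_def)
    have "Cauchy (\<lambda>n. \<Sum>k=1..n. D k \<omega>)"
    proof (rule metric_CauchyI)
      fix e :: real assume "e > 0"
      then obtain i :: nat where i: "inverse (real (Suc i)) < e / 2"
        using reals_Archimedean[of "e / 2"] by auto
      from elim obtain m where m: "\<And>j. \<bar>S m (m + j) \<omega>\<bar> < inverse (real (Suc i))" by blast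
      have m': "\<bar>(\<Sum>k=1..n. D k \<omega>) - (\<Sum>k=1..m. D k \<omega>)\<bar> < e / 2" if "n \<ge> m" for n
        using m[of "n - m"] i S[OF that] that by simp
      have "dist (\<Sum>k=1..n. D k \<omega>) (\<Sum>k=1..n'. D k \<omega>) < e" if "n \<ge> m" "n' \<ge> m" for n n'
        using m'[OF that(1)] m'[OF that(2)] unfolding dist_real_def by linarith
      then show "\<exists>N. \<forall>n\<ge>N. \<forall>n'\<ge>N. dist (\<Sum>k=1..n. D k \<omega>) (\<Sum>k=1..n'. D k \<omega>) < e" by blast
    qed
    then show ?case by (rule Cauchy_convergent)
  qed
qed

end

subsection \<open>Second-order Taylor expansion\<close>

lemma C2_grad_has_derivative:
  assumes "C2 f"
  shows "(grad f has_derivative (\<lambda>h. hessian f x *v h)) (at x)"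
proof -
  have "grad f differentiable (at x)" using assms by (simp add: C2_def)
  then show ?thesis
    using jacobian_works[of "grad f" "at x"] unfolding hessian_def by simp
qed

lemma
  assumes "C2 f"
  shows C2_continuous: "continuous_on UNIV f"
    and C2_continuous_grad: "continuous_on UNIV (grad f)"
    and C2_continuous_hessian: "continuous_on UNIV (hessian f)"
  using assms unfolding C2_def
  by (auto intro!: continuous_at_imp_continuous_on differentiable_imp_continuous_within)

text \<open>This is the Maclaurin formula on the segment from \<open>x\<close> to
  \<open>x + h\<close>. The Lagrange form of the remainder is convenient because it only needs the
  Hessian at one intermediate point.\<close>

lemma C2_taylor:
  fixes f :: "real ^ 'd \<Rightarrow> real"
  assumes "C2 f"
  shows "\<exists>t\<in>{0..1}. f (x + h) = f x + grad f x \<bullet> h + 1 / 2 * (h \<bullet> (hessian f (x + t *\<^sub>R h) *v h))"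
proof -
  let ?\<phi> = "\<lambda>t::real. f (x + t *\<^sub>R h)"
  let ?\<phi>' = "\<lambda>t::real. grad f (x + t *\<^sub>R h) \<bullet> h"
  let ?\<phi>'' = "\<lambda>t::real. h \<bullet> (hessian f (x + t *\<^sub>R h) *v h)"
  define df where "df m = (if m = 0 then ?\<phi> else if m = 1 then ?\<phi>' else ?\<phi>'')" for m :: nat
  have "(?\<phi> has_real_derivative ?\<phi>' t) (at t)" for t
  proof -
    have "GDERIV f (x + t *\<^sub>R h) :> grad f (x + t *\<^sub>R h)"
      using assms by (intro grad_GDERIV) (simp add: C2_def)
    then have "((f \<circ> (\<lambda>t. x + t *\<^sub>R h)) has_derivative
        ((\<lambda>k. k \<bullet> grad f (x + t *\<^sub>R h)) \<circ> (\<lambda>s. s *\<^sub>R h))) (at t)"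
      unfolding gderiv_def by (intro diff_chain_at) (auto intro!: derivative_eq_intros)
    then show ?thesis
      by (simp add: has_field_derivative_def o_def inner_commute mult.commute[of _ "h \<bullet> _"])
  qed
  moreover have "(?\<phi>' has_real_derivative ?\<phi>'' t) (at t)" for t
  proof -
    have "((grad f \<circ> (\<lambda>t. x + t *\<^sub>R h)) has_derivative
        ((\<lambda>k. hessian f (x + t *\<^sub>R h) *v k) \<circ> (\<lambda>s. s *\<^sub>R h))) (at t)"
      by (intro diff_chain_at C2_grad_has_derivative assms) (auto intro!: derivative_eq_intros)
    then have "((\<lambda>t. grad f (x + t *\<^sub>R h) \<bullet> h) has_derivative
        (\<lambda>s. (hessian f (x + t *\<^sub>R h) *v (s *\<^sub>R h)) \<bullet> h)) (at t)"
      unfolding o_def by (rule has_derivative_inner_left)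
    then show ?thesis
      by (simp add: has_field_derivative_def matrix_vector_mult_scaleR inner_commute
          mult.commute[of _ "h \<bullet> _"])
  qed
  ultimately have D: "\<forall>m t. m < 2 \<and> 0 \<le> t \<and> t \<le> 1 \<longrightarrow> DERIV (df m) t :> df (Suc m) t"
    by (auto simp: df_def less_2_cases_iff)
  obtain t where "0 < t" "t < 1" "?\<phi> 1 = (\<Sum>m<2. df m 0 / fact m * 1 ^ m) + df 2 t / fact 2 * 1 ^ 2"
    using Maclaurin[OF _ _ _ D, of ?\<phi>] by (auto simp: df_def)
  then show ?thesis
    by (intro bexI[of _ t]) (auto simp: df_def numeral_2_eq_2)
qed

lemma C2_compact_support_outside:
  fixes f :: "real ^ 'd \<Rightarrow> real"
  assumes "x \<notin> closure {x. f x \<noteq> 0}"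
  shows "f x = 0" "grad f x = 0" "hessian f x = 0"
proof -
  let ?O = "- closure {x. f x \<noteq> 0}"
  have O: "open ?O" by (simp add: open_Compl)
  have f0: "f y = 0" if "y \<in> ?O" for y
    using that closure_subset[of "{x. f x \<noteq> 0}"] by auto
  have g0: "grad f y = 0" if y: "y \<in> ?O" for y
  proof -
    have "(f has_derivative (\<lambda>_. 0)) (at y)"
      by (rule has_derivative_transform_within_open[OF has_derivative_const O y]) (rule f0[symmetric])
    then have "frechet_derivative f (at y) = (\<lambda>_. 0)" by (metis frechet_derivative_at)
    then show ?thesis by (simp add: grad_def vec_eq_iff)
  qed
  have "(grad f has_derivative (\<lambda>_. 0)) (at x)"
    by (rule has_derivative_transform_within_open[OF has_derivative_const O]) (use assms in simp, rule g0[symmetric])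
  then have "frechet_derivative (grad f) (at x) = (\<lambda>_. 0)" by (metis frechet_derivative_at)
  then show "hessian f x = 0"
    by (simp add: hessian_def jacobian_def matrix_def vec_eq_iff)
  show "f x = 0" by (rule f0) (use assms in simp)
  show "grad f x = 0" by (rule g0) (use assms in simp)
qed

lemma bounded_of_compact_support:
  fixes g :: "'b::topological_space \<Rightarrow> 'c::real_normed_vector"
  assumes "continuous_on UNIV g" "compact S" "\<And>x. x \<notin> S \<Longrightarrow> g x = 0"
  shows "\<exists>B\<ge>0. \<forall>x. norm (g x) \<le> B"
proof -
  have "bounded (g ` S)"
    using assms by (intro compact_imp_bounded compact_continuous_image continuous_on_subset[OF assms(1)]) auto
  then obtain B where B: "\<And>x. x \<in> S \<Longrightarrow> norm (g x) \<le> B" by (auto simp: bounded_iff)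
  have "norm (g x) \<le> max B 0" for x using B[of x] assms(3)[of x] by (cases "x \<in> S") auto
  then show ?thesis by (intro exI[of _ "max B 0"]) auto
qed

lemma uniformly_continuous_of_compact_support:
  fixes g :: "'b::euclidean_space \<Rightarrow> 'c::real_normed_vector"
  assumes "continuous_on UNIV g" "compact S" "\<And>x. x \<notin> S \<Longrightarrow> g x = 0" "e > 0"
  shows "\<exists>d>0. \<forall>x y. dist x y < d \<longrightarrow> norm (g y - g x) < e"
proof -
  \<comment> \<open>Uniform continuity is available on compact sets, so \<open>S\<close> is
    thickened by a unit ball. Of two points closer than 1, either both lie in \<open>T\<close>, or
    both lie outside \<open>S\<close> and \<open>g\<close> vanishes at both.\<close>
  define T where "T = {x + y |x y. x \<in> S \<and> y \<in> cball 0 1}"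
  have T: "compact T" unfolding T_def using assms(2) by (intro compact_sums) auto
  have ST: "S \<subseteq> T" unfolding T_def by (force intro: exI[of _ 0])
  have "uniformly_continuous_on T g"
    using T assms(1) by (intro compact_uniformly_continuous continuous_on_subset[OF assms(1)] subset_UNIV)
  then obtain d where d: "d > 0" "\<And>x y. x \<in> T \<Longrightarrow> y \<in> T \<Longrightarrow> dist y x < d \<Longrightarrow> dist (g y) (g x) < e"
    using assms(4) unfolding uniformly_continuous_on_def by blast
  have near: "y \<in> T" if "x \<in> S" "dist x y < 1" for x y
    unfolding T_def mem_Collect_eq using that
    by (intro exI[of _ x] exI[of _ "y - x"]) (auto simp: dist_norm norm_minus_commute)
  have "norm (g y - g x) < e" if xy: "dist x y < min d 1" for x y
  proof (cases "x \<in> S \<or> y \<in> S")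
    case True
    then have "x \<in> T" "y \<in> T"
      using ST near[of x y] near[of y x] xy by (auto simp: dist_commute)
    then show ?thesis using d(2)[of x y] xy by (simp add: dist_norm norm_minus_commute)
  next
    case False
    then show ?thesis using assms(3)[of x] assms(3)[of y] assms(4) by simp
  qed
  then show ?thesis using d(1) by (intro exI[of _ "min d 1"]) auto
qed

lemma norm_matrix_vector_mult_le:
  fixes A :: "real ^ 'n ^ 'm"
  shows "norm (A *v h) \<le> real CARD('m) * norm A * norm h"
proof -
  have "norm (A *v h) \<le> (\<Sum>i\<in>UNIV. \<bar>(A *v h) $ i\<bar>)" by (rule norm_le_l1_cart)
  also have "\<dots> \<le> (\<Sum>i\<in>(UNIV::'m set). norm A * norm h)"
  proof (rule sum_mono)
    fix i
    have "norm ((A *v h) $ i) = \<bar>(A $ i) \<bullet> h\<bar>"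
      by (simp add: matrix_vector_mult_def inner_vec_def)
    also have "\<dots> \<le> norm (A $ i) * norm h" by (rule Cauchy_Schwarz_ineq2)
    also have "\<dots> \<le> norm A * norm h" by (intro mult_right_mono Finite_Cartesian_Product.norm_nth_le) auto
    finally show "\<bar>(A *v h) $ i\<bar> \<le> norm A * norm h" by simp
  qed
  finally show ?thesis by simp
qed

definition taylor_remainder :: "(real ^ 'd \<Rightarrow> real) \<Rightarrow> real ^ 'd \<Rightarrow> real ^ 'd \<Rightarrow> real" where
  "taylor_remainder f x h = f (x + h) - f x - grad f x \<bullet> h - 1 / 2 * (h \<bullet> (hessian f x *v h))"

text \<open>By the Lagrange form, the remainder is half the quadratic form of the Hessian
  difference; the half is given away and the dimension comes from a crude operator norm
  bound.\<close>

lemma taylor_remainder_le: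
  fixes f :: "real ^ 'd \<Rightarrow> real"
  assumes "C2 f" and "\<And>t. t \<in> {0..1} \<Longrightarrow> norm (hessian f (x + t *\<^sub>R h) - hessian f x) \<le> e"
  shows "\<bar>taylor_remainder f x h\<bar> \<le> real CARD('d) * e * (norm h)\<^sup>2"
proof -
  obtain t where t: "t \<in> {0..1}"
    "f (x + h) = f x + grad f x \<bullet> h + 1 / 2 * (h \<bullet> (hessian f (x + t *\<^sub>R h) *v h))"
    using C2_taylor[OF assms(1)] by blast
  let ?E = "hessian f (x + t *\<^sub>R h) - hessian f x"
  have "taylor_remainder f x h = 1 / 2 * (h \<bullet> (?E *v h))"
    unfolding taylor_remainder_def t(2) by (simp add: matrix_vector_mult_diff_rdistrib inner_diff_right)
  also have "\<bar>\<dots>\<bar> \<le> \<bar>h \<bullet> (?E *v h)\<bar>" by simp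
  also have "\<dots> \<le> norm h * norm (?E *v h)" by (rule Cauchy_Schwarz_ineq2)
  also have "\<dots> \<le> norm h * (real CARD('d) * e * norm h)"
    by (intro mult_left_mono order_trans[OF norm_matrix_vector_mult_le] mult_right_mono assms(2) t) auto
  finally show ?thesis by (simp add: power2_eq_square mult_ac)
qed

lemma taylor_remainder_quadratic:
  fixes f :: "real ^ 'd \<Rightarrow> real"
  assumes "C2 f" "compact (closure {x. f x \<noteq> 0})"
  shows "\<exists>C\<ge>0. \<forall>x h. \<bar>taylor_remainder f x h\<bar> \<le> C * (norm h)\<^sup>2"
proof -
  obtain B where B: "B \<ge> 0" "\<And>x. norm (hessian f x) \<le> B"
    using bounded_of_compact_support[OF C2_continuous_hessian[OF assms(1)] assms(2) C2_compact_support_outside(3)]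
    by blast
  have "\<bar>taylor_remainder f x h\<bar> \<le> real CARD('d) * (2 * B) * (norm h)\<^sup>2" for x h
  proof (rule taylor_remainder_le[OF assms(1)])
    fix t :: real
    show "norm (hessian f (x + t *\<^sub>R h) - hessian f x) \<le> 2 * B"
      using norm_triangle_ineq4[of "hessian f (x + t *\<^sub>R h)" "hessian f x"]
        B(2)[of "x + t *\<^sub>R h"] B(2)[of x] by linarith
  qed
  then show ?thesis using B(1) by (intro exI[of _ "real CARD('d) * (2 * B)"]) auto
qed

text \<open>The Hessian is only uniformly continuous, so a quadratic term with small coefficient
  must remain. It covers increments below the modulus \<open>d\<close>; for longer ones
  \<open>norm h / d \<ge> 1\<close> turns the quadratic bound into a cubic one, at a constant
  depending on \<open>\<epsilon>\<close>.\<close>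

lemma taylor_remainder_cubic:
  fixes f :: "real ^ 'd \<Rightarrow> real"
  assumes "C2 f" "compact (closure {x. f x \<noteq> 0})" "\<epsilon> > 0"
  shows "\<exists>C\<ge>0. \<forall>x h. \<bar>taylor_remainder f x h\<bar> \<le> \<epsilon> * (norm h)\<^sup>2 + C * norm h ^ 3"
proof -
  obtain Q where Q: "Q \<ge> 0" "\<And>x h. \<bar>taylor_remainder f x h\<bar> \<le> Q * (norm h)\<^sup>2"
    using taylor_remainder_quadratic[OF assms(1,2)] by blast
  let ?e = "\<epsilon> / real CARD('d)"
  have "?e > 0" using assms(3) by simp
  then obtain d where d: "d > 0" "\<And>x y. dist x y < d \<Longrightarrow> norm (hessian f y - hessian f x) < ?e"
    using uniformly_continuous_of_compact_support[OF C2_continuous_hessian[OF assms(1)] assms(2)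
        C2_compact_support_outside(3)] by blast
  have "\<bar>taylor_remainder f x h\<bar> \<le> \<epsilon> * (norm h)\<^sup>2 + Q / d * norm h ^ 3" for x h
  proof (cases "norm h < d")
    case True
    have "\<bar>taylor_remainder f x h\<bar> \<le> real CARD('d) * ?e * (norm h)\<^sup>2"
    proof (rule taylor_remainder_le[OF assms(1)])
      fix t :: real assume t: "t \<in> {0..1}"
      then have "norm (t *\<^sub>R h) \<le> norm h" by (simp add: mult_left_le_one_le)
      with True show "norm (hessian f (x + t *\<^sub>R h) - hessian f x) \<le> ?e"
        by (intro less_imp_le d(2)) (simp add: dist_norm)
    qed
    also have "\<dots> = \<epsilon> * (norm h)\<^sup>2" by simp
    also have "\<dots> \<le> \<epsilon> * (norm h)\<^sup>2 + Q / d * norm h ^ 3" using Q(1) d(1) by simp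
    finally show ?thesis .
  next
    case False
    have "\<bar>taylor_remainder f x h\<bar> \<le> Q * (norm h)\<^sup>2" by (rule Q(2))
    also have "\<dots> \<le> Q * ((norm h)\<^sup>2 * (norm h / d))"
      using False d(1) Q(1)
      by (intro mult_left_mono) (simp_all add: pos_le_divide_eq mult_left_mono)
    also have "\<dots> = Q / d * norm h ^ 3" by (simp add: power2_eq_square power3_eq_cube)
    also have "\<dots> \<le> \<epsilon> * (norm h)\<^sup>2 + Q / d * norm h ^ 3" using assms(3) by simp
    finally show ?thesis .
  qed
  then show ?thesis using Q(1) d(1) by (intro exI[of _ "Q / d"]) auto
qed

lemma C2_compact_support_bounded_lipschitz:
  fixes f :: "real ^ 'd \<Rightarrow> real"
  assumes "C2 f" "compact (closure {x. f x \<noteq> 0})"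
  shows "\<exists>B\<ge>0. \<forall>x. \<bar>f x\<bar> \<le> B" "\<exists>L\<ge>0. \<forall>x h. \<bar>f (x + h) - f x\<bar> \<le> L * norm h"
proof -
  show "\<exists>B\<ge>0. \<forall>x. \<bar>f x\<bar> \<le> B"
    using bounded_of_compact_support[OF C2_continuous[OF assms(1)] assms(2) C2_compact_support_outside(1)[of _ f]]
    by simp
  obtain L where L: "L \<ge> 0" "\<And>x. norm (grad f x) \<le> L"
    using bounded_of_compact_support[OF C2_continuous_grad[OF assms(1)] assms(2) C2_compact_support_outside(2)]
    by blast
  have f: "f differentiable (at x)" for x
    using assms(1) by (simp add: C2_def)
  have "norm (f (x + h) - f x) \<le> L * norm (x + h - x)" for x h
  proof (rule differentiable_bound[OF convex_UNIV])
    fix y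
    show "(f has_derivative (\<lambda>h. h \<bullet> grad f y)) (at y within UNIV)"
      using grad_GDERIV[OF f, of y] by (simp add: gderiv_def)
    show "onorm (\<lambda>h. h \<bullet> grad f y) \<le> L"
    proof (rule onorm_le)
      fix k
      have "\<bar>k \<bullet> grad f y\<bar> \<le> norm k * norm (grad f y)" by (rule Cauchy_Schwarz_ineq2)
      also have "\<dots> \<le> norm k * L" by (intro mult_left_mono L(2)) simp
      finally show "norm (k \<bullet> grad f y) \<le> L * norm k" by (simp add: mult.commute)
    qed
  qed auto
  then show "\<exists>L\<ge>0. \<forall>x h. \<bar>f (x + h) - f x\<bar> \<le> L * norm h" using L(1) by auto
qed

subsection \<open>One Euler step with normalized noise\<close>

text \<open>The third moment is what integrates the cubic term of
  \<open>taylor_remainder_cubic\<close>; mean and covariance produce the generator.\<close>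

locale normalized_noise = prob_space \<mu> for \<mu> :: "(real ^ 'm) measure" +
  assumes sets_law [measurable_cong, simp]: "sets \<mu> = sets borel"
    and third_moment: "integrable \<mu> (\<lambda>u. norm u ^ 3)"
    and mean: "(LINT u|\<mu>. u) = 0"
    and covariance: "\<And>i j. (LINT u|\<mu>. u $ i * u $ j) = (if i = j then 1 else 0)"
begin

lemma space_law [simp]: "space \<mu> = UNIV"
  using sets_eq_imp_space_eq[OF sets_law] by simp

lemma prob_UNIV [simp]: "prob UNIV = 1"
  using prob_space by simp

definition absolute_moment :: "nat \<Rightarrow> real" where
  "absolute_moment p = (LINT u|\<mu>. (1 + norm u) ^ p)"

lemma integrable_cubic: "integrable \<mu> (\<lambda>u. 1 + norm u ^ 3)"
  using third_moment by simp

text \<open>Growth of degree at most 3 is dominated by \<open>8 * (1 + norm u ^ 3)\<close>; the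
  constant comes from comparing \<open>norm u\<close> with 1.\<close>

lemma integrable_growth:
  fixes g :: "real ^ 'm \<Rightarrow> 'c::{banach, second_countable_topology}"
  assumes [measurable]: "g \<in> borel_measurable borel"
    and p: "p \<le> 3" and g: "\<And>u. norm (g u) \<le> c * (1 + norm u) ^ p"
  shows "integrable \<mu> g"
proof -
  have *: "integrable \<mu> (\<lambda>u. (1 + norm u) ^ 3)"
  proof (rule Bochner_Integration.integrable_bound)
    show "integrable \<mu> (\<lambda>u. 8 * (1 + norm u ^ 3))"
      by (intro Bochner_Integration.integrable_mult_right integrable_cubic)
    have "(1 + r) ^ 3 \<le> 8 * (1 + r ^ 3)" if r: "r \<ge> 0" for r :: real
    proof (cases "r \<le> 1")
      case True
      then have "(1 + r) ^ 3 \<le> 2 ^ 3" using r by (intro power_mono) auto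
      then show ?thesis using r by simp (smt (verit) zero_le_power)
    next
      case False
      then have "(1 + r) ^ 3 \<le> (2 * r) ^ 3" by (intro power_mono) auto
      then show ?thesis by (simp add: power_mult_distrib)
    qed
    then show "AE u in \<mu>. norm ((1 + norm u) ^ 3) \<le> norm (8 * (1 + norm u ^ 3))"
      by (auto simp: abs_mult)
  qed simp
  show ?thesis
  proof (rule Bochner_Integration.integrable_bound)
    show "integrable \<mu> (\<lambda>u. \<bar>c\<bar> * (1 + norm u) ^ 3)" using * by simp
    have "norm (g u) \<le> \<bar>c\<bar> * (1 + norm u) ^ 3" for u
    proof -
      have "norm (g u) \<le> \<bar>c\<bar> * (1 + norm u) ^ p"
        by (rule order_trans[OF g]) (auto intro!: mult_right_mono)
      also have "\<dots> \<le> \<bar>c\<bar> * (1 + norm u) ^ 3"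
        using p by (intro mult_left_mono power_increasing) auto
      finally show ?thesis .
    qed
    then show "AE u in \<mu>. norm (g u) \<le> norm (\<bar>c\<bar> * (1 + norm u) ^ 3)"
      by (auto simp: abs_mult)
  qed simp
qed

lemma integrable_absolute_moment: "p \<le> 3 \<Longrightarrow> integrable \<mu> (\<lambda>u. (1 + norm u) ^ p)"
  by (rule integrable_growth[where c=1]) auto

lemma absolute_moment_nonneg: "0 \<le> absolute_moment p"
  unfolding absolute_moment_def by (intro integral_nonneg_AE) auto

lemma integrable_id: "integrable \<mu> (\<lambda>u. u)"
  by (rule integrable_growth[where c=1 and p=1]) auto

lemma integrable_inner_quadratic:
  fixes A B :: "real ^ 'm ^ 'n"
  shows "integrable \<mu> (\<lambda>u. (A *v u) \<bullet> (B *v u))"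
proof (rule integrable_growth[where p=2 and c="onorm ((*v) A) * onorm ((*v) B)"])
  have bl: "bounded_linear ((*v) A)" "bounded_linear ((*v) B)"
    by (simp_all add: matrix_vector_mul_bounded_linear)
  show "(\<lambda>u. (A *v u) \<bullet> (B *v u)) \<in> borel_measurable borel"
    by (intro borel_measurable_continuous_onI continuous_intros linear_continuous_on bl)
  fix u
  have "norm ((A *v u) \<bullet> (B *v u)) \<le> norm (A *v u) * norm (B *v u)"
    by (simp add: Cauchy_Schwarz_ineq2)
  also have "\<dots> \<le> (onorm ((*v) A) * norm u) * (onorm ((*v) B) * norm u)"
    by (intro mult_mono onorm bl mult_nonneg_nonneg onorm_pos_le) auto
  also have "\<dots> = onorm ((*v) A) * onorm ((*v) B) * norm u ^ 2" by (simp add: power2_eq_square)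
  also have "\<dots> \<le> onorm ((*v) A) * onorm ((*v) B) * (1 + norm u) ^ 2"
    by (intro mult_left_mono power_mono mult_nonneg_nonneg onorm_pos_le bl) auto
  finally show "norm ((A *v u) \<bullet> (B *v u)) \<le> onorm ((*v) A) * onorm ((*v) B) * (1 + norm u) ^ 2" .
qed simp

lemma integral_quadratic_form:
  fixes B :: "real ^ 'm ^ 'm"
  shows "(LINT u|\<mu>. u \<bullet> (B *v u)) = trace B"
proof -
  have int: "integrable \<mu> (\<lambda>u. u $ i * u $ j)" for i j
  proof (rule integrable_growth[where p=2 and c=1])
    fix u :: "real ^ 'm"
    have "norm (u $ i * u $ j) \<le> norm u * norm u"
      unfolding norm_mult by (intro mult_mono Finite_Cartesian_Product.norm_nth_le) auto
    also have "\<dots> \<le> 1 * (1 + norm u) ^ 2" unfolding power2_eq_square mult_1 by (intro mult_mono) auto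
    finally show "norm (u $ i * u $ j) \<le> 1 * (1 + norm u) ^ 2" .
  qed auto
  have "(LINT u|\<mu>. u \<bullet> (B *v u)) = (LINT u|\<mu>. (\<Sum>i\<in>UNIV. \<Sum>j\<in>UNIV. B $ i $ j * (u $ i * u $ j)))"
    by (intro Bochner_Integration.integral_cong refl)
       (simp add: inner_vec_def matrix_vector_mult_def sum_distrib_left mult_ac)
  also have "\<dots> = (\<Sum>i\<in>UNIV. \<Sum>j\<in>UNIV. B $ i $ j * (LINT u|\<mu>. u $ i * u $ j))"
    using int by (simp add: Bochner_Integration.integral_sum)
  also have "\<dots> = trace B" by (simp add: covariance trace_def if_distrib[of "(*) _"] cong: if_cong)
  finally show ?thesis .
qed

text \<open>This is the source of the second-order term of \<open>generator\<close>, with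
  \<open>A\<close> in the role of the diffusion matrix.\<close>

lemma integral_quadratic_image:
  fixes A :: "real ^ 'm ^ 'd" and H :: "real ^ 'd ^ 'd"
  shows "(LINT u|\<mu>. (A *v u) \<bullet> (H *v (A *v u))) = trace (transpose A ** H ** A)"
proof -
  have "(A *v u) \<bullet> (H *v (A *v u)) = u \<bullet> ((transpose A ** H ** A) *v u)" for u
    by (metis matrix_vector_mul_assoc transpose_matrix_vector inner_commute dot_lmul_matrix)
  then show ?thesis by (simp add: integral_quadratic_form)
qed

text \<open>\<open>v\<close> and \<open>A\<close> stand for the values of the drift and the
  diffusion at \<open>x\<close>, so the expansion below treats the coefficients as
  constants.\<close>

definition one_step :: "(real ^ 'd \<Rightarrow> real) \<Rightarrow> real ^ 'd \<Rightarrow> real ^ 'd \<Rightarrow> real ^ 'm ^ 'd \<Rightarrow> real \<Rightarrow> real" where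
  "one_step f x v A g = (LINT u|\<mu>. f (x + g *\<^sub>R v + sqrt g *\<^sub>R (A *v u)))"

text \<open>The Taylor polynomial of the increment is an affine function of \<open>u\<close> plus a
  quadratic form. Centering removes the linear part and the covariance turns the form into a trace.
  The term in \<open>g\<^sup>2\<close> comes from the drift alone and is the only polynomial term
  foreign to the generator.\<close>

lemma one_step_expansion:
  fixes f :: "real ^ 'd \<Rightarrow> real" and A :: "real ^ 'm ^ 'd" and v :: "real ^ 'd"
  assumes f: "C2 f" "\<And>x. \<bar>f x\<bar> \<le> B" and g: "g \<ge> 0"
  defines "h \<equiv> \<lambda>u. g *\<^sub>R v + sqrt g *\<^sub>R (A *v u)"
  shows "integrable \<mu> (\<lambda>u. taylor_remainder f x (h u))" (is ?int)
    and "one_step f x v A g = f x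
      + g * (grad f x \<bullet> v + 1 / 2 * trace (transpose A ** hessian f x ** A))
      + 1 / 2 * g\<^sup>2 * (v \<bullet> (hessian f x *v v)) + (LINT u|\<mu>. taylor_remainder f x (h u))" (is ?eq)
proof -
  let ?H = "hessian f x"
  have bl: "bounded_linear ((*v) A)" by (rule matrix_vector_mul_bounded_linear)
  have contA: "continuous_on UNIV (\<lambda>u. A *v u)" using bl by (rule linear_continuous_on)
  have sq: "sqrt g * sqrt g = g" using g by simp
  \<comment> \<open>All coefficients linear in \<open>u\<close>: the gradient term, of order
    \<open>sqrt g\<close>, and the two mixed terms of drift and noise, one for each order of the
    factors around \<open>?H\<close>.\<close>
  define c where "c = sqrt g *\<^sub>R (transpose A *v grad f x)
      + (1 / 2 * g * sqrt g) *\<^sub>R (transpose A *v (?H *v v) + transpose A *v (v v* ?H))"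
  define q where "q = f x + g * (grad f x \<bullet> v) + 1 / 2 * g\<^sup>2 * (v \<bullet> (?H *v v))"
  have lin: "f x + grad f x \<bullet> h u + 1 / 2 * (h u \<bullet> (?H *v h u)) =
      q + c \<bullet> u + 1 / 2 * g * ((A *v u) \<bullet> (?H *v (A *v u)))" for u
  proof -
    have a: "w \<bullet> (A *v u) = (transpose A *v w) \<bullet> u" for w
      by (simp add: transpose_matrix_vector dot_lmul_matrix)
    have b: "v \<bullet> (?H *v (A *v u)) = (transpose A *v (v v* ?H)) \<bullet> u"
      by (simp add: dot_lmul_matrix transpose_matrix_vector)
    have "h u \<bullet> (?H *v h u) = g\<^sup>2 * (v \<bullet> (?H *v v)) + g * sqrt g * ((A *v u) \<bullet> (?H *v v))
       + g * sqrt g * (v \<bullet> (?H *v (A *v u))) + (sqrt g * sqrt g) * ((A *v u) \<bullet> (?H *v (A *v u)))"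
      unfolding h_def
      by (simp add: matrix_vector_right_distrib matrix_vector_mult_scaleR inner_add_left inner_add_right
          power2_eq_square algebra_simps del: real_sqrt_mult_self)
    also have "(A *v u) \<bullet> (?H *v v) = (transpose A *v (?H *v v)) \<bullet> u"
      by (simp add: a inner_commute[of "A *v u"])
    also note b
    also note sq
    finally have "h u \<bullet> (?H *v h u) = g\<^sup>2 * (v \<bullet> (?H *v v))
       + g * sqrt g * ((transpose A *v (?H *v v)) \<bullet> u)
       + g * sqrt g * ((transpose A *v (v v* ?H)) \<bullet> u) + g * ((A *v u) \<bullet> (?H *v (A *v u)))" .
    moreover have "grad f x \<bullet> h u = g * (grad f x \<bullet> v) + sqrt g * ((transpose A *v grad f x) \<bullet> u)"
      by (simp add: h_def inner_add_right a)
    ultimately show ?thesis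
      by (simp add: q_def c_def inner_add_left algebra_simps)
  qed
  have R: "taylor_remainder f x (h u) = f (x + h u)
      - (q + c \<bullet> u + 1 / 2 * g * ((A *v u) \<bullet> (?H *v (A *v u))))" for u
    unfolding lin[symmetric] taylor_remainder_def by simp
  have i1: "integrable \<mu> (\<lambda>u. f (x + h u))"
  proof (rule integrable_const_bound[where B=B])
    have "continuous_on UNIV (\<lambda>u. f (x + h u))"
      unfolding h_def
      by (rule continuous_on_compose2[OF C2_continuous[OF f(1)]]) (auto intro!: continuous_intros contA)
    then show "(\<lambda>u. f (x + h u)) \<in> borel_measurable \<mu>"
      using borel_measurable_continuous_onI by (simp add: measurable_cong_sets[OF sets_law refl])
  qed (use f in auto)
  have i2: "integrable \<mu> (\<lambda>u. c \<bullet> u)" using integrable_id by simp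
  have i3: "integrable \<mu> (\<lambda>u. (A *v u) \<bullet> (?H *v (A *v u)))"
    using integrable_inner_quadratic[of A "?H ** A"] by (simp add: matrix_vector_mul_assoc)
  show ?int unfolding R using i1 i2 i3 by simp
  have "(LINT u|\<mu>. taylor_remainder f x (h u)) = (LINT u|\<mu>. f (x + h u))
      - (q + (LINT u|\<mu>. c \<bullet> u) + 1 / 2 * g * (LINT u|\<mu>. (A *v u) \<bullet> (?H *v (A *v u))))"
    unfolding R using i1 i2 i3 by (simp add: prob_space)
  also have "(LINT u|\<mu>. c \<bullet> u) = 0"
    using integrable_id by (simp add: mean)
  finally show ?eq
    by (simp add: one_step_def h_def q_def integral_quadratic_image algebra_simps)
qed

text \<open>The constants \<open>a\<close> and \<open>c\<close> are free so that both remainder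
  bounds fit: the cubic one with a small \<open>a\<close>, and the quadratic one with
  \<open>c = 0\<close>.\<close>

lemma one_step_error:
  fixes f :: "real ^ 'd \<Rightarrow> real" and A :: "real ^ 'm ^ 'd"
  assumes f: "C2 f" "\<And>x. \<bar>f x\<bar> \<le> B" and g: "g \<ge> 0" and J: "J \<ge> 0"
    and jump: "AE u in \<mu>. norm (g *\<^sub>R v + sqrt g *\<^sub>R (A *v u)) \<le> J * (1 + norm u)"
    and R: "\<And>h. \<bar>taylor_remainder f x h\<bar> \<le> a * (norm h)\<^sup>2 + c * norm h ^ 3" and ac: "a \<ge> 0" "c \<ge> 0"
  shows "\<bar>one_step f x v A g - f x - g * (grad f x \<bullet> v + 1 / 2 * trace (transpose A ** hessian f x ** A))\<bar>
    \<le> 1 / 2 * g\<^sup>2 * \<bar>v \<bullet> (hessian f x *v v)\<bar> + a * J\<^sup>2 * absolute_moment 2 + c * J ^ 3 * absolute_moment 3"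
proof -
  let ?h = "\<lambda>u. g *\<^sub>R v + sqrt g *\<^sub>R (A *v u)"
  note exp = one_step_expansion[OF f g, where x=x and v=v and A=A]
  have "\<bar>LINT u|\<mu>. taylor_remainder f x (?h u)\<bar> \<le> (LINT u|\<mu>. a * J\<^sup>2 * (1 + norm u)\<^sup>2 + c * J ^ 3 * (1 + norm u) ^ 3)"
  proof (rule order_trans[OF integral_abs_bound integral_mono_AE])
    show "AE u in \<mu>. \<bar>taylor_remainder f x (?h u)\<bar>
        \<le> a * J\<^sup>2 * (1 + norm u)\<^sup>2 + c * J ^ 3 * (1 + norm u) ^ 3"
      using jump
    proof eventually_elim
      case (elim u)
      have "a * (norm (?h u))\<^sup>2 + c * norm (?h u) ^ 3 \<le> a * (J * (1 + norm u))\<^sup>2 + c * (J * (1 + norm u)) ^ 3"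
        using elim ac by (intro add_mono mult_left_mono power_mono) auto
      with R[of "?h u"] show ?case by (simp add: power_mult_distrib)
    qed
  qed (use exp(1) integrable_absolute_moment[of 2] integrable_absolute_moment[of 3] in auto)
  also have "\<dots> = a * J\<^sup>2 * absolute_moment 2 + c * J ^ 3 * absolute_moment 3"
    using integrable_absolute_moment[of 2] integrable_absolute_moment[of 3]
    by (simp add: absolute_moment_def)
  moreover have "\<bar>1 / 2 * g\<^sup>2 * (v \<bullet> (hessian f x *v v))\<bar> = 1 / 2 * g\<^sup>2 * \<bar>v \<bullet> (hessian f x *v v)\<bar>"
    by (simp add: abs_mult)
  ultimately show ?thesis unfolding exp(2) by linarith
qed

text \<open>Controls the compensator in a martingale difference; together with the same estimate for
  the actual jump it makes the conditional variance of order \<open>J\<^sup>2\<close>.\<close>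

lemma one_step_lipschitz:
  fixes f :: "real ^ 'd \<Rightarrow> real" and A :: "real ^ 'm ^ 'd"
  assumes f: "continuous_on UNIV f" "\<And>x. \<bar>f x\<bar> \<le> B" "\<And>x h. \<bar>f (x + h) - f x\<bar> \<le> L * norm h" "L \<ge> 0"
    and jump: "AE u in \<mu>. norm (g *\<^sub>R v + sqrt g *\<^sub>R (A *v u)) \<le> J * (1 + norm u)"
  shows "\<bar>one_step f x v A g - f x\<bar> \<le> L * J * absolute_moment 1"
proof -
  let ?h = "\<lambda>u. g *\<^sub>R v + sqrt g *\<^sub>R (A *v u)"
  have "continuous_on UNIV (\<lambda>u. A *v u)"
    by (intro linear_continuous_on matrix_vector_mul_bounded_linear)
  then have "continuous_on UNIV (\<lambda>u. f (x + ?h u))"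
    by (intro continuous_on_compose2[OF f(1)]) (auto intro!: continuous_intros)
  then have "(\<lambda>u. f (x + ?h u)) \<in> borel_measurable \<mu>"
    using borel_measurable_continuous_onI by (simp add: measurable_cong_sets[OF sets_law refl])
  then have int: "integrable \<mu> (\<lambda>u. f (x + ?h u))"
    using f(2) by (intro integrable_const_bound[where B=B]) auto
  have "one_step f x v A g - f x = (LINT u|\<mu>. f (x + ?h u) - f x)"
    using int by (simp add: one_step_def prob_space add.assoc)
  also have "\<bar>\<dots>\<bar> \<le> (LINT u|\<mu>. L * J * (1 + norm u) ^ 1)"
  proof (rule order_trans[OF integral_abs_bound integral_mono_AE])
    show "AE u in \<mu>. \<bar>f (x + ?h u) - f x\<bar> \<le> L * J * (1 + norm u) ^ 1"
      using jump
    proof eventually_elim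
      case (elim u)
      have "\<bar>f (x + ?h u) - f x\<bar> \<le> L * norm (?h u)" by (rule f(3))
      also have "\<dots> \<le> L * (J * (1 + norm u))" by (intro mult_left_mono elim f(4))
      finally show ?case by simp
    qed
  qed (use int integrable_absolute_moment[of 1] in auto)
  also have "\<dots> = L * J * absolute_moment 1"
    unfolding absolute_moment_def by (rule integral_mult_right_zero)
  finally show ?thesis .
qed

end

subsection \<open>The driving noise\<close>

text \<open>The norm is at most the dimension times the largest coordinate, and
  \<open>r ^ 3 \<le> 27 * exp r\<close> follows from \<open>r / 3 \<le> exp (r / 3)\<close>. Only
  exponentials along coordinate directions appear, which are instances of the sub-Gaussian
  hypothesis.\<close>

lemma norm_power3_le_exp:
  fixes u :: "real ^ 'm"
  shows "norm u ^ 3 \<le> 27 * real CARD('m) ^ 3 * (\<Sum>i\<in>UNIV. exp (u $ i) + exp (- (u $ i)))"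
proof -
  have cube: "r ^ 3 \<le> 27 * exp r" if "r \<ge> 0" for r :: real
  proof -
    have "r / 3 \<le> exp (r / 3)" using exp_ge_add_one_self[of "r / 3"] by linarith
    then have "(r / 3) ^ 3 \<le> exp (r / 3) ^ 3" using that by (intro power_mono) auto
    also have "exp (r / 3) ^ 3 = exp r" by (simp add: exp_of_nat_mult[symmetric])
    finally show ?thesis by (simp add: power_divide)
  qed
  let ?A = "(\<lambda>i. \<bar>u $ i\<bar>) ` UNIV"
  have "Max ?A \<in> ?A" by (rule Max_in) auto
  then obtain i where i: "Max ?A = \<bar>u $ i\<bar>" by (rule imageE)
  have max: "\<bar>u $ j\<bar> \<le> \<bar>u $ i\<bar>" for j unfolding i[symmetric] by (intro Max_ge) auto
  have "norm u \<le> (\<Sum>j\<in>UNIV. \<bar>u $ j\<bar>)" by (rule norm_le_l1_cart)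
  also have "\<dots> \<le> (\<Sum>j\<in>(UNIV :: 'm set). \<bar>u $ i\<bar>)" by (intro sum_mono max)
  finally have "norm u \<le> real CARD('m) * \<bar>u $ i\<bar>" by simp
  then have "norm u ^ 3 \<le> (real CARD('m) * \<bar>u $ i\<bar>) ^ 3" by (intro power_mono) auto
  also have "\<dots> = real CARD('m) ^ 3 * \<bar>u $ i\<bar> ^ 3" by (rule power_mult_distrib)
  also have "\<dots> \<le> real CARD('m) ^ 3 * (27 * exp \<bar>u $ i\<bar>)" by (intro mult_left_mono cube) auto
  also have "exp \<bar>u $ i\<bar> \<le> exp (u $ i) + exp (- (u $ i))" by (cases "u $ i \<ge> 0") auto
  also have "\<dots> \<le> (\<Sum>i\<in>UNIV. exp (u $ i) + exp (- (u $ i)))"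
    by (rule member_le_sum[where f="\<lambda>i. exp (u $ i) + exp (- (u $ i))"]) (auto intro: add_nonneg_nonneg)
  finally show ?thesis by (simp add: mult_ac)
qed

text \<open>By \<open>exp x \<ge> 1 + x\<close>, the function
  \<open>exp (\<kappa> * t\<^sup>2 / 2) - 1 - t * ?m\<close> is nonnegative and vanishes at 0, so
  its derivative there, \<open>- ?m\<close>, is 0.\<close>

lemma (in prob_space) subgaussian_centered:
  fixes Z :: "'a \<Rightarrow> real"
  assumes Z: "integrable M Z" and exp: "\<And>t. integrable M (\<lambda>\<omega>. exp (t * Z \<omega>))"
    and bound: "\<And>t. (LINT \<omega>|M. exp (t * Z \<omega>)) \<le> exp (\<kappa> * t\<^sup>2 / 2)"
  shows "(LINT \<omega>|M. Z \<omega>) = 0"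
proof -
  let ?m = "LINT \<omega>|M. Z \<omega>"
  have "1 + t * ?m \<le> exp (\<kappa> * t\<^sup>2 / 2)" for t
  proof -
    have "1 + t * ?m = (LINT \<omega>|M. 1 + t * Z \<omega>)" using Z by (simp add: prob_space)
    also have "\<dots> \<le> (LINT \<omega>|M. exp (t * Z \<omega>))"
      using Z by (intro integral_mono exp) (auto intro: exp_ge_add_one_self)
    finally show ?thesis using bound[of t] by linarith
  qed
  then have min: "\<forall>t. \<bar>0 - t\<bar> < 1 \<longrightarrow> exp (\<kappa> * 0\<^sup>2 / 2) - 1 - 0 * ?m \<le> exp (\<kappa> * t\<^sup>2 / 2) - 1 - t * ?m"
    by (auto simp: algebra_simps)
  have "((\<lambda>t. exp (\<kappa> * t\<^sup>2 / 2) - 1 - t * ?m) has_real_derivative - ?m) (at 0)"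
    by (auto intro!: derivative_eq_intros)
  from DERIV_local_min[OF this zero_less_one min] show ?thesis by simp
qed

lemma subgaussian_noise_normalized:
  fixes U :: "nat \<Rightarrow> 'a \<Rightarrow> real ^ 'm"
  assumes "prob_space M" and "subgaussian_noise M U"
  shows "normalized_noise (distr M borel (U 1))"
proof -
  interpret prob_space M by fact
  define Z where "Z = U 1"
  have [measurable]: "Z \<in> borel_measurable M"
    using assms(2) unfolding Z_def by (auto simp: subgaussian_noise_def indep_vars_def)
  have cov: "covariance_matrix M Z = mat 1"
    using assms(2) unfolding Z_def subgaussian_noise_def by blast
  obtain \<kappa> where \<kappa>: "\<And>\<theta>. (\<integral>\<^sup>+ \<omega>. ennreal (exp (\<theta> \<bullet> Z \<omega>)) \<partial>M) \<le> ennreal (exp (\<kappa> * (norm \<theta>)\<^sup>2 / 2))"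
    using assms(2) unfolding Z_def subgaussian_noise_def by blast
  have int_exp: "integrable M (\<lambda>\<omega>. exp (\<theta> \<bullet> Z \<omega>))" for \<theta>
  proof (rule integrableI_nonneg)
    show "(\<integral>\<^sup>+ \<omega>. ennreal (exp (\<theta> \<bullet> Z \<omega>)) \<partial>M) < \<infinity>"
      by (rule le_less_trans[OF \<kappa>]) simp
  qed auto
  have bound: "(LINT \<omega>|M. exp (\<theta> \<bullet> Z \<omega>)) \<le> exp (\<kappa> * (norm \<theta>)\<^sup>2 / 2)" for \<theta>
    using \<kappa>[of \<theta>] nn_integral_eq_integral[OF int_exp[of \<theta>]] by (simp add: ennreal_le_iff)
  have coord: "axis i t \<bullet> Z \<omega> = t * Z \<omega> $ i" for i t \<omega>
    by (simp add: inner_axis')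
  have int3: "integrable M (\<lambda>\<omega>. norm (Z \<omega>) ^ 3)"
  proof (rule Bochner_Integration.integrable_bound)
    show "integrable M (\<lambda>\<omega>. 27 * real CARD('m) ^ 3 * (\<Sum>i\<in>UNIV. exp (Z \<omega> $ i) + exp (- (Z \<omega> $ i))))"
      using int_exp[of "axis _ 1"] int_exp[of "axis _ (-1)"]
      by (intro Bochner_Integration.integrable_mult_right Bochner_Integration.integrable_sum
          Bochner_Integration.integrable_add) (simp_all add: coord)
    show "AE \<omega> in M. norm (norm (Z \<omega>) ^ 3)
        \<le> norm (27 * real CARD('m) ^ 3 * (\<Sum>i\<in>UNIV. exp (Z \<omega> $ i) + exp (- (Z \<omega> $ i))))"
    proof (rule AE_I2)
      fix \<omega>
      show "norm (norm (Z \<omega>) ^ 3)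
          \<le> norm (27 * real CARD('m) ^ 3 * (\<Sum>i\<in>UNIV. exp (Z \<omega> $ i) + exp (- (Z \<omega> $ i))))"
        unfolding real_norm_def
        by (rule order_trans[OF _ abs_ge_self]) (use norm_power3_le_exp[of "Z \<omega>"] in simp)
    qed
  qed simp
  have int1: "integrable M Z"
  proof (rule Bochner_Integration.integrable_bound)
    show "integrable M (\<lambda>\<omega>. 1 + norm (Z \<omega>) ^ 3)" using int3 by simp
    have "r \<le> 1 + r ^ 3" if "r \<ge> 0" for r :: real
      using that power_increasing[of 1 3 r] by (cases "r \<le> 1") (auto intro: add_increasing2)
    then show "AE \<omega> in M. norm (Z \<omega>) \<le> norm (1 + norm (Z \<omega>) ^ 3)" by auto
  qed simp
  have int1i: "integrable M (\<lambda>\<omega>. Z \<omega> $ i)" for i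
    by (rule integrable_bounded_linear[OF bounded_linear_vec_nth int1])
  have mean_i: "(LINT \<omega>|M. Z \<omega> $ i) = 0" for i
  proof (rule subgaussian_centered[OF int1i])
    fix t :: real
    show "integrable M (\<lambda>\<omega>. exp (t * Z \<omega> $ i))" using int_exp[of "axis i t"] by (simp add: coord)
    show "(LINT \<omega>|M. exp (t * Z \<omega> $ i)) \<le> exp (\<kappa> * t\<^sup>2 / 2)"
      using bound[of "axis i t"]
      by (simp add: coord power2_norm_eq_inner inner_axis_axis flip: power2_eq_square)
  qed
  show ?thesis
    unfolding Z_def[symmetric] normalized_noise_def normalized_noise_axioms_def
  proof (intro conjI allI)
    show "prob_space (distr M borel Z)" by (rule prob_space_distr) simp
    show "integrable (distr M borel Z) (\<lambda>u. norm u ^ 3)"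
      using int3 by (subst integrable_distr_eq) auto
    have "(LINT \<omega>|M. Z \<omega>) = 0"
    proof (rule vec_eq_iff[THEN iffD2], intro allI)
      fix i
      have "(LINT \<omega>|M. Z \<omega>) $ i = (LINT \<omega>|M. Z \<omega> $ i)"
        by (rule integral_bounded_linear[OF bounded_linear_vec_nth int1, symmetric])
      then show "(LINT \<omega>|M. Z \<omega>) $ i = 0 $ i" using mean_i by simp
    qed
    then show "(LINT u|distr M borel Z. u) = 0"
      by (subst integral_distr) auto
    fix i j
    \<comment> \<open>Once the mean is known to be 0, the entries of the covariance matrix are plain
      second moments.\<close>
    have "(LINT \<omega>|M. Z \<omega> $ i * Z \<omega> $ j) = covariance_matrix M Z $ i $ j"
      by (simp add: covariance_matrix_def mean_i)
    then show "(LINT u|distr M borel Z. u $ i * u $ j) = (if i = j then 1 else 0)"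
      by (subst integral_distr) (auto simp: cov mat_def)
  qed simp
qed

section \<open>Independence of the next noise variable from the past\<close>

lemma space_noise_filtration [simp]: "space (noise_filtration M U n) = space M"
  by (simp add: noise_filtration_def space_measure_of_conv)

lemma sets_noise_filtration:
  "sets (noise_filtration M U n) =
    sigma_sets (space M) (\<Union>k\<in>{1..n}. {U k -` A \<inter> space M | A. A \<in> sets borel})"
  unfolding noise_filtration_def by (rule sets_measure_of) auto

lemma noise_filtration_mono:
  assumes "m \<le> n"
  shows "sets (noise_filtration M U m) \<subseteq> sets (noise_filtration M U n)"
  unfolding sets_noise_filtration using assms by (intro sigma_sets_mono') force

lemma noise_filtration_measurable:
  assumes "1 \<le> k" "k \<le> n"
  shows "U k \<in> borel_measurable (noise_filtration M U n)"
proof (rule measurableI)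
  fix A :: "(real ^ 'b) set" assume "A \<in> sets borel"
  then show "U k -` A \<inter> space (noise_filtration M U n) \<in> sets (noise_filtration M U n)"
    unfolding sets_noise_filtration space_noise_filtration using assms
    by (intro sigma_sets.Basic UN_I[of k]) auto
qed simp

lemma (in prob_space) subalgebra_noise_filtration:
  assumes "\<And>k. 1 \<le> k \<Longrightarrow> U k \<in> borel_measurable M"
  shows "subalgebra M (noise_filtration M U n)"
proof -
  have "sigma_sets (space M) (\<Union>k\<in>{1..n}. {U k -` A \<inter> space M | A. A \<in> sets borel}) \<subseteq> sets M"
    using assms by (intro sets.sigma_sets_subset) (auto intro: measurable_sets)
  then show ?thesis by (simp add: subalgebra_def sets_noise_filtration)
qed

text \<open>Independence is put as a product law for the pair of the sample point, seen only through
  the past, and the next noise. In this form, averaging over the next noise becomes Fubini's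
  theorem.\<close>

lemma (in prob_space) indep_noise_filtration:
  assumes ind: "indep_vars (\<lambda>_. borel) U {1..}"
  shows "distr M (noise_filtration M U n \<Otimes>\<^sub>M borel) (\<lambda>\<omega>. (\<omega>, U (Suc n) \<omega>)) =
    restr_to_subalg M (noise_filtration M U n) \<Otimes>\<^sub>M distr M borel (U (Suc n))"
proof -
  let ?F = "noise_filtration M U n"
  let ?E = "\<lambda>k. {U k -` A \<inter> space M | A. A \<in> sets borel}"
  have U: "\<And>k. 1 \<le> k \<Longrightarrow> U k \<in> borel_measurable M" using ind by (auto simp: indep_vars_def)
  have sub: "subalgebra M ?F" by (rule subalgebra_noise_filtration[OF U])
  \<comment> \<open>Two blocks of indices, the past and the next one: independence of the
    intersection-stable generators passes to the sigma-algebras generated by the blocks.\<close>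
  let ?I = "case_bool {1..n} {Suc n}"
  have ind_E: "indep_sets ?E (\<Union>j\<in>UNIV. ?I j)"
  proof (rule indep_sets_mono_index)
    show "indep_sets ?E {1..}" using ind unfolding indep_vars_def2 by (rule conjunct2)
    show "(\<Union>j\<in>UNIV. ?I j) \<subseteq> {1..}" by (auto simp: UNIV_bool)
  qed
  have stable: "Int_stable (?E i)" for i
  proof (rule Int_stableI)
    fix a b assume "a \<in> ?E i" "b \<in> ?E i"
    then obtain A B where AB: "a = U i -` A \<inter> space M" "b = U i -` B \<inter> space M" "A \<in> sets borel" "B \<in> sets borel"
      by blast
    then have "a \<inter> b = U i -` (A \<inter> B) \<inter> space M" "A \<inter> B \<in> sets borel" by auto
    then show "a \<inter> b \<in> ?E i" by blast
  qed
  have disj: "disjoint_family_on ?I UNIV" by (auto simp: disjoint_family_on_def UNIV_bool)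
  have "indep_sets (\<lambda>j. sigma_sets (space M) (\<Union>i\<in>?I j. ?E i)) UNIV"
    by (rule indep_sets_collect_sigma[OF ind_E stable disj])
  moreover have "(\<lambda>j. sigma_sets (space M) (\<Union>i\<in>case_bool {1..n} {Suc n} j. ?E i)) =
      case_bool (sets ?F) (sigma_sets (space M) (?E (Suc n)))"
    by (auto simp: fun_eq_iff sets_noise_filtration split: bool.splits)
  ultimately have is_FU: "indep_set (sets ?F) (sigma_sets (space M) (?E (Suc n)))"
    by (simp add: indep_set_def)
  have id_meas: "(\<lambda>\<omega>. \<omega>) \<in> measurable M ?F"
    using sub by (auto simp: measurable_def subalgebra_def)
  have pair_meas: "(\<lambda>\<omega>. (\<omega>, U (Suc n) \<omega>)) \<in> measurable M (?F \<Otimes>\<^sub>M borel)"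
    using id_meas U[of "Suc n"] by simp
  interpret R: prob_space "restr_to_subalg M ?F"
    by (rule prob_space_restr_to_subalg[OF sub prob_space_axioms])
  interpret N: prob_space "distr M borel (U (Suc n))"
    by (rule prob_space_distr) (simp add: U)
  have "restr_to_subalg M ?F \<Otimes>\<^sub>M distr M borel (U (Suc n)) =
      distr M (?F \<Otimes>\<^sub>M borel) (\<lambda>\<omega>. (\<omega>, U (Suc n) \<omega>))"
  proof (rule pair_measure_eqI)
    show "sets (restr_to_subalg M ?F \<Otimes>\<^sub>M distr M borel (U (Suc n))) =
        sets (distr M (?F \<Otimes>\<^sub>M borel) (\<lambda>\<omega>. (\<omega>, U (Suc n) \<omega>)))"
      unfolding sets_distr by (intro sets_pair_measure_cong sets_restr_to_subalg[OF sub] sets_distr)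
    fix A B assume "A \<in> sets (restr_to_subalg M ?F)" "B \<in> sets (distr M borel (U (Suc n)))"
    then have A: "A \<in> sets ?F" and B: "B \<in> sets borel" by (simp_all add: sets_restr_to_subalg[OF sub])
    have AM: "A \<subseteq> space M" using sets.sets_into_space[OF A] by simp
    let ?B = "U (Suc n) -` B \<inter> space M"
    have "emeasure (distr M (?F \<Otimes>\<^sub>M borel) (\<lambda>\<omega>. (\<omega>, U (Suc n) \<omega>))) (A \<times> B)
        = emeasure M ((\<lambda>\<omega>. (\<omega>, U (Suc n) \<omega>)) -` (A \<times> B) \<inter> space M)"
      using A B by (intro emeasure_distr pair_meas) simp
    also have "(\<lambda>\<omega>. (\<omega>, U (Suc n) \<omega>)) -` (A \<times> B) \<inter> space M = A \<inter> ?B" using AM by auto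
    also have "emeasure M (A \<inter> ?B) = emeasure M A * emeasure M ?B"
    proof -
      have "prob (A \<inter> ?B) = prob A * prob ?B"
        by (rule indep_setD[OF is_FU A]) (use B in \<open>auto intro: sigma_sets.Basic\<close>)
      then show ?thesis by (simp add: emeasure_eq_measure ennreal_mult)
    qed
    finally show "emeasure (restr_to_subalg M ?F) A * emeasure (distr M borel (U (Suc n))) B =
        emeasure (distr M (?F \<Otimes>\<^sub>M borel) (\<lambda>\<omega>. (\<omega>, U (Suc n) \<omega>))) (A \<times> B)"
      using B U[of "Suc n"] by (simp add: emeasure_restr_to_subalg[OF sub A] emeasure_distr)
  qed (fact R.sigma_finite_measure_axioms N.sigma_finite_measure_axioms)+
  then show ?thesis by simp
qed

context
  fixes M :: "'a measure" and U :: "nat \<Rightarrow> 'a \<Rightarrow> real ^ 'm" and n :: nat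
  assumes M: "prob_space M" and noise: "subgaussian_noise M U"
begin

interpretation prob_space M by (rule M)

abbreviation (input) "\<F> \<equiv> noise_filtration M U n"

lemma noise_measurable: "1 \<le> k \<Longrightarrow> U k \<in> borel_measurable M"
  using noise by (auto simp: subgaussian_noise_def indep_vars_def)

lemma noise_subalgebra: "subalgebra M \<F>"
  by (rule subalgebra_noise_filtration) (rule noise_measurable)

lemma noise_joint_law:
  "distr M (\<F> \<Otimes>\<^sub>M borel) (\<lambda>\<omega>. (\<omega>, U (Suc n) \<omega>)) = restr_to_subalg M \<F> \<Otimes>\<^sub>M distr M borel (U 1)"
proof -
  have ind: "indep_vars (\<lambda>_. borel) U {1..}" and id: "\<forall>k\<ge>1. distr M borel (U k) = distr M borel (U 1)"
    using noise unfolding subgaussian_noise_def by blast+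
  have "distr M borel (U (Suc n)) = distr M borel (U 1)"
    by (rule id[rule_format]) simp
  then show ?thesis unfolding indep_noise_filtration[OF ind] by (rule arg_cong)
qed

lemma noise_pair_measurable: "(\<lambda>\<omega>. (\<omega>, U (Suc n) \<omega>)) \<in> measurable M (\<F> \<Otimes>\<^sub>M borel)"
proof -
  have "(\<lambda>\<omega>. \<omega>) \<in> measurable M \<F>"
    using noise_subalgebra by (auto simp: measurable_def subalgebra_def)
  then show ?thesis using noise_measurable[of "Suc n"] by simp
qed

lemma noise_pair_sigma_finite: "pair_sigma_finite (restr_to_subalg M \<F>) (distr M borel (U 1))"
proof -
  interpret R: prob_space "restr_to_subalg M \<F>"
    by (rule prob_space_restr_to_subalg[OF noise_subalgebra M])
  interpret N: prob_space "distr M borel (U 1)"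
    by (rule prob_space_distr) (simp add: noise_measurable)
  show ?thesis ..
qed

text \<open>The freezing lemma: the past is held fixed and the next noise is replaced by an
  independent variable \<open>u\<close>. The inner integral depends on the past only, so the outer
  one may be taken over \<open>M\<close> again.\<close>

lemma nn_integral_freeze:
  assumes h: "h \<in> borel_measurable (\<F> \<Otimes>\<^sub>M borel)"
  shows "(\<integral>\<^sup>+ \<omega>. h (\<omega>, U (Suc n) \<omega>) \<partial>M) = (\<integral>\<^sup>+ \<omega>. \<integral>\<^sup>+ u. h (\<omega>, u) \<partial>distr M borel (U 1) \<partial>M)"
proof -
  interpret P: pair_sigma_finite "restr_to_subalg M \<F>" "distr M borel (U 1)"
    by (rule noise_pair_sigma_finite)
  have s: "sets (restr_to_subalg M \<F> \<Otimes>\<^sub>M distr M borel (U 1)) = sets (\<F> \<Otimes>\<^sub>M borel)"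
    by (intro sets_pair_measure_cong) (auto simp: sets_restr_to_subalg[OF noise_subalgebra])
  have h': "h \<in> borel_measurable (restr_to_subalg M \<F> \<Otimes>\<^sub>M distr M borel (U 1))"
    using h unfolding measurable_cong_sets[OF s refl] .
  have h'': "h \<in> borel_measurable (\<F> \<Otimes>\<^sub>M distr M borel (U 1))"
    using h unfolding measurable_cong_sets[OF sets_pair_measure_cong[OF refl sets_distr] refl] .
  have "(\<integral>\<^sup>+ \<omega>. h (\<omega>, U (Suc n) \<omega>) \<partial>M) = (\<integral>\<^sup>+ z. h z \<partial>(restr_to_subalg M \<F> \<Otimes>\<^sub>M distr M borel (U 1)))"
    unfolding noise_joint_law[symmetric] by (subst nn_integral_distr[OF noise_pair_measurable]) (use h in simp_all)
  also have "\<dots> = (\<integral>\<^sup>+ \<omega>. \<integral>\<^sup>+ u. h (\<omega>, u) \<partial>distr M borel (U 1) \<partial>restr_to_subalg M \<F>)"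
    by (rule P.M2.nn_integral_fst[OF h', symmetric])
  also have "\<dots> = (\<integral>\<^sup>+ \<omega>. \<integral>\<^sup>+ u. h (\<omega>, u) \<partial>distr M borel (U 1) \<partial>M)"
    by (rule nn_integral_subalgebra2[OF noise_subalgebra P.M2.borel_measurable_nn_integral_fst[OF h'']])
  finally show ?thesis .
qed

lemma integral_freeze:
  fixes h :: "'a \<times> (real ^ 'm) \<Rightarrow> real"
  assumes h: "h \<in> borel_measurable (\<F> \<Otimes>\<^sub>M borel)" and b: "\<And>z. \<bar>h z\<bar> \<le> C"
  shows "(LINT \<omega>|M. h (\<omega>, U (Suc n) \<omega>)) = (LINT \<omega>|M. LINT u|distr M borel (U 1). h (\<omega>, u))"
proof -
  interpret P: pair_sigma_finite "restr_to_subalg M \<F>" "distr M borel (U 1)"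
    by (rule noise_pair_sigma_finite)
  interpret R: prob_space "restr_to_subalg M \<F>"
    by (rule prob_space_restr_to_subalg[OF noise_subalgebra M])
  interpret N: prob_space "distr M borel (U 1)"
    by (rule prob_space_distr) (simp add: noise_measurable)
  interpret RN: pair_prob_space "restr_to_subalg M \<F>" "distr M borel (U 1)" ..
  have s: "sets (restr_to_subalg M \<F> \<Otimes>\<^sub>M distr M borel (U 1)) = sets (\<F> \<Otimes>\<^sub>M borel)"
    by (intro sets_pair_measure_cong) (auto simp: sets_restr_to_subalg[OF noise_subalgebra])
  have h': "h \<in> borel_measurable (restr_to_subalg M \<F> \<Otimes>\<^sub>M distr M borel (U 1))"
    using h unfolding measurable_cong_sets[OF s refl] .
  have h'': "h \<in> borel_measurable (\<F> \<Otimes>\<^sub>M distr M borel (U 1))"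
    using h unfolding measurable_cong_sets[OF sets_pair_measure_cong[OF refl sets_distr] refl] .
  have int: "integrable (restr_to_subalg M \<F> \<Otimes>\<^sub>M distr M borel (U 1)) h"
    using h' b by (intro RN.integrable_const_bound[where B=C]) auto
  have "(LINT \<omega>|M. h (\<omega>, U (Suc n) \<omega>)) = (LINT z|(restr_to_subalg M \<F> \<Otimes>\<^sub>M distr M borel (U 1)). h z)"
    unfolding noise_joint_law[symmetric] by (subst integral_distr[OF noise_pair_measurable h]) simp
  also have "\<dots> = (LINT \<omega>|restr_to_subalg M \<F>. LINT u|distr M borel (U 1). h (\<omega>, u))"
    by (rule P.integral_fst'[OF int, symmetric])
  also have "\<dots> = (LINT \<omega>|M. LINT u|distr M borel (U 1). h (\<omega>, u))"
    using h'' by (intro integral_subalgebra2[OF noise_subalgebra] P.M2.borel_measurable_lebesgue_integral) simp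
  finally show ?thesis .
qed

text \<open>Transfers an almost sure bound along the actual noise to almost every value of a fresh
  noise variable, as required for integrating it against the law of the noise.\<close>

lemma AE_freeze:
  assumes P: "Measurable.pred (\<F> \<Otimes>\<^sub>M borel) P" and AE: "AE \<omega> in M. P (\<omega>, U (Suc n) \<omega>)"
  shows "AE \<omega> in M. AE u in distr M borel (U 1). P (\<omega>, u)"
proof -
  interpret P: pair_sigma_finite "restr_to_subalg M \<F>" "distr M borel (U 1)"
    by (rule noise_pair_sigma_finite)
  have "AE z in restr_to_subalg M \<F> \<Otimes>\<^sub>M distr M borel (U 1). P z"
    unfolding noise_joint_law[symmetric]
    using P AE by (subst AE_distr_iff[OF noise_pair_measurable]) (auto simp: pred_def)
  from P.AE_pair[OF this] show ?thesis
    by (rule AE_restr_to_subalg[OF noise_subalgebra])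
qed

end

subsection \<open>Summability from the drift condition\<close>

text \<open>Clearing the denominator and moving all negative terms to the other side allows
  integration without any integrability assumption. An infinite conditional expectation would
  contradict the finite right-hand side of the hypothesis.\<close>

lemma drift_condition_ennreal:
  fixes ce :: ennreal and w g \<alpha> \<beta> :: real
  assumes "(enn2ereal ce - ereal w) / ereal g \<le> ereal (- \<alpha> * w + \<beta>)"
    and "w \<ge> 0" "g > 0" "\<alpha> > 0" "\<beta> > 0"
  shows "ce + ennreal (\<alpha> * (g * w)) \<le> ennreal w + ennreal (\<beta> * g)"
proof (cases ce)
  case (real r)
  with assms(1) have "(r - w) / g \<le> - \<alpha> * w + \<beta>" using \<open>g > 0\<close> by (simp add: enn2ereal_ennreal)
  then have "r + \<alpha> * (g * w) \<le> w + \<beta> * g" using \<open>g > 0\<close> by (simp add: field_simps)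
  then show ?thesis using real assms by (simp flip: ennreal_plus)
next
  case top
  then show ?thesis using assms by simp
qed

text \<open>A summed drift inequality in expectation: multiplied by the nonincreasing weights and
  restricted to \<open>A\<close>, it telescopes. The event \<open>A\<close> replaces integrability
  of \<open>w n\<^sub>0\<close>. The gain on the left carries the actual step \<open>g n\<close>,
  while the loss on the right uses its deterministic bound \<open>\<gamma> n\<close>.\<close>

lemma (in prob_space) lyapunov_drift_summable:
  fixes F :: "nat \<Rightarrow> 'a measure" and w g :: "nat \<Rightarrow> 'a \<Rightarrow> real" and \<theta> \<gamma> :: "nat \<Rightarrow> real"
  assumes sub: "\<And>n. subalgebra M (F n)" and mono: "\<And>m n. m \<le> n \<Longrightarrow> sets (F m) \<subseteq> sets (F n)"
    and w_meas [measurable]: "\<And>n. w n \<in> borel_measurable M" and w0: "\<And>n \<omega>. w n \<omega> \<ge> 0"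
    and g_meas [measurable]: "\<And>n. g n \<in> borel_measurable M"
    and g: "\<And>n. AE \<omega> in M. 0 < g n \<omega> \<and> g n \<omega> \<le> \<gamma> n"
    and \<alpha>: "\<alpha> > 0" and \<beta>: "\<beta> > 0"
    and drift: "\<And>n. n \<ge> n\<^sub>0 \<Longrightarrow> AE \<omega> in M.
      (enn2ereal (nn_cond_exp M (F n) (\<lambda>\<omega>'. ennreal (w (Suc n) \<omega>')) \<omega>) - ereal (w n \<omega>)) / ereal (g n \<omega>)
        \<le> ereal (- \<alpha> * w n \<omega> + \<beta>)"
    and \<theta>: "decseq \<theta>" "\<And>n. \<theta> n \<ge> 0" and \<theta>_sum: "summable (\<lambda>n. \<theta> n * \<gamma> n)"
    and A: "A \<in> sets (F n\<^sub>0)" "\<And>\<omega>. \<omega> \<in> A \<Longrightarrow> w n\<^sub>0 \<omega> \<le> c"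
  shows "(\<Sum>n. \<integral>\<^sup>+ \<omega>. indicator A \<omega> * ennreal (\<theta> (n\<^sub>0 + n) * g (n\<^sub>0 + n) \<omega> * w (n\<^sub>0 + n) \<omega>) \<partial>M) < \<infinity>"
proof -
  define a where "a n = (\<integral>\<^sup>+ \<omega>. indicator A \<omega> * ennreal (w n \<omega>) \<partial>M)" for n
  define d where "d n = (\<integral>\<^sup>+ \<omega>. indicator A \<omega> * ennreal (g n \<omega> * w n \<omega>) \<partial>M)" for n
  have AM [measurable]: "A \<in> sets M" using A(1) sub[of n\<^sub>0] by (auto simp: subalgebra_def)
  have \<gamma>0: "\<gamma> n \<ge> 0" for n
  proof -
    have "AE \<omega> in M. 0 \<le> \<gamma> n" using g[of n] by eventually_elim auto
    then show ?thesis by simp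
  qed
  \<comment> \<open>\<open>A\<close> belongs to \<open>F n\<close> for every
    \<open>n \<ge> n\<^sub>0\<close>, so its indicator passes through the conditional
    expectation.\<close>
  have step: "a (Suc n) + ennreal \<alpha> * d n \<le> a n + ennreal (\<beta> * \<gamma> n)" if n: "n \<ge> n\<^sub>0" for n
  proof -
    interpret S: finite_measure_subalgebra M "F n"
      by standard (rule sub)
    let ?ce = "nn_cond_exp M (F n) (\<lambda>\<omega>. ennreal (w (Suc n) \<omega>))"
    have "A \<in> sets (F n)" using A(1) mono[OF n] by blast
    then have ind: "(\<lambda>\<omega>. indicator A \<omega> :: ennreal) \<in> borel_measurable (F n)" by simp
    have "a (Suc n) = (\<integral>\<^sup>+ \<omega>. indicator A \<omega> * ?ce \<omega> \<partial>M)"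
      unfolding a_def by (rule S.nn_cond_exp_intg[OF ind, symmetric]) measurable
    moreover have "ennreal \<alpha> * d n = (\<integral>\<^sup>+ \<omega>. indicator A \<omega> * ennreal (\<alpha> * (g n \<omega> * w n \<omega>)) \<partial>M)"
      unfolding d_def using \<alpha>
      by (subst nn_integral_cmult[symmetric]) (auto simp: ennreal_mult' mult_ac intro!: nn_integral_cong)
    ultimately have "a (Suc n) + ennreal \<alpha> * d n =
        (\<integral>\<^sup>+ \<omega>. indicator A \<omega> * ?ce \<omega> + indicator A \<omega> * ennreal (\<alpha> * (g n \<omega> * w n \<omega>)) \<partial>M)"
      by (simp add: nn_integral_add)
    also have "\<dots> \<le> (\<integral>\<^sup>+ \<omega>. indicator A \<omega> * ennreal (w n \<omega>) + ennreal (\<beta> * \<gamma> n) \<partial>M)"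
    proof (rule nn_integral_mono_AE)
      show "AE \<omega> in M. indicator A \<omega> * ?ce \<omega> + indicator A \<omega> * ennreal (\<alpha> * (g n \<omega> * w n \<omega>))
          \<le> indicator A \<omega> * ennreal (w n \<omega>) + ennreal (\<beta> * \<gamma> n)"
        using g[of n] drift[OF n]
      proof eventually_elim
        case (elim \<omega>)
        have "?ce \<omega> + ennreal (\<alpha> * (g n \<omega> * w n \<omega>)) \<le> ennreal (w n \<omega>) + ennreal (\<beta> * g n \<omega>)"
          using elim \<alpha> \<beta> w0 by (intro drift_condition_ennreal) auto
        also have "\<dots> \<le> ennreal (w n \<omega>) + ennreal (\<beta> * \<gamma> n)"
          using elim \<beta> by (intro add_left_mono ennreal_leI mult_left_mono) auto
        finally show ?case by (simp split: split_indicator)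
      qed
    qed
    also have "\<dots> = a n + ennreal (\<beta> * \<gamma> n)"
      by (simp add: a_def nn_integral_add emeasure_space_1)
    finally show ?thesis .
  qed
  have tele: "ennreal (\<theta> (n\<^sub>0 + N)) * a (n\<^sub>0 + N) + ennreal \<alpha> * (\<Sum>n<N. ennreal (\<theta> (n\<^sub>0 + n)) * d (n\<^sub>0 + n))
      \<le> ennreal (\<theta> n\<^sub>0) * a n\<^sub>0 + ennreal (\<Sum>n<N. \<beta> * (\<theta> (n\<^sub>0 + n) * \<gamma> (n\<^sub>0 + n)))" for N
  proof (induction N)
    case (Suc N)
    let ?n = "n\<^sub>0 + N"
    let ?R = "\<lambda>N. \<Sum>n<N. \<beta> * (\<theta> (n\<^sub>0 + n) * \<gamma> (n\<^sub>0 + n))"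
    let ?S = "\<lambda>N. ennreal \<alpha> * (\<Sum>n<N. ennreal (\<theta> (n\<^sub>0 + n)) * d (n\<^sub>0 + n))"
    have R0: "?R N \<ge> 0" using \<beta> \<theta>(2) \<gamma>0 by (intro sum_nonneg) auto
    \<comment> \<open>Monotonicity of the weights enters here: both terms of the one-step bound must
      carry the same weight \<open>\<theta> ?n\<close>.\<close>
    have "ennreal (\<theta> (Suc ?n)) * a (Suc ?n) + ?S (Suc N)
        \<le> ennreal (\<theta> ?n) * a (Suc ?n) + (?S N + ennreal \<alpha> * (ennreal (\<theta> ?n) * d ?n))"
      using decseqD[OF \<theta>(1), of ?n "Suc ?n"]
      by (intro add_mono mult_right_mono ennreal_leI) (auto simp: distrib_left)
    also have "\<dots> = ennreal (\<theta> ?n) * (a (Suc ?n) + ennreal \<alpha> * d ?n) + ?S N"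
      by (simp add: distrib_left add_ac mult_ac)
    also have "\<dots> \<le> ennreal (\<theta> ?n) * (a ?n + ennreal (\<beta> * \<gamma> ?n)) + ?S N"
      by (intro add_right_mono mult_left_mono step) auto
    also have "\<dots> = (ennreal (\<theta> ?n) * a ?n + ?S N) + ennreal (\<beta> * (\<theta> ?n * \<gamma> ?n))"
      using \<beta> \<theta>(2) \<gamma>0 by (simp add: distrib_left add_ac mult_ac flip: ennreal_mult)
    also have "\<dots> \<le> (ennreal (\<theta> n\<^sub>0) * a n\<^sub>0 + ennreal (?R N)) + ennreal (\<beta> * (\<theta> ?n * \<gamma> ?n))"
      by (intro add_right_mono Suc.IH)
    also have "\<dots> = ennreal (\<theta> n\<^sub>0) * a n\<^sub>0 + ennreal (?R (Suc N))"
      using R0 \<beta> \<theta>(2) \<gamma>0 by (simp add: add.assoc flip: ennreal_plus)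
    finally show ?case by simp
  qed simp
  define C where "C = ennreal (\<theta> n\<^sub>0) * ennreal \<bar>c\<bar> + ennreal (\<beta> * (\<Sum>n. \<theta> (n + n\<^sub>0) * \<gamma> (n + n\<^sub>0)))"
  have a0: "a n\<^sub>0 \<le> ennreal \<bar>c\<bar>"
  proof -
    have "a n\<^sub>0 \<le> (\<integral>\<^sup>+ \<omega>. ennreal \<bar>c\<bar> \<partial>M)"
      unfolding a_def using order_trans[OF A(2) abs_ge_self]
      by (intro nn_integral_mono) (auto split: split_indicator intro!: ennreal_leI)
    then show ?thesis by (simp add: emeasure_space_1)
  qed
  have bound: "(\<Sum>n<N. ennreal (\<theta> (n\<^sub>0 + n)) * d (n\<^sub>0 + n)) \<le> C / ennreal \<alpha>" for N
  proof -
    have "(\<Sum>n<N. \<theta> (n\<^sub>0 + n) * \<gamma> (n\<^sub>0 + n)) \<le> (\<Sum>n. \<theta> (n + n\<^sub>0) * \<gamma> (n + n\<^sub>0))"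
      unfolding add.commute[of n\<^sub>0] using summable_ignore_initial_segment[OF \<theta>_sum, of n\<^sub>0] \<theta>(2) \<gamma>0
      by (intro sum_le_suminf) auto
    then have "(\<Sum>n<N. \<beta> * (\<theta> (n\<^sub>0 + n) * \<gamma> (n\<^sub>0 + n))) \<le> \<beta> * (\<Sum>n. \<theta> (n + n\<^sub>0) * \<gamma> (n + n\<^sub>0))"
      unfolding sum_distrib_left[symmetric] using \<beta> by (intro mult_left_mono) auto
    then have "ennreal (\<theta> n\<^sub>0) * a n\<^sub>0 + ennreal (\<Sum>n<N. \<beta> * (\<theta> (n\<^sub>0 + n) * \<gamma> (n\<^sub>0 + n))) \<le> C"
      unfolding C_def by (intro add_mono mult_left_mono a0 ennreal_leI) auto
    moreover have "ennreal \<alpha> * (\<Sum>n<N. ennreal (\<theta> (n\<^sub>0 + n)) * d (n\<^sub>0 + n)) \<le>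
        ennreal (\<theta> n\<^sub>0) * a n\<^sub>0 + ennreal (\<Sum>n<N. \<beta> * (\<theta> (n\<^sub>0 + n) * \<gamma> (n\<^sub>0 + n)))"
      by (rule order_trans[OF _ tele[of N]]) simp
    ultimately have "ennreal \<alpha> * (\<Sum>n<N. ennreal (\<theta> (n\<^sub>0 + n)) * d (n\<^sub>0 + n)) \<le> C" by (rule order_trans[rotated])
    from divide_right_mono_ennreal[OF this, of "ennreal \<alpha>"] show ?thesis
      using \<alpha> by (simp add: mult_divide_eq_ennreal mult.commute[of "ennreal \<alpha>"])
  qed
  have eq: "(\<integral>\<^sup>+ \<omega>. indicator A \<omega> * ennreal (\<theta> n * g n \<omega> * w n \<omega>) \<partial>M) = ennreal (\<theta> n) * d n" for n
    unfolding d_def using \<theta>(2)[of n]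
    by (subst nn_integral_cmult[symmetric]) (auto simp: ennreal_mult' mult_ac intro!: nn_integral_cong)
  have "(\<Sum>n. \<integral>\<^sup>+ \<omega>. indicator A \<omega> * ennreal (\<theta> (n\<^sub>0 + n) * g (n\<^sub>0 + n) \<omega> * w (n\<^sub>0 + n) \<omega>) \<partial>M)
      \<le> C / ennreal \<alpha>"
    unfolding eq suminf_eq_SUP by (intro SUP_least bound)
  also have "C / ennreal \<alpha> < \<infinity>"
  proof -
    have "C \<noteq> top" by (simp add: C_def ennreal_mult_eq_top_iff)
    then have "C / ennreal \<alpha> \<noteq> top" using \<alpha> by (simp add: ennreal_divide_eq_top_iff)
    then show ?thesis by (simp add: less_top)
  qed
  finally show ?thesis .
qed

subsection \<open>The Euler scheme\<close>

lemma continuous_on_matrix_vector_mult [continuous_intros]: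
  fixes A :: "'x::topological_space \<Rightarrow> real ^ 'n ^ 'm"
  assumes "continuous_on S A" "continuous_on S u"
  shows "continuous_on S (\<lambda>x. A x *v u x)"
  unfolding matrix_vector_mult_def by (intro continuous_intros assms)

definition euler_increment ::
  "(real ^ 'd \<Rightarrow> real ^ 'd) \<Rightarrow> (real ^ 'd \<Rightarrow> real ^ 'm ^ 'd) \<Rightarrow> real ^ 'd \<Rightarrow> real \<Rightarrow> real ^ 'm \<Rightarrow> real ^ 'd"
where
  "euler_increment b \<sigma> x g u = g *\<^sub>R b x + sqrt g *\<^sub>R (\<sigma> x *v u)"

lemma measurable_euler_increment:
  fixes b :: "real ^ 'd \<Rightarrow> real ^ 'd" and \<sigma> :: "real ^ 'd \<Rightarrow> real ^ 'm ^ 'd"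
  assumes b: "continuous_on UNIV b" and \<sigma>: "continuous_on UNIV \<sigma>"
    and [measurable]: "X \<in> borel_measurable N" "g \<in> borel_measurable N" "u \<in> borel_measurable N"
  shows "(\<lambda>\<omega>. euler_increment b \<sigma> (X \<omega>) (g \<omega>) (u \<omega>)) \<in> borel_measurable N"
proof -
  have "continuous_on UNIV (\<lambda>p :: (real ^ 'd) \<times> real \<times> (real ^ 'm). b (fst p))"
    by (rule continuous_on_compose2[OF b]) (auto intro!: continuous_intros)
  moreover have "continuous_on UNIV (\<lambda>p :: (real ^ 'd) \<times> real \<times> (real ^ 'm). \<sigma> (fst p))"
    by (rule continuous_on_compose2[OF \<sigma>]) (auto intro!: continuous_intros)
  ultimately have "continuous_on UNIV (\<lambda>p. euler_increment b \<sigma> (fst p) (fst (snd p)) (snd (snd p)))"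
    unfolding euler_increment_def by (intro continuous_intros)
  from borel_measurable_continuous_on[OF this, of "\<lambda>\<omega>. (X \<omega>, g \<omega>, u \<omega>)" N]
  show ?thesis by simp
qed

locale adaptive_euler = prob_space M for M :: "'a measure" +
  fixes b :: "real ^ 'd \<Rightarrow> real ^ 'd" and \<sigma> :: "real ^ 'd \<Rightarrow> real ^ 'm ^ 'd"
    and U :: "nat \<Rightarrow> 'a \<Rightarrow> real ^ 'm" and \<gamma> :: "nat \<Rightarrow> real" and cap :: "nat \<Rightarrow> 'a \<Rightarrow> real"
    and x\<^sub>0 :: "real ^ 'd"
  assumes drift_continuous: "continuous_on UNIV b"
    and diffusion_continuous: "continuous_on UNIV \<sigma>"
    and noise: "subgaussian_noise M U"
    and step_pos: "\<And>n. \<gamma> n > 0"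
    and cap_measurable: "\<And>n. cap n \<in> borel_measurable (noise_filtration M U n)"
begin

abbreviation F :: "nat \<Rightarrow> 'a measure" where
  "F \<equiv> noise_filtration M U"

abbreviation step :: "nat \<Rightarrow> 'a \<Rightarrow> real" where
  "step \<equiv> capped_step \<gamma> cap"

definition law :: "(real ^ 'm) measure" where
  "law = distr M borel (U 1)"

sublocale law: normalized_noise law
  unfolding law_def by (rule subgaussian_noise_normalized[OF prob_space_axioms noise])

lemma subalgebra_F: "subalgebra M (F n)"
  by (rule noise_subalgebra[OF prob_space_axioms noise])

lemma U_measurable [measurable]: "U (Suc n) \<in> borel_measurable M"
  by (rule noise_measurable[OF prob_space_axioms noise]) simp

lemma F_mono: "m \<le> n \<Longrightarrow> f \<in> measurable (F m) N \<Longrightarrow> f \<in> measurable (F n) N"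
  using noise_filtration_mono[of m n M U] unfolding measurable_def by auto

lemma F_M: "f \<in> measurable (F n) N \<Longrightarrow> f \<in> measurable M N"
  by (rule measurable_from_subalg[OF subalgebra_F])

lemma step_measurable: "step (Suc n) \<in> borel_measurable (F n)"
proof -
  have [measurable]: "cap n \<in> borel_measurable (F n)" by (rule cap_measurable)
  have "step (Suc n) = (\<lambda>\<omega>. min (\<gamma> (Suc n)) (cap n \<omega>))" by (rule ext) simp
  then show ?thesis by simp
qed

declare capped_step.simps [simp del]

text \<open>An exactly recursive, hence adapted, version of the scheme, which the hypotheses determine only
  almost surely.\<close>

primrec Y :: "nat \<Rightarrow> 'a \<Rightarrow> real ^ 'd" where
  "Y 0 \<omega> = x\<^sub>0"
| "Y (Suc n) \<omega> = Y n \<omega> + euler_increment b \<sigma> (Y n \<omega>) (step (Suc n) \<omega>) (U (Suc n) \<omega>)"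

lemma Y_measurable: "Y n \<in> borel_measurable (F n)"
proof (induction n)
  case (Suc n)
  have 1: "Y n \<in> borel_measurable (F (Suc n))" by (rule F_mono[OF _ Suc.IH]) simp
  have 2: "step (Suc n) \<in> borel_measurable (F (Suc n))" by (rule F_mono[OF _ step_measurable]) simp
  have 3: "U (Suc n) \<in> borel_measurable (F (Suc n))" by (rule noise_filtration_measurable) auto
  have "(\<lambda>\<omega>. Y n \<omega> + euler_increment b \<sigma> (Y n \<omega>) (step (Suc n) \<omega>) (U (Suc n) \<omega>)) \<in> borel_measurable (F (Suc n))"
    by (intro borel_measurable_add measurable_euler_increment[OF drift_continuous diffusion_continuous 1 2 3] 1)
  then show ?case by simp
qed simp

lemma Y_measurable_M [measurable]: "Y n \<in> borel_measurable M"
  by (rule F_M[OF Y_measurable])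

definition transition :: "(real ^ 'd \<Rightarrow> real) \<Rightarrow> real \<Rightarrow> real ^ 'd \<Rightarrow> real" where
  "transition f g x = law.one_step f x (b x) (\<sigma> x) g"

lemma transition_eq: "transition f g x = (LINT u|law. f (x + euler_increment b \<sigma> x g u))"
  by (simp add: transition_def law.one_step_def euler_increment_def add.assoc)

lemma frozen_measurable:
  assumes f: "continuous_on UNIV f" and X: "X \<in> borel_measurable N"
  shows "(\<lambda>(\<omega>, u). f (X \<omega> + euler_increment b \<sigma> (X \<omega>) g u)) \<in> borel_measurable (N \<Otimes>\<^sub>M borel)"
proof -
  have X' [measurable]: "(\<lambda>p. X (fst p)) \<in> borel_measurable (N \<Otimes>\<^sub>M (borel :: (real ^ 'm) measure))"
    using X by measurable
  have [measurable]: "(\<lambda>p. euler_increment b \<sigma> (X (fst p)) g (snd p))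
      \<in> borel_measurable (N \<Otimes>\<^sub>M (borel :: (real ^ 'm) measure))"
    by (intro measurable_euler_increment[OF drift_continuous diffusion_continuous X']) auto
  show ?thesis
    unfolding case_prod_beta by (intro borel_measurable_continuous_on[OF f] borel_measurable_add X') measurable
qed

lemma transition_measurable:
  assumes f: "continuous_on UNIV f" and X: "X \<in> borel_measurable N"
  shows "(\<lambda>\<omega>. transition f g (X \<omega>)) \<in> borel_measurable N"
proof -
  have "(\<lambda>(\<omega>, u). f (X \<omega> + euler_increment b \<sigma> (X \<omega>) g u)) \<in> borel_measurable (N \<Otimes>\<^sub>M law)"
    using frozen_measurable[OF f X] unfolding measurable_cong_sets[OF sets_pair_measure_cong[OF refl law.sets_law] refl] .
  then show ?thesis
    unfolding transition_eq by (rule law.borel_measurable_lebesgue_integral)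
qed

lemma transition_bounded:
  assumes f: "continuous_on UNIV f" and B: "\<And>x. \<bar>f x\<bar> \<le> B"
  shows "\<bar>transition f g x\<bar> \<le> B" "integrable law (\<lambda>u. f (x + euler_increment b \<sigma> x g u))"
proof -
  have "(\<lambda>u. f (x + euler_increment b \<sigma> x g u)) \<in> borel_measurable borel"
    by (intro borel_measurable_continuous_on[OF f] borel_measurable_add
        measurable_euler_increment[OF drift_continuous diffusion_continuous]) auto
  then show int: "integrable law (\<lambda>u. f (x + euler_increment b \<sigma> x g u))"
    using B by (intro law.integrable_const_bound[where B=B]) (auto simp: measurable_cong_sets[OF law.sets_law refl])
  have "\<bar>transition f g x\<bar> \<le> (LINT u|law. \<bar>f (x + euler_increment b \<sigma> x g u)\<bar>)"
    unfolding transition_eq by (rule integral_abs_bound)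
  also have "\<dots> \<le> (LINT u|law. B)"
    using int B by (intro integral_mono) auto
  finally show "\<bar>transition f g x\<bar> \<le> B" by simp
qed

definition jump_bound :: "(real ^ 'd \<Rightarrow> real) \<Rightarrow> real \<Rightarrow> bool" where
  "jump_bound V K \<longleftrightarrow> (\<forall>n. AE \<omega> in M. norm (Y (Suc n) \<omega> - Y n \<omega>) \<le>
     K * sqrt (\<gamma> (Suc n)) * sqrt (V (Y n \<omega>)) * (1 + norm (U (Suc n) \<omega>)))"

text \<open>The restriction to an uncapped step is essential to the transfer: only then is the
  actual increment the one of length \<open>\<gamma> (Suc n)\<close> that the kernel
  averages.\<close>

lemma jump_frozen:
  assumes V: "continuous_on UNIV V" and jump: "jump_bound V K"
  shows "AE \<omega> in M. step (Suc n) \<omega> = \<gamma> (Suc n) \<longrightarrow> (AE u in law.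
    norm (euler_increment b \<sigma> (Y n \<omega>) (\<gamma> (Suc n)) u) \<le>
      K * sqrt (\<gamma> (Suc n)) * sqrt (V (Y n \<omega>)) * (1 + norm u))"
proof -
  let ?N = "F n \<Otimes>\<^sub>M (borel :: (real ^ 'm) measure)"
  \<comment> \<open>The condition on the step is kept inside the predicate; it depends on
    \<open>cap n\<close> only, hence on the past, and \<open>P\<close> is jointly
    measurable.\<close>
  define P where "P p \<longleftrightarrow> (step (Suc n) (fst p) = \<gamma> (Suc n) \<longrightarrow>
      norm (euler_increment b \<sigma> (Y n (fst p)) (\<gamma> (Suc n)) (snd p)) \<le>
      K * sqrt (\<gamma> (Suc n)) * sqrt (V (Y n (fst p))) * (1 + norm (snd p)))" for p :: "'a \<times> (real ^ 'm)"
  have Y1 [measurable]: "(\<lambda>p. Y n (fst p)) \<in> borel_measurable ?N"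
    by (rule measurable_compose[OF measurable_fst Y_measurable])
  have [measurable]: "(\<lambda>p. step (Suc n) (fst p)) \<in> borel_measurable ?N"
    by (rule measurable_compose[OF measurable_fst step_measurable])
  have [measurable]: "(\<lambda>p. euler_increment b \<sigma> (Y n (fst p)) (\<gamma> (Suc n)) (snd p)) \<in> borel_measurable ?N"
    by (intro measurable_euler_increment[OF drift_continuous diffusion_continuous Y1]) auto
  have [measurable]: "(\<lambda>p. V (Y n (fst p))) \<in> borel_measurable ?N"
    by (rule borel_measurable_continuous_on[OF V Y1])
  have "Measurable.pred ?N P" unfolding P_def[abs_def] by measurable
  moreover have "AE \<omega> in M. P (\<omega>, U (Suc n) \<omega>)"
    using jump[unfolded jump_bound_def, rule_format, of n]
    by eventually_elim (auto simp: P_def)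
  ultimately have "AE \<omega> in M. AE u in law. P (\<omega>, u)"
    unfolding law_def by (rule AE_freeze[OF prob_space_axioms noise])
  then show ?thesis by eventually_elim (auto simp: P_def)
qed

text \<open>On the event \<open>A\<close> (below: \<open>W (Y n\<^sub>0) \<le> i\<close>) and for uncapped steps, the variances are summable in
  expectation, so no stopping time is needed; both restrictions are harmless, since \<open>i\<close> is arbitrary
  and almost surely only finitely many steps are capped.\<close>

definition compensated ::
  "(real ^ 'd \<Rightarrow> real) \<Rightarrow> (nat \<Rightarrow> real) \<Rightarrow> nat \<Rightarrow> 'a set \<Rightarrow> nat \<Rightarrow> 'a \<Rightarrow> real"
where
  "compensated f c n\<^sub>0 A k \<omega> =
     (case k of 0 \<Rightarrow> 0 | Suc n \<Rightarrow>
        if n\<^sub>0 \<le> n \<and> \<omega> \<in> A \<and> step (Suc n) \<omega> = \<gamma> (Suc n)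
        then c (Suc n) * (f (Y (Suc n) \<omega>) - transition f (\<gamma> (Suc n)) (Y n \<omega>)) else 0)"

text \<open>Each difference is a function \<open>h n\<close> of the past and the next noise.
  Freezing the past, its mean is 0 by the definition of \<open>transition\<close>, and the Lipschitz
  property of \<open>f\<close> with the jump bound makes its second moment a constant times
  \<open>c\<^sup>2 * \<gamma> * V\<close>.\<close>

lemma compensated_convergent:
  assumes f: "C2 f" "compact (closure {x. f x \<noteq> 0})"
    and V: "continuous_on UNIV V" "\<And>x. V x \<ge> 0" and jump: "jump_bound V K" and K: "K \<ge> 0"
    and A: "A \<in> sets (F n\<^sub>0)"
    and fin: "(\<Sum>n. \<integral>\<^sup>+ \<omega>. indicator (A \<inter> {\<omega>. step (Suc (n\<^sub>0 + n)) \<omega> = \<gamma> (Suc (n\<^sub>0 + n))}) \<omega> *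
        ennreal ((c (Suc (n\<^sub>0 + n)))\<^sup>2 * \<gamma> (Suc (n\<^sub>0 + n)) * V (Y (n\<^sub>0 + n) \<omega>)) \<partial>M) < \<infinity>"
  shows "AE \<omega> in M. convergent (\<lambda>N. \<Sum>k=1..N. compensated f c n\<^sub>0 A k \<omega>)"
proof -
  note fc = C2_continuous[OF f(1)]
  obtain B where B: "B \<ge> 0" "\<And>x. \<bar>f x\<bar> \<le> B"
    using C2_compact_support_bounded_lipschitz(1)[OF f] by blast
  obtain L where L: "L \<ge> 0" "\<And>x h. \<bar>f (x + h) - f x\<bar> \<le> L * norm h"
    using C2_compact_support_bounded_lipschitz(2)[OF f] by blast
  let ?D = "compensated f c n\<^sub>0 A"
  \<comment> \<open>The event is known at time \<open>n\<close>: the length of step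
    \<open>Suc n\<close> is fixed by \<open>cap n\<close> before the noise \<open>U (Suc n)\<close>
    is drawn.\<close>
  define G where "G n = A \<inter> {\<omega> \<in> space M. step (Suc n) \<omega> = \<gamma> (Suc n)}" for n
  have AM: "A \<subseteq> space M" using sets.sets_into_space[OF A] by simp
  have GF: "G n \<in> sets (F n)" if "n\<^sub>0 \<le> n" for n
  proof -
    have [measurable]: "step (Suc n) \<in> borel_measurable (F n)" by (rule step_measurable)
    have "{\<omega> \<in> space (F n). step (Suc n) \<omega> = \<gamma> (Suc n)} \<in> sets (F n)" by measurable
    moreover have "A \<in> sets (F n)" using A noise_filtration_mono[OF that] by blast
    ultimately show ?thesis by (auto simp: G_def)
  qed
  \<comment> \<open>The increment is written with \<open>\<gamma> (Suc n)\<close> in place of the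
    random step; on \<open>G n\<close> the two agree, and elsewhere the indicator makes
    \<open>h n\<close> zero.\<close>
  define h where "h n p = (indicator (G n) (fst p) * c (Suc n)) *
      (f (Y n (fst p) + euler_increment b \<sigma> (Y n (fst p)) (\<gamma> (Suc n)) (snd p))
        - transition f (\<gamma> (Suc n)) (Y n (fst p)))" for n and p :: "'a \<times> (real ^ 'm)"
  have D_h: "?D (Suc n) \<omega> = h n (\<omega>, U (Suc n) \<omega>)" if "n\<^sub>0 \<le> n" for n \<omega>
    using that AM by (auto simp: compensated_def h_def G_def split: split_indicator)
  have D_0: "?D (Suc n) \<omega> = 0" if "\<not> n\<^sub>0 \<le> n" for n \<omega>
    using that by (simp add: compensated_def)
  have h_meas: "h n \<in> borel_measurable (F n \<Otimes>\<^sub>M borel)" if "n\<^sub>0 \<le> n" for n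
  proof -
    have [measurable]: "G n \<in> sets (F n)" by (rule GF[OF that])
    have [measurable]: "(\<lambda>\<omega>. transition f (\<gamma> (Suc n)) (Y n \<omega>)) \<in> borel_measurable (F n)"
      by (rule transition_measurable[OF fc Y_measurable])
    have [measurable]: "(\<lambda>p. f (Y n (fst p) + euler_increment b \<sigma> (Y n (fst p)) (\<gamma> (Suc n)) (snd p)))
        \<in> borel_measurable (F n \<Otimes>\<^sub>M borel)"
      using frozen_measurable[OF fc Y_measurable] unfolding case_prod_beta .
    show ?thesis unfolding h_def[abs_def] by measurable
  qed
  have tB: "\<bar>transition f g x\<bar> \<le> B" for g x by (rule transition_bounded(1)[OF fc B(2)])
  have h_bound: "\<bar>h n p\<bar> \<le> \<bar>c (Suc n)\<bar> * (2 * B)" for n p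
  proof -
    have "\<bar>h n p\<bar> \<le> (1 * \<bar>c (Suc n)\<bar>) * (2 * B)"
      unfolding h_def abs_mult
    proof (intro mult_mono)
      show "\<bar>f (Y n (fst p) + euler_increment b \<sigma> (Y n (fst p)) (\<gamma> (Suc n)) (snd p))
        - transition f (\<gamma> (Suc n)) (Y n (fst p))\<bar> \<le> 2 * B"
        using B(2)[of "Y n (fst p) + euler_increment b \<sigma> (Y n (fst p)) (\<gamma> (Suc n)) (snd p)"]
          tB[of "\<gamma> (Suc n)" "Y n (fst p)"] by linarith
    qed (use B in \<open>auto split: split_indicator\<close>)
    then show ?thesis by simp
  qed
  define C where "C k = (case k of 0 \<Rightarrow> 0 | Suc n \<Rightarrow> \<bar>c (Suc n)\<bar> * (2 * B))" for k
  have D_bound: "\<bar>?D k \<omega>\<bar> \<le> C k" for k \<omega>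
  proof (cases k)
    case (Suc n)
    then show ?thesis
      using D_h[of n \<omega>] D_0[of n \<omega>] h_bound[of n "(\<omega>, U (Suc n) \<omega>)"] B(1)
      by (cases "n\<^sub>0 \<le> n") (auto simp: C_def)
  qed (simp add: C_def compensated_def)
  have D_adapted: "?D k \<in> borel_measurable (F k)" for k
  proof (cases k)
    case 0
    then show ?thesis by (simp add: compensated_def[abs_def])
  next
    case (Suc n)
    show ?thesis
    proof (cases "n\<^sub>0 \<le> n")
      case True
      have "(\<lambda>\<omega>. \<omega>) \<in> measurable (F (Suc n)) (F n)"
        using noise_filtration_mono[of n "Suc n" M U] by (auto simp: measurable_def)
      then have "(\<lambda>\<omega>. (\<omega>, U (Suc n) \<omega>)) \<in> measurable (F (Suc n)) (F n \<Otimes>\<^sub>M borel)"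
        using noise_filtration_measurable[of "Suc n" "Suc n" U M] by simp
      moreover have "?D (Suc n) = (\<lambda>\<omega>. h n (\<omega>, U (Suc n) \<omega>))"
        by (rule ext) (rule D_h[OF True])
      ultimately show ?thesis
        unfolding Suc by (simp only: measurable_compose[OF _ h_meas[OF True]])
    next
      case False
      then have "?D (Suc n) = (\<lambda>\<omega>. 0)" by (intro ext D_0)
      then show ?thesis unfolding Suc by simp
    qed
  qed
  define m where "m = law.absolute_moment 1"
  have m0: "m \<ge> 0" unfolding m_def by (rule law.absolute_moment_nonneg)
  \<comment> \<open>\<open>1 + norm u\<close> bounds the deviation of the new value of
    \<open>f\<close> from the old one, and \<open>m\<close> that of the kernel average, both in
    units of \<open>L * ?J\<close>.\<close>
  define q where "q = (LINT u|law. ((1 + norm u) + m)\<^sup>2)"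
  have q_int: "integrable law (\<lambda>u. ((1 + norm u) + m)\<^sup>2)"
  proof -
    have "(\<lambda>u :: real ^ 'm. ((1 + norm u) + m)\<^sup>2) = (\<lambda>u. (1 + norm u) ^ 2 + (2 * m) * (1 + norm u) ^ 1 + m\<^sup>2)"
      by (simp add: fun_eq_iff power2_eq_square algebra_simps)
    moreover have "integrable law (\<lambda>u. (1 + norm u) ^ 2 + (2 * m) * (1 + norm u) ^ 1 + m\<^sup>2)"
      by (intro Bochner_Integration.integrable_add Bochner_Integration.integrable_mult_right
          law.integrable_absolute_moment) auto
    ultimately show ?thesis by (simp only:)
  qed
  have q0: "q \<ge> 0" unfolding q_def by (intro integral_nonneg_AE) auto
  have q_nn: "(\<integral>\<^sup>+ u. ennreal (((1 + norm u) + m)\<^sup>2) \<partial>law) = ennreal q"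
    unfolding q_def by (rule nn_integral_eq_integral[OF q_int]) auto
  define v where "v n = (\<integral>\<^sup>+ \<omega>. indicator (A \<inter> {\<omega>. step (Suc n) \<omega> = \<gamma> (Suc n)}) \<omega> *
        ennreal ((c (Suc n))\<^sup>2 * \<gamma> (Suc n) * V (Y n \<omega>)) \<partial>M)" for n
  have var: "(\<integral>\<^sup>+ \<omega>. ennreal ((?D (Suc n) \<omega>)\<^sup>2) \<partial>M) \<le> ennreal ((L * K)\<^sup>2 * q) * v n" if n: "n\<^sub>0 \<le> n" for n
  proof -
    have [measurable]: "h n \<in> borel_measurable (F n \<Otimes>\<^sub>M borel)" by (rule h_meas[OF n])
    have "(\<integral>\<^sup>+ \<omega>. ennreal ((?D (Suc n) \<omega>)\<^sup>2) \<partial>M) = (\<integral>\<^sup>+ \<omega>. \<integral>\<^sup>+ u. ennreal ((h n (\<omega>, u))\<^sup>2) \<partial>law \<partial>M)"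
      unfolding D_h[OF n] law_def
      by (rule nn_integral_freeze[OF prob_space_axioms noise, of "\<lambda>p. ennreal ((h n p)\<^sup>2)"]) simp
    also have "\<dots> \<le> (\<integral>\<^sup>+ \<omega>. ennreal ((L * K)\<^sup>2 * q) *
        (indicator (A \<inter> {\<omega>. step (Suc n) \<omega> = \<gamma> (Suc n)}) \<omega> *
          ennreal ((c (Suc n))\<^sup>2 * \<gamma> (Suc n) * V (Y n \<omega>))) \<partial>M)"
    proof (rule nn_integral_mono_AE)
      show "AE \<omega> in M. (\<integral>\<^sup>+ u. ennreal ((h n (\<omega>, u))\<^sup>2) \<partial>law) \<le> ennreal ((L * K)\<^sup>2 * q) *
        (indicator (A \<inter> {\<omega>. step (Suc n) \<omega> = \<gamma> (Suc n)}) \<omega> *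
          ennreal ((c (Suc n))\<^sup>2 * \<gamma> (Suc n) * V (Y n \<omega>)))"
        using jump_frozen[OF V(1) jump, of n]
      proof eventually_elim
        case (elim \<omega>)
        show ?case
        proof (cases "\<omega> \<in> G n")
          case False
          then show ?thesis by (simp add: h_def)
        next
          case True
          let ?J = "K * sqrt (\<gamma> (Suc n)) * sqrt (V (Y n \<omega>))"
          let ?I = "\<lambda>u. euler_increment b \<sigma> (Y n \<omega>) (\<gamma> (Suc n)) u"
          have J0: "?J \<ge> 0" using K V(2) step_pos[of "Suc n"] by simp
          have J2: "?J\<^sup>2 = K\<^sup>2 * (\<gamma> (Suc n) * V (Y n \<omega>))"
            using V(2) step_pos[of "Suc n"] by (simp add: power_mult_distrib less_imp_le)
          have *: "AE u in law. norm (?I u) \<le> ?J * (1 + norm u)"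
            using elim True by (simp add: G_def)
          have t: "\<bar>transition f (\<gamma> (Suc n)) (Y n \<omega>) - f (Y n \<omega>)\<bar> \<le> L * ?J * m"
            unfolding transition_def m_def
            by (rule law.one_step_lipschitz[OF fc B(2) L(2) L(1)])
               (use * in \<open>simp add: euler_increment_def\<close>)
          have "AE u in law. ennreal ((h n (\<omega>, u))\<^sup>2) \<le>
              ennreal ((c (Suc n))\<^sup>2 * (L * ?J)\<^sup>2) * ennreal (((1 + norm u) + m)\<^sup>2)"
            using *
          proof eventually_elim
            case (elim u)
            have "\<bar>f (Y n \<omega> + ?I u) - f (Y n \<omega>)\<bar> \<le> L * (?J * (1 + norm u))"
              by (rule order_trans[OF L(2)]) (intro mult_left_mono elim L(1))
            with t have "\<bar>f (Y n \<omega> + ?I u) - transition f (\<gamma> (Suc n)) (Y n \<omega>)\<bar> \<le> (L * ?J) * ((1 + norm u) + m)"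
              by (simp add: algebra_simps)
            then have "\<bar>h n (\<omega>, u)\<bar> \<le> \<bar>c (Suc n)\<bar> * ((L * ?J) * ((1 + norm u) + m))"
              using True by (simp add: h_def abs_mult mult_left_mono)
            then have "\<bar>h n (\<omega>, u)\<bar>\<^sup>2 \<le> (\<bar>c (Suc n)\<bar> * ((L * ?J) * ((1 + norm u) + m)))\<^sup>2"
              by (intro power_mono) auto
            also have "\<dots> = ((c (Suc n))\<^sup>2 * (L * ?J)\<^sup>2) * ((1 + norm u) + m)\<^sup>2"
              by (simp only: power_mult_distrib power2_abs mult.assoc)
            finally show ?case by (simp only: power2_abs) (simp flip: ennreal_mult)
          qed
          then have "(\<integral>\<^sup>+ u. ennreal ((h n (\<omega>, u))\<^sup>2) \<partial>law) \<le>
              (\<integral>\<^sup>+ u. ennreal ((c (Suc n))\<^sup>2 * (L * ?J)\<^sup>2) * ennreal (((1 + norm u) + m)\<^sup>2) \<partial>law)"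
            by (rule nn_integral_mono_AE)
          also have "\<dots> = ennreal ((c (Suc n))\<^sup>2 * (L * ?J)\<^sup>2) * ennreal q"
            by (subst nn_integral_cmult) (simp_all add: q_nn)
          also have "\<dots> = ennreal ((L * K)\<^sup>2 * q * ((c (Suc n))\<^sup>2 * \<gamma> (Suc n) * V (Y n \<omega>)))"
          proof -
            have LJ: "(L * ?J)\<^sup>2 = L\<^sup>2 * (K\<^sup>2 * (\<gamma> (Suc n) * V (Y n \<omega>)))"
              unfolding J2[symmetric] by (rule power_mult_distrib)
            have "(c (Suc n))\<^sup>2 * (L * ?J)\<^sup>2 * q =
                (L * K)\<^sup>2 * q * ((c (Suc n))\<^sup>2 * \<gamma> (Suc n) * V (Y n \<omega>))"
              unfolding LJ by (simp add: power_mult_distrib)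
            moreover have "ennreal ((c (Suc n))\<^sup>2 * (L * ?J)\<^sup>2) * ennreal q = ennreal ((c (Suc n))\<^sup>2 * (L * ?J)\<^sup>2 * q)"
              using q0 by (intro ennreal_mult[symmetric]) auto
            ultimately show ?thesis by (simp only:)
          qed
          also have "\<dots> = ennreal ((L * K)\<^sup>2 * q) * ennreal ((c (Suc n))\<^sup>2 * \<gamma> (Suc n) * V (Y n \<omega>))"
            using q0 V(2)[of "Y n \<omega>"] step_pos[of "Suc n"] by (intro ennreal_mult) auto
          finally show ?thesis using True by (simp add: G_def)
        qed
      qed
    qed
    also have "\<dots> = ennreal ((L * K)\<^sup>2 * q) * v n"
    proof -
      have [measurable]: "G n \<in> sets M" using GF[OF n] subalgebra_F[of n] by (auto simp: subalgebra_def)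
      have "indicator (A \<inter> {\<omega>. step (Suc n) \<omega> = \<gamma> (Suc n)}) \<omega> = (indicator (G n) \<omega> :: ennreal)" for \<omega>
        using AM by (auto simp: G_def split: split_indicator)
      moreover have [measurable]: "(\<lambda>\<omega>. V (Y n \<omega>)) \<in> borel_measurable M"
        by (rule borel_measurable_continuous_on[OF V(1)]) simp
      ultimately show ?thesis unfolding v_def by (simp add: nn_integral_cmult)
    qed
    finally show ?thesis .
  qed
  interpret D: square_integrable_martingale_differences M F ?D C
  proof
    show "subalgebra M (F n)" for n by (rule subalgebra_F)
    show "sets (F n) \<subseteq> sets (F (Suc n))" for n by (rule noise_filtration_mono) simp
    show "?D n \<in> borel_measurable (F n)" for n by (rule D_adapted)
    show "\<bar>?D n \<omega>\<bar> \<le> C n" for n \<omega> by (rule D_bound)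
    show "(LINT \<omega>|M. Z \<omega> * ?D (Suc n) \<omega>) = 0"
      if Z: "Z \<in> borel_measurable (F n)" "\<And>\<omega>. \<bar>Z \<omega>\<bar> \<le> z" for n Z z
    proof (cases "n\<^sub>0 \<le> n")
      case True
      have [measurable]: "h n \<in> borel_measurable (F n \<Otimes>\<^sub>M borel)" by (rule h_meas[OF True])
      have [measurable]: "(\<lambda>p. Z (fst p)) \<in> borel_measurable (F n \<Otimes>\<^sub>M (borel :: (real ^ 'm) measure))"
        by (rule measurable_compose[OF measurable_fst Z(1)])
      \<comment> \<open>The kernel subtracts exactly the mean over \<open>u\<close>, while
        \<open>Z\<close>, the indicator and \<open>c\<close> are constants once the past is
        frozen.\<close>
      have zero: "(LINT u|law. Z \<omega> * h n (\<omega>, u)) = 0" for \<omega>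
        using transition_bounded(2)[OF fc B(2), of "Y n \<omega>" "\<gamma> (Suc n)"]
        by (simp add: h_def transition_eq)
      have "(LINT \<omega>|M. Z \<omega> * ?D (Suc n) \<omega>) = (LINT \<omega>|M. LINT u|law. Z \<omega> * h n (\<omega>, u))"
        unfolding D_h[OF True] law_def
      proof (rule integral_freeze[OF prob_space_axioms noise, of "\<lambda>p. Z (fst p) * h n p", unfolded fst_conv])
        show "(\<lambda>p. Z (fst p) * h n p) \<in> borel_measurable (F n \<Otimes>\<^sub>M borel)" by measurable
        show "\<bar>Z (fst p) * h n p\<bar> \<le> z * (\<bar>c (Suc n)\<bar> * (2 * B))" for p
          unfolding abs_mult by (intro mult_mono Z(2) h_bound) (use Z(2)[of "fst p"] in auto)
      qed
      then show ?thesis unfolding zero by simp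
    qed (simp add: D_0)
    show "summable (\<lambda>n. LINT \<omega>|M. (?D n \<omega>)\<^sup>2)"
    proof -
      have int: "integrable M (\<lambda>\<omega>. (?D n \<omega>)\<^sup>2)" for n
      proof (rule integrable_const_bound[where B="(C n)\<^sup>2"])
        have "\<bar>?D n \<omega>\<bar>\<^sup>2 \<le> (C n)\<^sup>2" for \<omega> by (intro power_mono D_bound) simp
        then show "AE \<omega> in M. norm ((?D n \<omega>)\<^sup>2) \<le> (C n)\<^sup>2" by simp
        have [measurable]: "?D n \<in> borel_measurable M" by (rule F_M[OF D_adapted])
        show "(\<lambda>\<omega>. (?D n \<omega>)\<^sup>2) \<in> borel_measurable M" by simp
      qed
      \<comment> \<open>The shift by \<open>Suc n\<^sub>0\<close> matches difference
        \<open>Suc (n\<^sub>0 + n)\<close> with \<open>v (n\<^sub>0 + n)\<close>; finitely many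
        initial terms do not affect summability.\<close>
      have "(\<Sum>n. ennreal (LINT \<omega>|M. (?D (n + Suc n\<^sub>0) \<omega>)\<^sup>2)) \<le> (\<Sum>n. ennreal ((L * K)\<^sup>2 * q) * v (n\<^sub>0 + n))"
      proof (rule suminf_le)
        show "ennreal (LINT \<omega>|M. (?D (n + Suc n\<^sub>0) \<omega>)\<^sup>2) \<le> ennreal ((L * K)\<^sup>2 * q) * v (n\<^sub>0 + n)" for n
          using var[of "n\<^sub>0 + n"] nn_integral_eq_integral[OF int[of "n + Suc n\<^sub>0"]] by (simp add: add.commute)
      qed auto
      also have "\<dots> < \<infinity>"
        using fin by (simp add: v_def ennreal_mult_less_top)
      finally have "summable (\<lambda>n. LINT \<omega>|M. (?D (n + Suc n\<^sub>0) \<omega>)\<^sup>2)"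
        by (intro summable_suminf_not_top) (auto simp: less_top)
      then show ?thesis by (rule summable_iff_shift[THEN iffD1])
    qed
  qed
  show ?thesis by (rule D.AE_convergent)
qed

end

subsection \<open>The generator along the scheme\<close>

text \<open>Inside a large ball \<open>V\<close> is bounded by compactness, and outside it the
  asymptotic comparison applies. The dichotomy by values of \<open>V\<close> later selects the
  Taylor bound.\<close>

lemma smallo_threshold:
  fixes V W :: "'x::{euclidean_space} \<Rightarrow> real"
  assumes V: "continuous_on UNIV V" and o: "V \<in> o[at_infinity](W)" and \<delta>: "\<delta> > 0"
    and W: "\<And>x. W x \<ge> 0"
  shows "\<exists>A\<ge>0. \<forall>x. V x \<le> A \<or> V x \<le> \<delta> * W x"
proof -
  from landau_o.smallD[OF o \<delta>] obtain R where R: "\<And>x. norm x \<ge> R \<Longrightarrow> norm (V x) \<le> \<delta> * norm (W x)"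
    by (auto simp: eventually_at_infinity)
  have "bounded (V ` cball 0 R)"
    by (intro compact_imp_bounded compact_continuous_image continuous_on_subset[OF V]) auto
  then obtain A where A: "\<And>x. norm x \<le> R \<Longrightarrow> norm (V x) \<le> A"
    unfolding bounded_iff by (auto simp: dist_norm) (metis mem_cball_0)
  have "V x \<le> \<bar>A\<bar> \<or> V x \<le> \<delta> * W x" for x
    using R[of x] A[of x] W[of x] by (cases "norm x \<le> R") auto
  then show ?thesis by (intro exI[of _ "\<bar>A\<bar>"]) auto
qed

lemma smallo_affine_bound:
  fixes V W :: "'x::{euclidean_space} \<Rightarrow> real"
  assumes "continuous_on UNIV V" and "V \<in> o[at_infinity](W)" and W: "\<And>x. W x \<ge> 0"
  shows "\<exists>C\<ge>0. \<forall>x. V x \<le> C * (1 + W x)"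
proof -
  obtain A where A: "A \<ge> 0" "\<And>x. V x \<le> A \<or> V x \<le> 1 * W x"
    using smallo_threshold[OF assms(1,2) zero_less_one W] by blast
  have "V x \<le> (A + 1) * (1 + W x)" for x
  proof -
    have "V x \<le> A + W x" using A(2)[of x] A(1) W[of x] by auto
    also have "\<dots> \<le> (A + 1) * (1 + W x)"
      using mult_nonneg_nonneg[OF A(1) W[of x]] by (simp add: algebra_simps)
    finally show ?thesis .
  qed
  then show ?thesis using A(1) by (intro exI[of _ "A + 1"]) auto
qed

lemma generator_continuous:
  assumes f: "C2 f" and b: "continuous_on UNIV b" and \<sigma>: "continuous_on UNIV \<sigma>"
  shows "continuous_on UNIV (generator b \<sigma> f)"
  unfolding generator_def trace_def matrix_matrix_mult_def transpose_def
  using C2_continuous_grad[OF f] C2_continuous_hessian[OF f] b \<sigma>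
  by (intro continuous_intros continuous_on_divide) auto

context adaptive_euler
begin

text \<open>After division by \<open>g\<close>, a squared jump contributes a multiple of
  \<open>v\<close>, whereas a cubed jump contributes \<open>sqrt g\<close> times
  \<open>v * sqrt v\<close>: smaller in the step but worse in the state.\<close>

lemma transition_expansion:
  assumes f: "C2 f" "\<And>x. \<bar>f x\<bar> \<le> B"
    and R: "\<And>h. \<bar>taylor_remainder f x h\<bar> \<le> a * (norm h)\<^sup>2 + c * norm h ^ 3" and ac: "a \<ge> 0" "c \<ge> 0"
    and g: "g > 0" and v: "v \<ge> 0" and K: "K \<ge> 0"
    and D: "\<bar>b x \<bullet> (hessian f x *v b x)\<bar> \<le> D"
    and jump: "AE u in law. norm (euler_increment b \<sigma> x g u) \<le> K * sqrt g * sqrt v * (1 + norm u)"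
  shows "\<bar>(transition f g x - f x) / g - generator b \<sigma> f x\<bar> \<le>
    g * D + a * K\<^sup>2 * law.absolute_moment 2 * v + c * K ^ 3 * law.absolute_moment 3 * (sqrt g * (v * sqrt v))"
proof -
  let ?J = "K * sqrt g * sqrt v"
  have J0: "?J \<ge> 0" using K g v by simp
  have "\<bar>transition f g x - f x - g * generator b \<sigma> f x\<bar> \<le>
      1 / 2 * g\<^sup>2 * \<bar>b x \<bullet> (hessian f x *v b x)\<bar> + a * ?J\<^sup>2 * law.absolute_moment 2 + c * ?J ^ 3 * law.absolute_moment 3"
    unfolding transition_def generator_def
    using jump by (intro law.one_step_error[OF f less_imp_le[OF g] J0 _ R ac]) (simp add: euler_increment_def)
  also have "1 / 2 * g\<^sup>2 * \<bar>b x \<bullet> (hessian f x *v b x)\<bar> \<le> g\<^sup>2 * D"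
    using mult_left_mono[OF D, of "g\<^sup>2"] D by (intro order_trans[OF _ mult_left_mono[OF D]]) auto
  also have "?J\<^sup>2 = g * (K\<^sup>2 * v)" using g v by (simp add: power_mult_distrib)
  also have "?J ^ 3 = g * (K ^ 3 * (sqrt g * (v * sqrt v)))"
  proof -
    have "sqrt g ^ 3 = g * sqrt g" "sqrt v ^ 3 = v * sqrt v" using g v by (simp_all add: power3_eq_cube)
    then show ?thesis by (simp add: power_mult_distrib)
  qed
  finally have *: "\<bar>transition f g x - f x - g * generator b \<sigma> f x\<bar> \<le>
    g * (g * D + a * K\<^sup>2 * law.absolute_moment 2 * v + c * K ^ 3 * law.absolute_moment 3 * (sqrt g * (v * sqrt v)))"
    by (simp add: algebra_simps power2_eq_square)
  have "\<bar>(transition f g x - f x) / g - generator b \<sigma> f x\<bar> = \<bar>transition f g x - f x - g * generator b \<sigma> f x\<bar> / g"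
  proof -
    have "(transition f g x - f x) / g - generator b \<sigma> f x = (transition f g x - f x - g * generator b \<sigma> f x) / g"
      using g by (simp add: diff_divide_distrib)
    then show ?thesis using g by (simp only: abs_divide abs_of_pos)
  qed
  also have "\<dots> \<le> (g * (g * D + a * K\<^sup>2 * law.absolute_moment 2 * v +
      c * K ^ 3 * law.absolute_moment 3 * (sqrt g * (v * sqrt v)))) / g"
    using g by (intro divide_right_mono *) auto
  finally show ?thesis using g by simp
qed

text \<open>Where \<open>V \<le> A\<close>, the cubic bound with small \<open>a\<close> is used and
  \<open>V * sqrt V\<close> stays below \<open>A * sqrt A\<close>. Elsewhere
  \<open>V \<le> \<delta> * W\<close>, and the quadratic bound with its fixed constant
  \<open>Q\<close> is enough. The drift term is uniformly of order
  \<open>\<gamma> k\<close>.\<close>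

lemma consistency_error_negligible:
  fixes y :: "nat \<Rightarrow> real ^ 'd"
  assumes f: "C2 f" "compact (closure {x. f x \<noteq> 0})"
    and V: "continuous_on UNIV V" "\<And>x. V x \<ge> 0" and W: "\<And>x. W x \<ge> 0" and o: "V \<in> o[at_infinity](W)"
    and \<gamma>: "\<gamma> \<longlonglongrightarrow> 0" and K: "K \<ge> 0"
    and jump: "eventually (\<lambda>k. AE u in law. norm (euler_increment b \<sigma> (y (k - 1)) (\<gamma> k) u) \<le>
      K * sqrt (\<gamma> k) * sqrt (V (y (k - 1))) * (1 + norm u)) sequentially"
    and \<epsilon>: "\<epsilon> > 0"
  shows "eventually (\<lambda>k. \<bar>(transition f (\<gamma> k) (y (k - 1)) - f (y (k - 1))) / \<gamma> k - generator b \<sigma> f (y (k - 1))\<bar>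
    \<le> \<epsilon> * (1 + W (y (k - 1)))) sequentially"
proof -
  obtain B where B: "\<And>x. \<bar>f x\<bar> \<le> B" using C2_compact_support_bounded_lipschitz(1)[OF f] by blast
  \<comment> \<open>The drift may be unbounded, but the Hessian vanishes outside the support of
    \<open>f\<close>, so this form is bounded.\<close>
  have "continuous_on UNIV (\<lambda>x. b x \<bullet> (hessian f x *v b x))"
    by (intro continuous_intros drift_continuous C2_continuous_hessian f)
  moreover have "b x \<bullet> (hessian f x *v b x) = 0" if "x \<notin> closure {x. f x \<noteq> 0}" for x
    using C2_compact_support_outside(3)[OF that] by simp
  ultimately obtain D where D: "\<And>x. \<bar>b x \<bullet> (hessian f x *v b x)\<bar> \<le> D"
    using bounded_of_compact_support[OF _ f(2), of "\<lambda>x. b x \<bullet> (hessian f x *v b x)"] by force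
  obtain Q where Q: "Q \<ge> 0" "\<And>x h. \<bar>taylor_remainder f x h\<bar> \<le> Q * (norm h)\<^sup>2"
    using taylor_remainder_quadratic[OF f] by blast
  obtain C\<^sub>V where C\<^sub>V: "C\<^sub>V \<ge> 0" "\<And>x. V x \<le> C\<^sub>V * (1 + W x)"
    using smallo_affine_bound[OF V(1) o W] by blast
  define m\<^sub>2 where "m\<^sub>2 = K\<^sup>2 * law.absolute_moment 2"
  define m\<^sub>3 where "m\<^sub>3 = K ^ 3 * law.absolute_moment 3"
  have m0: "m\<^sub>2 \<ge> 0" "m\<^sub>3 \<ge> 0" using K law.absolute_moment_nonneg by (auto simp: m\<^sub>2_def m\<^sub>3_def)
  \<comment> \<open>Dividing by \<open>p + 1\<close> gives a positive parameter even when the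
    constant \<open>p\<close> to be absorbed is 0.\<close>
  have scale: "0 < e / (p + 1)" "p * (e / (p + 1)) \<le> e" if "p \<ge> 0" "e > 0" for p e :: real
    using that by (auto simp: pos_divide_le_eq algebra_simps)
  \<comment> \<open>\<open>\<delta>\<close> depends on \<open>Q\<close> and the moments only, so it
    can be fixed before the threshold \<open>A\<close> that it determines.\<close>
  define \<delta> where "\<delta> = (\<epsilon> / 2) / (Q * m\<^sub>2 + 1)"
  have \<delta>: "\<delta> > 0" "Q * m\<^sub>2 * \<delta> \<le> \<epsilon> / 2"
    using scale[of "Q * m\<^sub>2" "\<epsilon> / 2"] \<epsilon> Q(1) m0 unfolding \<delta>_def by auto
  obtain A where A: "A \<ge> 0" "\<And>x. V x \<le> A \<or> V x \<le> \<delta> * W x"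
    using smallo_threshold[OF V(1) o \<delta>(1) W] by blast
  define a where "a = (\<epsilon> / 4) / (m\<^sub>2 * C\<^sub>V + 1)"
  have a: "a > 0" "a * m\<^sub>2 * C\<^sub>V \<le> \<epsilon> / 4"
    using scale[of "m\<^sub>2 * C\<^sub>V" "\<epsilon> / 4"] \<epsilon> C\<^sub>V(1) m0 unfolding a_def by (auto simp: mult_ac)
  obtain c where c: "c \<ge> 0" "\<And>x h. \<bar>taylor_remainder f x h\<bar> \<le> a * (norm h)\<^sup>2 + c * norm h ^ 3"
    using taylor_remainder_cubic[OF f a(1)] by blast
  have "(\<lambda>k. \<gamma> k * D) \<longlonglongrightarrow> 0 * D" by (intro tendsto_intros \<gamma>)
  then have ev1: "eventually (\<lambda>k. \<gamma> k * D < \<epsilon> / 4) sequentially"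
    using \<epsilon> by (intro order_tendstoD(2)) auto
  have "(\<lambda>k. c * m\<^sub>3 * (A * sqrt A) * sqrt (\<gamma> k)) \<longlonglongrightarrow> c * m\<^sub>3 * (A * sqrt A) * sqrt 0" by (intro tendsto_intros \<gamma>)
  then have ev2: "eventually (\<lambda>k. c * m\<^sub>3 * (A * sqrt A) * sqrt (\<gamma> k) < \<epsilon> / 4) sequentially"
    using \<epsilon> by (intro order_tendstoD(2)) auto
  show ?thesis
    using ev1 ev2 jump
  proof eventually_elim
    case (elim k)
    let ?x = "y (k - 1)"
    let ?e = "\<bar>(transition f (\<gamma> k) ?x - f ?x) / \<gamma> k - generator b \<sigma> f ?x\<bar>"
    have W1: "1 + W ?x \<ge> 1" using W[of ?x] by simp
    have e\<epsilon>: "\<epsilon> / 4 \<le> \<epsilon> / 4 * (1 + W ?x)" using mult_left_mono[OF W1, of "\<epsilon> / 4"] \<epsilon> by simp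
    show ?case
    proof (cases "V ?x \<le> A")
      case True
      have "?e \<le> \<gamma> k * D + a * K\<^sup>2 * law.absolute_moment 2 * V ?x
          + c * K ^ 3 * law.absolute_moment 3 * (sqrt (\<gamma> k) * (V ?x * sqrt (V ?x)))"
        by (rule transition_expansion[OF f(1) B c(2) less_imp_le[OF a(1)] c(1) step_pos V(2) K D elim(3)])
      also have "\<dots> = \<gamma> k * D + a * m\<^sub>2 * V ?x + c * m\<^sub>3 * (V ?x * sqrt (V ?x)) * sqrt (\<gamma> k)"
        by (simp add: m\<^sub>2_def m\<^sub>3_def mult_ac)
      also have "a * m\<^sub>2 * V ?x \<le> a * m\<^sub>2 * (C\<^sub>V * (1 + W ?x))"
        using a(1) m0 by (intro mult_left_mono C\<^sub>V) auto
      also have "\<dots> \<le> \<epsilon> / 4 * (1 + W ?x)"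
        using mult_right_mono[OF a(2), of "1 + W ?x"] W1 by (simp add: mult.assoc)
      also have "c * m\<^sub>3 * (V ?x * sqrt (V ?x)) * sqrt (\<gamma> k) \<le> c * m\<^sub>3 * (A * sqrt A) * sqrt (\<gamma> k)"
        using c(1) m0 True V(2) A(1) step_pos[of k]
        by (intro mult_right_mono mult_left_mono mult_mono real_sqrt_le_mono) auto
      finally have "?e \<le> \<epsilon> / 4 + \<epsilon> / 4 * (1 + W ?x) + \<epsilon> / 4" using elim(1,2) by linarith
      also have "\<dots> \<le> 3 * (\<epsilon> / 4 * (1 + W ?x))" using e\<epsilon> by linarith
      also have "\<dots> \<le> \<epsilon> * (1 + W ?x)" using \<epsilon> W1 by simp
      finally show ?thesis .
    next
      case False
      then have VW: "V ?x \<le> \<delta> * W ?x" using A(2)[of ?x] by blast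
      \<comment> \<open>Taking \<open>c = 0\<close> removes the term in \<open>V * sqrt V\<close>,
        for which no bound by \<open>W\<close> is at hand here.\<close>
      have "?e \<le> \<gamma> k * D + Q * K\<^sup>2 * law.absolute_moment 2 * V ?x
          + 0 * K ^ 3 * law.absolute_moment 3 * (sqrt (\<gamma> k) * (V ?x * sqrt (V ?x)))"
        by (rule transition_expansion[OF f(1) B _ Q(1) order_refl step_pos V(2) K D elim(3)])
           (use Q(2) in simp)
      also have "\<dots> = \<gamma> k * D + Q * m\<^sub>2 * V ?x" by (simp add: m\<^sub>2_def mult_ac)
      also have "Q * m\<^sub>2 * V ?x \<le> Q * m\<^sub>2 * (\<delta> * W ?x)"
        using Q(1) m0 VW by (intro mult_left_mono) auto
      also have "\<dots> \<le> \<epsilon> / 2 * W ?x"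
        using mult_right_mono[OF \<delta>(2) W[of ?x]] by (simp add: mult.assoc)
      finally have "?e \<le> \<epsilon> / 4 * (1 + W ?x) + \<epsilon> / 2 * W ?x" using elim(1) e\<epsilon> by linarith
      also have "\<dots> \<le> \<epsilon> * (1 + W ?x)" using \<epsilon> mult_nonneg_nonneg[OF less_imp_le[OF \<epsilon>] W[of ?x]]
        by (simp add: algebra_simps)
      finally show ?thesis .
    qed
  qed
qed

end

text \<open>The square case suffices for the martingale: \<open>\<eta>\<^sub>n / (H\<^sub>n \<surd>\<gamma>\<^sub>n)\<close> is bounded, so its square is
  dominated by its power of exponent \<open>s \<le> 2\<close>, for which monotonicity is assumed.\<close>

lemma noise_variance_weights:
  assumes \<gamma>: "\<And>n. \<gamma> n > 0" and eta: "weight_sequence \<eta>" and sw: "step_weight \<gamma> \<eta>"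
  shows "\<exists>\<theta> C. decseq \<theta> \<and> (\<forall>n. \<theta> n \<ge> 0) \<and> summable (\<lambda>n. \<theta> n * \<gamma> (Suc n)) \<and> C \<ge> 0 \<and>
    (\<forall>n. (\<eta> (Suc n) / (\<gamma> (Suc n) * weight_total \<eta> (Suc n)))\<^sup>2 * \<gamma> (Suc n) \<le> C * (\<theta> n * \<gamma> (Suc n)))"
proof -
  let ?H = "weight_total \<eta>"
  let ?\<rho> = "\<lambda>n. \<eta> n / (?H n * sqrt (\<gamma> n))"
  obtain s where s: "1 < s" "s \<le> 2"
    and anti: "antimono_on {1..} (\<lambda>n. 1 / \<gamma> n * ?\<rho> n powr s)" and sum: "summable (\<lambda>n. ?\<rho> n powr s)"
    using sw unfolding step_weight_def by auto
  \<comment> \<open>The nonincreasing sequence of \<open>step_weight\<close>, shifted by one so that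
    \<open>\<theta> n\<close> accompanies the step from \<open>n\<close> to \<open>Suc n\<close> and
    index 0, where the total weight vanishes, is avoided.\<close>
  define \<theta> where "\<theta> n = 1 / \<gamma> (Suc n) * ?\<rho> (Suc n) powr s" for n
  have H: "?H (Suc n) > 0" for n
    unfolding weight_total_def using eta by (intro sum_pos) (auto simp: weight_sequence_def)
  have \<theta>\<gamma>: "\<theta> n * \<gamma> (Suc n) = ?\<rho> (Suc n) powr s" for n
    using \<gamma>[of "Suc n"] by (simp add: \<theta>_def)
  have \<rho>0: "?\<rho> (Suc n) \<ge> 0" for n
    using eta H[of n] \<gamma>[of "Suc n"] by (auto simp: weight_sequence_def intro!: divide_nonneg_nonneg less_imp_le)
  have "decseq \<theta>"
  proof (rule decseq_SucI)
    fix n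
    show "\<theta> (Suc n) \<le> \<theta> n"
      using monotone_onD[OF anti, of "Suc n" "Suc (Suc n)"] by (simp add: \<theta>_def)
  qed
  moreover have "\<theta> n \<ge> 0" for n using \<gamma>[of "Suc n"] by (simp add: \<theta>_def)
  moreover have sum': "summable (\<lambda>n. \<theta> n * \<gamma> (Suc n))"
    unfolding \<theta>\<gamma> using sum by (subst summable_Suc_iff)
  \<comment> \<open>Summability bounds the powers. As \<open>s > 1\<close> and
    \<open>R \<ge> 1\<close>, the same \<open>R\<close> bounds the base: a base above 1 is below its
    power.\<close>
  moreover obtain R where R: "\<And>n. ?\<rho> (Suc n) powr s \<le> R" "R \<ge> 1"
  proof -
    from summable_imp_Bseq[OF sum'] obtain R' where "\<And>n. norm (\<theta> n * \<gamma> (Suc n)) \<le> R'"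
      by (auto simp: Bseq_def)
    then have "\<And>n. ?\<rho> (Suc n) powr s \<le> max R' 1" unfolding \<theta>\<gamma> by (metis abs_ge_self max.coboundedI1 order_trans real_norm_def)
    then show ?thesis using that[of "max R' 1"] by auto
  qed
  moreover have "(\<eta> (Suc n) / (\<gamma> (Suc n) * ?H (Suc n)))\<^sup>2 * \<gamma> (Suc n) \<le> R powr (2 - s) * (\<theta> n * \<gamma> (Suc n))" for n
  proof -
    let ?r = "?\<rho> (Suc n)"
    have "(\<eta> (Suc n) / (\<gamma> (Suc n) * ?H (Suc n)))\<^sup>2 * \<gamma> (Suc n) = ?r\<^sup>2"
      using \<gamma>[of "Suc n"] by (simp add: power_divide power_mult_distrib power2_eq_square)
    also have "?r\<^sup>2 = ?r powr (2 - s) * ?r powr s"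
    proof -
      have "x\<^sup>2 = x powr (2 - s) * x powr s" if "x \<ge> 0" for x :: real
        using that by (cases "x = 0") (simp_all flip: powr_add)
      then show ?thesis using \<rho>0[of n] .
    qed
    also have "\<dots> \<le> R powr (2 - s) * ?r powr s"
    proof (intro mult_right_mono powr_mono2 \<rho>0)
      show "?r \<le> R"
      proof (cases "?r \<le> 1")
        case False
        have "x \<le> x powr s" if "1 < x" for x using powr_mono[of 1 s x] s that by simp
        with False R(1)[of n] show ?thesis by (meson not_le order_trans)
      qed (use R(2) in simp)
    qed (use s in auto)
    finally show ?thesis by (simp add: \<theta>\<gamma>)
  qed
  ultimately show ?thesis by (intro exI[of _ \<theta>] exI[of _ "R powr (2 - s)"]) auto
qed

section \<open>Assembly of the vanishing averages along almost every path\<close>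

context adaptive_euler
begin

text \<open>The probabilistic statements are first made simultaneous over countably many indices; on
  a single path outside the exceptional set, what remains is deterministic analysis.\<close>

lemma weighted_average_generator_tendsto_0:
  assumes f: "C2 f" "compact (closure {x. f x \<noteq> 0})"
    and V: "continuous_on UNIV V" "\<And>x. V x \<ge> 0" and jump: "jump_bound V K" and K: "K \<ge> 0"
    and W_meas [measurable]: "W \<in> borel_measurable borel" and W: "\<And>x. W x \<ge> 0"
    and o: "V \<in> o[at_infinity](W)"
    and \<gamma>: "\<gamma> \<longlonglongrightarrow> 0" and cap_pos: "\<And>n. AE \<omega> in M. cap n \<omega> > 0"
    and eta: "weight_sequence \<eta>" and sw: "step_weight \<gamma> \<eta>"
    and uncapped: "AE \<omega> in M. eventually (\<lambda>k. step k \<omega> = \<gamma> k) sequentially"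
    and \<alpha>: "\<alpha> > 0" and \<beta>: "\<beta> > 0"
    and drift: "\<And>n. n \<ge> n\<^sub>0 \<Longrightarrow> AE \<omega> in M.
      (enn2ereal (nn_cond_exp M (F n) (\<lambda>\<omega>'. ennreal (W (Y (Suc n) \<omega>'))) \<omega>) - ereal (W (Y n \<omega>)))
        / ereal (step (Suc n) \<omega>) \<le> ereal (- \<alpha> * W (Y n \<omega>) + \<beta>)"
    and W_avg: "AE \<omega> in M. \<exists>L. \<forall>n\<ge>1. (\<Sum>k=1..n. \<eta> k * W (Y (k - 1) \<omega>)) \<le> L * weight_total \<eta> n"
  shows "AE \<omega> in M. (\<lambda>n. 1 / weight_total \<eta> n * (\<Sum>k=1..n. \<eta> k * generator b \<sigma> f (Y (k - 1) \<omega>))) \<longlonglongrightarrow> 0"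
proof -
  let ?H = "weight_total \<eta>"
  \<comment> \<open>Kronecker's lemma needs the coefficient \<open>\<eta> k / \<gamma> k\<close>
    divided by the total weight; \<open>H k * c k\<close> restores it.\<close>
  define c where "c k = \<eta> k / (\<gamma> k * ?H k)" for k
  obtain \<theta> C where \<theta>: "decseq \<theta>" "\<And>n. \<theta> n \<ge> 0" "summable (\<lambda>n. \<theta> n * \<gamma> (Suc n))"
    and C: "C \<ge> 0" "\<And>n. (c (Suc n))\<^sup>2 * \<gamma> (Suc n) \<le> C * (\<theta> n * \<gamma> (Suc n))"
    using noise_variance_weights[OF step_pos eta sw] unfolding c_def by blast
  obtain C\<^sub>V where C\<^sub>V: "C\<^sub>V \<ge> 0" "\<And>x. V x \<le> C\<^sub>V * (1 + W x)"
    using smallo_affine_bound[OF V(1) o W] by blast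
  \<comment> \<open>These events increase to the whole space, so each path belongs to some
    \<open>A i\<close>.\<close>
  define A where "A i = {\<omega> \<in> space M. W (Y n\<^sub>0 \<omega>) \<le> real i}" for i
  have conv: "AE \<omega> in M. convergent (\<lambda>N. \<Sum>k=1..N. compensated f c n\<^sub>0 (A i) k \<omega>)" for i
  proof (rule compensated_convergent[OF f V jump K])
    have [measurable]: "Y n\<^sub>0 \<in> borel_measurable (F n\<^sub>0)" by (rule Y_measurable)
    have "{\<omega> \<in> space (F n\<^sub>0). W (Y n\<^sub>0 \<omega>) \<le> real i} \<in> sets (F n\<^sub>0)" by measurable
    then show A: "A i \<in> sets (F n\<^sub>0)" by (simp add: A_def)
    have [measurable]: "step (Suc n) \<in> borel_measurable M" for n by (rule F_M[OF step_measurable])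
    have [measurable]: "A i \<in> sets M" unfolding A_def by measurable
    define X where "X n = (\<integral>\<^sup>+ \<omega>. indicator (A i) \<omega> * ennreal (\<theta> n * step (Suc n) \<omega> * W (Y n \<omega>)) \<partial>M)" for n
    have X: "(\<Sum>n. X (n\<^sub>0 + n)) < \<infinity>"
      unfolding X_def
    proof (rule lyapunov_drift_summable[where F=F and g="\<lambda>n. step (Suc n)" and w="\<lambda>n \<omega>. W (Y n \<omega>)"
          and \<theta>=\<theta> and \<gamma>="\<lambda>n. \<gamma> (Suc n)" and c="real i" and \<alpha>=\<alpha> and \<beta>=\<beta>])
      fix n assume "n\<^sub>0 \<le> n"
      then show "AE \<omega> in M.
          (enn2ereal (nn_cond_exp M (F n) (\<lambda>\<omega>'. ennreal (W (Y (Suc n) \<omega>'))) \<omega>) - ereal (W (Y n \<omega>)))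
            / ereal (step (Suc n) \<omega>) \<le> ereal (- \<alpha> * W (Y n \<omega>) + \<beta>)"
        by (rule drift)
    next
      show "sets (F m) \<subseteq> sets (F n)" if "m \<le> n" for m n using that by (rule noise_filtration_mono)
    next
      show "AE \<omega> in M. 0 < step (Suc n) \<omega> \<and> step (Suc n) \<omega> \<le> \<gamma> (Suc n)" for n
        using cap_pos[of n] by eventually_elim (use step_pos in \<open>simp add: capped_step.simps\<close>)
    qed (use \<alpha> \<beta> \<theta> W A subalgebra_F in \<open>auto simp: A_def simp del: Y.simps\<close>)
    let ?J = "\<lambda>n. \<integral>\<^sup>+ \<omega>. indicator (A i \<inter> {\<omega>. step (Suc n) \<omega> = \<gamma> (Suc n)}) \<omega> *
        ennreal ((c (Suc n))\<^sup>2 * \<gamma> (Suc n) * V (Y n \<omega>)) \<partial>M"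
    \<comment> \<open>The affine bound on \<open>V\<close> by \<open>W\<close> splits the variance
      into a deterministic summable part and \<open>X n\<close>. On the uncapped event
      \<open>\<gamma> (Suc n)\<close> is the actual step, which is the one that the drift estimate
      controls.\<close>
    have J: "?J n \<le> ennreal (C * C\<^sub>V) * (ennreal (\<theta> n * \<gamma> (Suc n)) + X n)" for n
    proof -
      have "?J n \<le> (\<integral>\<^sup>+ \<omega>. ennreal (C * C\<^sub>V) * (ennreal (\<theta> n * \<gamma> (Suc n)) +
          indicator (A i) \<omega> * ennreal (\<theta> n * step (Suc n) \<omega> * W (Y n \<omega>))) \<partial>M)"
      proof (rule nn_integral_mono)
        fix \<omega>
        have p: "0 \<le> \<theta> n * \<gamma> (Suc n)" using \<theta>(2)[of n] step_pos[of "Suc n"] by simp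
        have "(c (Suc n))\<^sup>2 * \<gamma> (Suc n) * V (Y n \<omega>) \<le> (C * (\<theta> n * \<gamma> (Suc n))) * (C\<^sub>V * (1 + W (Y n \<omega>)))"
          by (rule mult_mono[OF C(2) C\<^sub>V(2)]) (use C(1) p V(2) in auto)
        also have "\<dots> = (C * C\<^sub>V) * (\<theta> n * \<gamma> (Suc n) + \<theta> n * \<gamma> (Suc n) * W (Y n \<omega>))"
          by (simp add: algebra_simps)
        finally have "ennreal ((c (Suc n))\<^sup>2 * \<gamma> (Suc n) * V (Y n \<omega>))
            \<le> ennreal ((C * C\<^sub>V) * (\<theta> n * \<gamma> (Suc n) + \<theta> n * \<gamma> (Suc n) * W (Y n \<omega>)))"
          by (rule ennreal_leI)
        also have "\<dots> = ennreal (C * C\<^sub>V) * (ennreal (\<theta> n * \<gamma> (Suc n)) + ennreal (\<theta> n * \<gamma> (Suc n) * W (Y n \<omega>)))"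
          using C(1) C\<^sub>V(1) p W[of "Y n \<omega>"] by (simp add: ennreal_mult ennreal_plus)
        finally show "indicator (A i \<inter> {\<omega>. step (Suc n) \<omega> = \<gamma> (Suc n)}) \<omega> *
          ennreal ((c (Suc n))\<^sup>2 * \<gamma> (Suc n) * V (Y n \<omega>)) \<le> ennreal (C * C\<^sub>V) * (ennreal (\<theta> n * \<gamma> (Suc n)) +
          indicator (A i) \<omega> * ennreal (\<theta> n * step (Suc n) \<omega> * W (Y n \<omega>)))"
          by (simp split: split_indicator)
      qed
      also have "\<dots> = ennreal (C * C\<^sub>V) * (ennreal (\<theta> n * \<gamma> (Suc n)) + X n)"
        unfolding X_def by (subst nn_integral_cmult) (simp_all add: nn_integral_add emeasure_space_1)
      finally show ?thesis .
    qed
    have "(\<Sum>n. ?J (n\<^sub>0 + n)) \<le> (\<Sum>n. ennreal (C * C\<^sub>V) * (ennreal (\<theta> (n\<^sub>0 + n) * \<gamma> (Suc (n\<^sub>0 + n))) + X (n\<^sub>0 + n)))"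
      by (intro suminf_le J) auto
    also have "\<dots> = ennreal (C * C\<^sub>V) * ((\<Sum>n. ennreal (\<theta> (n\<^sub>0 + n) * \<gamma> (Suc (n\<^sub>0 + n)))) + (\<Sum>n. X (n\<^sub>0 + n)))"
      by (simp add: suminf_add)
    also have "\<dots> < \<infinity>"
    proof -
      have "summable (\<lambda>n. \<theta> (n\<^sub>0 + n) * \<gamma> (Suc (n\<^sub>0 + n)))"
        using summable_ignore_initial_segment[OF \<theta>(3), of n\<^sub>0] by (simp add: add.commute)
      then have "(\<Sum>n. ennreal (\<theta> (n\<^sub>0 + n) * \<gamma> (Suc (n\<^sub>0 + n)))) \<noteq> top"
        by (intro ennreal_suminf_neq_top mult_nonneg_nonneg \<theta>(2) less_imp_le[OF step_pos])
      with X show ?thesis by (simp add: ennreal_mult_less_top less_top)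
    qed
    finally show "(\<Sum>n. ?J (n\<^sub>0 + n)) < \<infinity>" .
  qed
  \<comment> \<open>Convergence is needed for all \<open>i\<close> at once, since the
    \<open>i\<close> that suits a path depends on the path.\<close>
  have conv_all: "AE \<omega> in M. \<forall>i. convergent (\<lambda>N. \<Sum>k=1..N. compensated f c n\<^sub>0 (A i) k \<omega>)"
    using conv by (simp add: AE_all_countable)
  have frozen: "AE \<omega> in M. \<forall>n. step (Suc n) \<omega> = \<gamma> (Suc n) \<longrightarrow> (AE u in law.
    norm (euler_increment b \<sigma> (Y n \<omega>) (\<gamma> (Suc n)) u) \<le>
      K * sqrt (\<gamma> (Suc n)) * sqrt (V (Y n \<omega>)) * (1 + norm u))"
    by (subst AE_all_countable) (intro allI jump_frozen V jump)
  obtain B where B: "\<And>x. \<bar>f x\<bar> \<le> B" using C2_compact_support_bounded_lipschitz(1)[OF f] by blast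
  note H_top = weight_total_at_top[OF eta]
  have \<eta>pos: "\<eta> k > 0" if "k \<ge> 1" for k using eta that by (simp add: weight_sequence_def)
  have Hpos: "?H k > 0" if "k \<ge> 1" for k
    unfolding weight_total_def using that \<eta>pos by (intro sum_pos) auto
  show ?thesis
    using conv_all frozen uncapped W_avg AE_space
  proof eventually_elim
    case (elim \<omega>)
    define y where "y n = Y n \<omega>" for n
    obtain i where "W (Y n\<^sub>0 \<omega>) \<le> real i" using real_arch_simple by blast
    with elim(5) have \<omega>A: "\<omega> \<in> A i" by (simp add: A_def)
    define d where "d k = compensated f c n\<^sub>0 (A i) k \<omega>" for k
    let ?q = "\<lambda>k. \<eta> k / \<gamma> k"
    let ?tr = "\<lambda>k. transition f (\<gamma> k) (y (k - 1))"
    let ?r = "\<lambda>k. (?tr k - f (y (k - 1))) / \<gamma> k - generator b \<sigma> f (y (k - 1))"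
    let ?avg = "\<lambda>e n. 1 / ?H n * (\<Sum>k=1..n. e k)"
    from elim(4) obtain L where L: "\<And>n. n \<ge> 1 \<Longrightarrow> (\<Sum>k=1..n. \<eta> k * W (y (k - 1))) \<le> L * ?H n"
      unfolding y_def by blast
    have late: "eventually (\<lambda>k. k \<ge> Suc n\<^sub>0 \<and> step k \<omega> = \<gamma> k) sequentially"
      using elim(3) eventually_ge_at_top[of "Suc n\<^sub>0"] by eventually_elim simp
    have increments: "?avg (\<lambda>k. ?q k * (f (y k) - f (y (k - 1)))) \<longlonglongrightarrow> 0"
      by (rule weighted_increments_tendsto_0[OF eta sw step_pos B])
    have martingale: "?avg (\<lambda>k. ?H k * d k) \<longlonglongrightarrow> 0"
      using elim(1) unfolding d_def
      by (intro kronecker[OF weight_total_def H_top \<eta>pos]) auto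
    \<comment> \<open>From some index on the path is past \<open>n\<^sub>0\<close> and uncapped, so
      the true fluctuation equals \<open>?H k * d k\<close>; zero weights express that the
      difference eventually vanishes.\<close>
    have discarded: "?avg (\<lambda>k. ?q k * (f (y k) - ?tr k) - ?H k * d k) \<longlonglongrightarrow> 0"
    proof (rule weighted_average_tendsto_0[OF H_top, where \<eta>="\<lambda>_. 0" and w="\<lambda>_. 0" and L=0])
      fix \<epsilon> :: real
      show "eventually (\<lambda>k. \<bar>?q k * (f (y k) - ?tr k) - ?H k * d k\<bar> \<le> \<epsilon> * (0 * 0)) sequentially"
        using late
      proof eventually_elim
        case (elim k)
        then obtain n where n: "k = Suc n" "n\<^sub>0 \<le> n" by (cases k) auto
        have "d k = c k * (f (y k) - ?tr k)"
          using elim n \<omega>A by (simp add: d_def compensated_def y_def)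
        moreover have "?H k * c k = ?q k" using Hpos[of k] n by (simp add: c_def)
        ultimately show ?case by (simp add: mult.assoc[symmetric])
      qed
    qed auto
    have consistency: "?avg (\<lambda>k. \<eta> k * ?r k) \<longlonglongrightarrow> 0"
    proof (rule weighted_average_tendsto_0[OF H_top, where \<eta>=\<eta> and w="\<lambda>k. 1 + W (y (k - 1))" and L="1 + L"])
      show "0 \<le> \<eta> k * (1 + W (y (k - 1)))" if "1 \<le> k" for k
        using \<eta>pos[OF that] W[of "y (k - 1)"] by simp
      show "(\<Sum>k=1..n. \<eta> k * (1 + W (y (k - 1)))) \<le> (1 + L) * ?H n" if "1 \<le> n" for n
        using L[OF that] by (simp add: distrib_left distrib_right sum.distrib weight_total_def)
      fix \<epsilon> :: real assume \<epsilon>: "\<epsilon> > 0"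
      have "eventually (\<lambda>k. AE u in law. norm (euler_increment b \<sigma> (y (k - 1)) (\<gamma> k) u) \<le>
          K * sqrt (\<gamma> k) * sqrt (V (y (k - 1))) * (1 + norm u)) sequentially"
        using late
      proof eventually_elim
        case (elim k)
        then obtain n where n: "k = Suc n" by (cases k) auto
        show ?case
          using \<open>\<forall>n. step (Suc n) \<omega> = \<gamma> (Suc n) \<longrightarrow> _ n\<close>[rule_format, of n] elim unfolding n y_def by simp
      qed
      from consistency_error_negligible[OF f V W o \<gamma> K this \<epsilon>] eventually_ge_at_top[of 1]
      show "eventually (\<lambda>k. \<bar>\<eta> k * ?r k\<bar> \<le> \<epsilon> * (\<eta> k * (1 + W (y (k - 1))))) sequentially"
      proof eventually_elim
        case (elim k)
        from mult_left_mono[OF elim(1), of "\<eta> k"] \<eta>pos[OF elim(2)] show ?case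
          by (simp add: abs_mult mult_ac)
      qed
    qed
    \<comment> \<open>The increments minus fluctuations leave \<open>?q k\<close> times the kernel
      increment; subtracting \<open>\<eta> k * ?r k\<close> turns this into the generator
      term.\<close>
    have "(\<lambda>n. ?avg (\<lambda>k. ?q k * (f (y k) - f (y (k - 1)))) n - ?avg (\<lambda>k. ?q k * (f (y k) - ?tr k) - ?H k * d k) n
        - ?avg (\<lambda>k. ?H k * d k) n - ?avg (\<lambda>k. \<eta> k * ?r k) n) \<longlonglongrightarrow> 0 - 0 - 0 - 0"
      by (intro tendsto_diff increments discarded martingale consistency)
    moreover have "?avg (\<lambda>k. ?q k * (f (y k) - f (y (k - 1)))) n - ?avg (\<lambda>k. ?q k * (f (y k) - ?tr k) - ?H k * d k) n
        - ?avg (\<lambda>k. ?H k * d k) n - ?avg (\<lambda>k. \<eta> k * ?r k) n = ?avg (\<lambda>k. \<eta> k * generator b \<sigma> f (y (k - 1))) n" for n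
    proof -
      have "?q k * (f (y k) - f (y (k - 1))) - (?q k * (f (y k) - ?tr k) - ?H k * d k) - ?H k * d k - \<eta> k * ?r k
          = \<eta> k * generator b \<sigma> f (y (k - 1))" for k
        by (simp add: right_diff_distrib diff_divide_distrib)
      then show ?thesis
        by (simp only: right_diff_distrib[symmetric] sum_subtractf[symmetric])
    qed
    ultimately show ?case by (simp only: y_def diff_0_right)
  qed
qed

end

theorem proposition8:
  fixes M :: "'a measure"
    and b :: "real ^ 'd \<Rightarrow> real ^ 'd"
    and \<sigma> :: "real ^ 'd \<Rightarrow> real ^ 'm ^ 'd"
    and V W :: "real ^ 'd \<Rightarrow> real"
    and U :: "nat \<Rightarrow> 'a \<Rightarrow> real ^ 'm"
    and \<gamma> \<eta> :: "nat \<Rightarrow> real"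
    and cap :: "nat \<Rightarrow> 'a \<Rightarrow> real"
    and X :: "nat \<Rightarrow> 'a \<Rightarrow> real ^ 'd"
    and x\<^sub>0 :: "real ^ 'd"
    and n\<^sub>1 :: "'a \<Rightarrow> enat"
    and K \<alpha> \<beta> :: real
    and n\<^sub>0 :: nat
    and f :: "real ^ 'd \<Rightarrow> real"
  assumes "prob_space M"
    and "local_lipschitz (UNIV :: real set) UNIV (\<lambda>_. b)"
    and "local_lipschitz (UNIV :: real set) UNIV (\<lambda>_. \<sigma>)"
    and "lyapunov b \<sigma> V"
    and "subgaussian_noise M U"
    and "step_sequence \<gamma>"
    and "step_caps M U cap"
    and "euler_scheme M b \<sigma> \<gamma> cap U x\<^sub>0 X"
    and "weight_sequence \<eta>"
    and "step_weight \<gamma> \<eta>"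
    and "n\<^sub>1 \<in> measurable M (count_space UNIV)"
    and "AE \<omega> in M. n\<^sub>1 \<omega> < \<infinity>"
    and "AE \<omega> in M. \<forall>n. enat n \<ge> n\<^sub>1 \<omega> \<longrightarrow> capped_step \<gamma> cap n \<omega> = \<gamma> n"
    and "K > 0"
    and "\<forall>n\<ge>1. AE \<omega> in M. norm (X n \<omega> - X (n - 1) \<omega>) \<le>
           K * sqrt (\<gamma> n) * sqrt (V (X (n - 1) \<omega>)) * (1 + norm (U n \<omega>))"
    and "W \<in> borel_measurable borel"
    and "\<forall>x. W x \<ge> 0"
    and "\<alpha> > 0" and "\<beta> > 0"
    and "\<forall>n\<ge>n\<^sub>0. AE \<omega> in M.
           (enn2ereal (nn_cond_exp M (noise_filtration M U n) (\<lambda>\<omega>'. ennreal (W (X (n + 1) \<omega>'))) \<omega>)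
              - ereal (W (X n \<omega>))) / ereal (capped_step \<gamma> cap (n + 1) \<omega>)
           \<le> ereal (- \<alpha> * W (X n \<omega>) + \<beta>)"
    and "V \<in> o[at_infinity](W)"
    and "AE \<omega> in M. (SUP n\<in>{1..}. \<integral>\<^sup>+ x. ennreal (W x) \<partial>empirical_measure \<eta> X n \<omega>) < \<infinity>"
    and "C2 f"
    and "compact (closure {x. f x \<noteq> 0})"
  shows "AE \<omega> in M.
           (\<lambda>n. LINT x|empirical_measure \<eta> X n \<omega>. generator b \<sigma> f x) \<longlonglongrightarrow> 0"
proof -
  interpret prob_space M by fact
  have b: "continuous_on UNIV b" and \<sigma>: "continuous_on UNIV \<sigma>"
    using local_lipschitz_continuous_on[OF assms(2)] local_lipschitz_continuous_on[OF assms(3)] by auto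
  have \<gamma>: "\<And>n. \<gamma> n > 0" "\<gamma> \<longlonglongrightarrow> 0" using assms(6) by (auto simp: step_sequence_def)
  interpret adaptive_euler M b \<sigma> U \<gamma> cap x\<^sub>0
    using b \<sigma> assms(5,7) \<gamma> by unfold_locales (auto simp: step_caps_def)
  have X_meas [measurable]: "X n \<in> borel_measurable M" for n
    using assms(8) by (auto simp: euler_scheme_def)
  have V: "continuous_on UNIV V" "\<And>x. V x \<ge> 0"
    using assms(4) C2_continuous unfolding lyapunov_def by (blast, meson order_trans zero_le_one)
  have W: "\<And>x. W x \<ge> 0" using assms(17) by blast
  \<comment> \<open>\<open>X\<close> satisfies the recursion only up to null sets depending on
    \<open>n\<close>; passing to \<open>Y\<close> gives measurability with respect to the noise
    filtration.\<close>
  have XY: "AE \<omega> in M. X n \<omega> = Y n \<omega>" for n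
  proof (induction n)
    case 0
    then show ?case using assms(8) by (simp add: euler_scheme_def)
  next
    case (Suc n)
    have "AE \<omega> in M. X (n + 1) \<omega> =
        X n \<omega> + capped_step \<gamma> cap (n + 1) \<omega> *\<^sub>R b (X n \<omega>)
              + sqrt (capped_step \<gamma> cap (n + 1) \<omega>) *\<^sub>R (\<sigma> (X n \<omega>) *v U (n + 1) \<omega>)"
      using assms(8) unfolding euler_scheme_def by blast
    with Suc show ?case
      by eventually_elim (simp add: euler_increment_def add.assoc)
  qed
  then have XY_all: "AE \<omega> in M. \<forall>n. X n \<omega> = Y n \<omega>" by (simp add: AE_all_countable)
  have jump: "jump_bound V K"
    unfolding jump_bound_def
  proof
    fix n
    have "AE \<omega> in M. norm (X (Suc n) \<omega> - X n \<omega>) \<le>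
        K * sqrt (\<gamma> (Suc n)) * sqrt (V (X n \<omega>)) * (1 + norm (U (Suc n) \<omega>))"
      using assms(15)[rule_format, of "Suc n"] by simp
    then show "AE \<omega> in M. norm (Y (Suc n) \<omega> - Y n \<omega>) \<le>
        K * sqrt (\<gamma> (Suc n)) * sqrt (V (Y n \<omega>)) * (1 + norm (U (Suc n) \<omega>))"
      using XY_all
      by eventually_elim (simp del: Y.simps)
  qed
  have uncapped: "AE \<omega> in M. eventually (\<lambda>k. step k \<omega> = \<gamma> k) sequentially"
    using assms(12,13)
  proof eventually_elim
    case (elim \<omega>)
    then obtain N where "n\<^sub>1 \<omega> = enat N" by auto
    with elim(2) show ?case by (auto simp: eventually_sequentially)
  qed
  have drift: "AE \<omega> in M.
      (enn2ereal (nn_cond_exp M (F n) (\<lambda>\<omega>'. ennreal (W (Y (Suc n) \<omega>'))) \<omega>) - ereal (W (Y n \<omega>)))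
        / ereal (step (Suc n) \<omega>) \<le> ereal (- \<alpha> * W (Y n \<omega>) + \<beta>)" if n: "n \<ge> n\<^sub>0" for n
  proof -
    interpret S: finite_measure_subalgebra M "F n" by standard (rule subalgebra_F)
    have [measurable]: "W \<in> borel_measurable borel" by (rule assms(16))
    \<comment> \<open>Integrands that agree almost surely have the same conditional expectation
      almost surely, so the drift condition passes from \<open>X\<close> to
      \<open>Y\<close>.\<close>
    have "AE \<omega> in M. nn_cond_exp M (F n) (\<lambda>\<omega>'. ennreal (W (X (n + 1) \<omega>'))) \<omega> =
        nn_cond_exp M (F n) (\<lambda>\<omega>'. ennreal (W (Y (Suc n) \<omega>'))) \<omega>"
      by (rule S.nn_cond_exp_cong) (use XY[of "Suc n"] in \<open>auto simp del: Y.simps\<close>)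
    with assms(20)[rule_format, OF n] XY[of n] show ?thesis
      by eventually_elim simp
  qed
  have W_avg: "AE \<omega> in M. \<exists>L. \<forall>n\<ge>1. (\<Sum>k=1..n. \<eta> k * W (Y (k - 1) \<omega>)) \<le> L * weight_total \<eta> n"
    using assms(22) XY_all
  proof eventually_elim
    case (elim \<omega>)
    let ?I = "\<lambda>n. \<integral>\<^sup>+ x. ennreal (W x) \<partial>empirical_measure \<eta> X n \<omega>"
    \<comment> \<open>The finite supremum is a path-dependent bound for all averages of
      \<open>W\<close>; multiplied by the total weight it becomes the form required by the averaging
      lemma.\<close>
    obtain L where L: "L \<ge> 0" "(SUP n\<in>{1..}. ?I n) = ennreal L"
      using elim(1) unfolding less_top_ennreal infinity_ennreal_def by blast
    have "(\<Sum>k=1..n. \<eta> k * W (Y (k - 1) \<omega>)) \<le> L * weight_total \<eta> n" if n: "n \<ge> 1" for n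
    proof -
      have \<eta>0: "\<And>k. k \<ge> 1 \<Longrightarrow> \<eta> k > 0" using assms(9) by (simp add: weight_sequence_def)
      have H: "weight_total \<eta> n > 0"
        unfolding weight_total_def using n \<eta>0 by (intro sum_pos) auto
      have nn: "0 \<le> \<eta> k / weight_total \<eta> n" if "k \<in> {1..n}" for k
        using \<eta>0[of k] that H by simp
      have "?I n = (\<Sum>k=1..n. ennreal (\<eta> k / weight_total \<eta> n) * ennreal (W (X (k - 1) \<omega>)))"
        unfolding empirical_measure_def using assms(16)
        by (subst nn_integral_distr) (auto simp: nn_integral_point_measure_finite)
      also have "\<dots> = (\<Sum>k=1..n. ennreal (\<eta> k / weight_total \<eta> n * W (X (k - 1) \<omega>)))"
        using nn W by (intro sum.cong refl ennreal_mult[symmetric]) auto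
      also have "\<dots> = ennreal (\<Sum>k=1..n. \<eta> k / weight_total \<eta> n * W (X (k - 1) \<omega>))"
        by (intro sum_ennreal mult_nonneg_nonneg nn W)
      finally have "ennreal (\<Sum>k=1..n. \<eta> k / weight_total \<eta> n * W (X (k - 1) \<omega>)) \<le> ennreal L"
        using SUP_upper[of n "{1..}" ?I] n unfolding L(2) by simp
      then have "(\<Sum>k=1..n. \<eta> k / weight_total \<eta> n * W (X (k - 1) \<omega>)) \<le> L"
        using L(1) by (simp add: ennreal_le_iff)
      also have "(\<Sum>k=1..n. \<eta> k / weight_total \<eta> n * W (X (k - 1) \<omega>)) =
          (\<Sum>k=1..n. \<eta> k * W (Y (k - 1) \<omega>)) / weight_total \<eta> n"
        using elim(2) by (simp add: sum_divide_distrib)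
      finally show ?thesis using H by (simp add: pos_divide_le_eq)
    qed
    then show ?case by blast
  qed
  have avg: "AE \<omega> in M. (\<lambda>n. 1 / weight_total \<eta> n * (\<Sum>k=1..n. \<eta> k * generator b \<sigma> f (Y (k - 1) \<omega>))) \<longlonglongrightarrow> 0"
    by (rule weighted_average_generator_tendsto_0[OF assms(23,24) V jump _ assms(16) W assms(21) \<gamma>(2) _
          assms(9,10) uncapped assms(18,19) drift W_avg])
       (use assms(14,7) in \<open>auto simp: step_caps_def\<close>)
  have gen: "generator b \<sigma> f \<in> borel_measurable borel"
    by (intro borel_measurable_continuous_onI generator_continuous[OF assms(23) b \<sigma>])
  show ?thesis
    using avg XY_all by eventually_elim (simp add: integral_empirical_measure[OF assms(9) gen])
qed

end
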